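(* Let $G$ be a compact Lie group acting on the left on a quantizable symplectic manifold $(M,\omega)$ by symplectomorphisms, in a Hamiltonian way with moment map $\Phi$, let $(L,D)$ be a prequantum bundle on $M$, and assume that the prequantum data $(L,D)$ are $G$-invariant, with $\rho$ the corresponding action of $G$ on $C^\infty(L)$ generating $\mathcal P$. Let $\{A_t\}_t$ be a curve in $\mathfrak g$ with $A_0=0$ and let $\tau\in C^\infty(L)$. Then the solution $\tau_t$ to $$\frac{d\tau_t}{dt}=\mathcal P_{A_t}(\tau_t),\qquad \tau_0=\tau,$$ is given by $\tau_t=\rho(h_t)\tau$, where $h_t\in G$ is the solution to the Lax equation $$\dot h_th_t^{-1}=A_t,\qquad h_0=e.$$
   Context: Curves are smooth. For $A\in\mathfrak g$, $X_A$ is the vector field on $M$ generated by $A$, i.e. $X_A(q)=\frac{d}{du}\big|_{u=0}e^{uA}\cdot q$. The moment map $\Phi:M\to\mathfrak g^*$ satisfies $(d\Phi(Y))\cdot A=\omega(Y,X_A)$ for every vector field $Y$; put $f_A=\Phi\cdot A:M\to\mathbb R$, so that $\iota_{X_A}\omega=-df_A$, and one has $\{f_A,f_B\}=\omega(X_B,X_A)=f_{[A,B]}$. A prequantum bundle $(L,D)$ is a Hermitian line bundle $L$ over $M$ with a connection $D$ whose curvature is $-2\pi i\omega$. The prequantization map is $$A\in\mathfrak g\mapsto\mathcal P_A=-D_{X_A}-2\pi i f_A\in\mathrm{End}(C^\infty(L)).$$ The prequantum data $(L,D)$ are $G$-invariant if there is an action $\rho$ of $G$ on $C^\infty(L)$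 (a smooth linear action: $g\mapsto\rho(g)\tau$ is smooth for each $\tau$) which generates $\mathcal P$, i.e. $\frac{d}{du}\big|_{u=0}\rho(e^{uA})\tau=\mathcal P_A\tau$ for all $A\in\mathfrak g$, $\tau\in C^\infty(L)$. *)

theory Defs
  imports "HOL-Analysis.Analysis" "HOL-Algebra.Group"
begin

section \<open>Smooth maps between finite-dimensional normed spaces\<close>

text \<open>Model spaces of manifolds. Unlike \<^class>\<open>euclidean_space\<close>, this class admits the
  zero-dimensional space, so that finite groups are Lie groups.\<close>

class finite_dim_normed_space = real_normed_vector +
  assumes finite_dim: "\<exists>B. finite B \<and> (\<forall>x. \<exists>c. x = (\<Sum>b\<in>B. c b *\<^sub>R b))"

instance euclidean_space \<subseteq> finite_dim_normed_space
  by standard (metis finite_Basis euclidean_representation)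

text \<open>For open \<open>S\<close> in a finite-dimensional space it is enough, for \<open>C\<^sup>k\<close>, that the derivative is
  \<open>C\<^sup>k\<^sup>-\<^sup>1\<close> in each fixed direction \<open>v\<close>.\<close>

primrec Ck_on :: "nat \<Rightarrow> 'a set \<Rightarrow> ('a::real_normed_vector \<Rightarrow> 'b::real_normed_vector) \<Rightarrow> bool" where
  "Ck_on 0 S f \<longleftrightarrow> continuous_on S f"
| "Ck_on (Suc k) S f \<longleftrightarrow>
     (\<exists>f'. (\<forall>x\<in>S. (f has_derivative f' x) (at x)) \<and> (\<forall>v. Ck_on k S (\<lambda>x. f' x v)))"

text \<open>On an arbitrary set, smooth means locally extendable to a smooth map on an open set; this is
  needed for curves on intervals that need not be open.\<close>

definition smooth_on :: "'a set \<Rightarrow> ('a::real_normed_vector \<Rightarrow> 'b::real_normed_vector) \<Rightarrow> bool" where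
  "smooth_on S f \<longleftrightarrow>
     (\<forall>x\<in>S. \<exists>T g. open T \<and> x \<in> T \<and> (\<forall>k. Ck_on k T g) \<and> (\<forall>y\<in>S \<inter> T. g y = f y))"


section \<open>Manifolds\<close>

text \<open>The underlying set of a manifold is a whole type; a chart is a pair of a domain and a
  coordinate map, whose values outside the domain are irrelevant.\<close>

type_synonym ('m, 'e) atlas = "('m set \<times> ('m \<Rightarrow> 'e)) set"

definition smooth_atlas ::
  "('m::{t2_space, second_countable_topology}, 'e::finite_dim_normed_space) atlas \<Rightarrow> bool" where
  "smooth_atlas \<A> \<longleftrightarrow>
     (\<forall>p. \<exists>(U, \<phi>)\<in>\<A>. p \<in> U) \<and>
     (\<forall>(U, \<phi>)\<in>\<A>. open U \<and> open (\<phi> ` U) \<and> homeomorphism U (\<phi> ` U) \<phi> (inv_into U \<phi>)) \<and>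
     (\<forall>(U, \<phi>)\<in>\<A>. \<forall>(V, \<psi>)\<in>\<A>. smooth_on (\<phi> ` (U \<inter> V)) (\<psi> \<circ> inv_into U \<phi>))"

definition std_atlas :: "('e, 'e) atlas" where
  "std_atlas = {(UNIV, id)}"

definition prod_atlas :: "('m, 'e) atlas \<Rightarrow> ('n, 'f) atlas \<Rightarrow> ('m \<times> 'n, 'e \<times> 'f) atlas" where
  "prod_atlas \<A> \<B> = {(U \<times> V, map_prod \<phi> \<psi>) |U \<phi> V \<psi>. (U, \<phi>) \<in> \<A> \<and> (V, \<psi>) \<in> \<B>}"

definition smooth_map_on ::
  "('m::topological_space, 'e::real_normed_vector) atlas \<Rightarrow> 'm set \<Rightarrow>
   ('n::topological_space, 'f::real_normed_vector) atlas \<Rightarrow> ('m \<Rightarrow> 'n) \<Rightarrow> bool" where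
  "smooth_map_on \<A> S \<B> F \<longleftrightarrow> continuous_on S F \<and>
     (\<forall>(U, \<phi>)\<in>\<A>. \<forall>(V, \<psi>)\<in>\<B>.
        smooth_on (\<phi> ` {p \<in> S \<inter> U. F p \<in> V}) (\<psi> \<circ> F \<circ> inv_into U \<phi>))"

abbreviation smooth_fun_on ::
  "('m::topological_space, 'e::real_normed_vector) atlas \<Rightarrow> 'm set \<Rightarrow>
   ('m \<Rightarrow> 'b::real_normed_vector) \<Rightarrow> bool" where
  "smooth_fun_on \<A> S f \<equiv> smooth_map_on \<A> S std_atlas f"

definition smooth_near ::
  "('m::topological_space, 'e::real_normed_vector) atlas \<Rightarrow> 'm \<Rightarrow>
   ('m \<Rightarrow> 'b::real_normed_vector) \<Rightarrow> bool" where
  "smooth_near \<A> p f \<longleftrightarrow> (\<exists>U. open U \<and> p \<in> U \<and> smooth_fun_on \<A> U f)"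


section \<open>Tangent vectors, vector fields and two-forms\<close>

text \<open>A tangent vector at \<open>p\<close> is an equivalence class of curves through \<open>p\<close>, represented by the
  functional it induces on real functions that are smooth near \<open>p\<close>; it is \<open>0\<close> on all other
  functions, so that distinct functionals are distinct tangent vectors.\<close>

type_synonym 'm tvec = "('m \<Rightarrow> real) \<Rightarrow> real"

definition tzero :: "'m tvec" where "tzero = (\<lambda>f. 0)"
definition tadd :: "'m tvec \<Rightarrow> 'm tvec \<Rightarrow> 'm tvec" where "tadd v w = (\<lambda>f. v f + w f)"
definition tscale :: "real \<Rightarrow> 'm tvec \<Rightarrow> 'm tvec" where "tscale a v = (\<lambda>f. a * v f)"

definition velocity ::
  "('m::topological_space, 'e::real_normed_vector) atlas \<Rightarrow> real set \<Rightarrow> (real \<Rightarrow> 'm) \<Rightarrow> real \<Rightarrow> 'm tvec" where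
  "velocity \<A> I c t =
     (\<lambda>f. if smooth_near \<A> (c t) f then vector_derivative (\<lambda>s. f (c s)) (at t within I) else 0)"

definition tangent_space ::
  "('m::topological_space, 'e::real_normed_vector) atlas \<Rightarrow> 'm \<Rightarrow> 'm tvec set" where
  "tangent_space \<A> p = {velocity \<A> UNIV c 0 |c.
     c 0 = p \<and> (\<exists>\<epsilon>>0. smooth_map_on std_atlas {-\<epsilon><..<\<epsilon>} \<A> c)}"

definition pushforward ::
  "('n::topological_space, 'f::real_normed_vector) atlas \<Rightarrow> ('m \<Rightarrow> 'n) \<Rightarrow> 'm \<Rightarrow> 'm tvec \<Rightarrow> 'n tvec" where
  "pushforward \<B> F p v = (\<lambda>f. if smooth_near \<B> (F p) f then v (f \<circ> F) else 0)"

definition smooth_vf ::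
  "('m::topological_space, 'e::real_normed_vector) atlas \<Rightarrow> 'm set \<Rightarrow> ('m \<Rightarrow> 'm tvec) \<Rightarrow> bool" where
  "smooth_vf \<A> U X \<longleftrightarrow>
     (\<forall>p\<in>U. X p \<in> tangent_space \<A> p) \<and>
     (\<forall>V f. open V \<longrightarrow> V \<subseteq> U \<longrightarrow> smooth_fun_on \<A> V f \<longrightarrow> smooth_fun_on \<A> V (\<lambda>p. X p f))"

definition vf_bracket ::
  "('m::topological_space, 'e::real_normed_vector) atlas \<Rightarrow>
   ('m \<Rightarrow> 'm tvec) \<Rightarrow> ('m \<Rightarrow> 'm tvec) \<Rightarrow> 'm \<Rightarrow> 'm tvec" where
  "vf_bracket \<A> X Y p =
     (\<lambda>f. if smooth_near \<A> p f then X p (\<lambda>q. Y q f) - Y p (\<lambda>q. X q f) else 0)"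

definition two_form ::
  "('m::topological_space, 'e::real_normed_vector) atlas \<Rightarrow>
   ('m \<Rightarrow> 'm tvec \<Rightarrow> 'm tvec \<Rightarrow> real) \<Rightarrow> bool" where
  "two_form \<A> \<omega> \<longleftrightarrow>
     (\<forall>p. \<forall>u\<in>tangent_space \<A> p. \<forall>v\<in>tangent_space \<A> p. \<forall>w\<in>tangent_space \<A> p. \<forall>a b.
        \<omega> p (tadd (tscale a u) (tscale b v)) w = a * \<omega> p u w + b * \<omega> p v w) \<and>
     (\<forall>p. \<forall>v\<in>tangent_space \<A> p. \<forall>w\<in>tangent_space \<A> p. \<omega> p v w = - \<omega> p w v) \<and>
     (\<forall>U X Y. open U \<longrightarrow> smooth_vf \<A> U X \<longrightarrow> smooth_vf \<A> U Y \<longrightarrow>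
        smooth_fun_on \<A> U (\<lambda>p. \<omega> p (X p) (Y p)))"

text \<open>The value \<open>d\<omega>(X, Y, Z)\<close> at \<open>p\<close>, by the invariant formula for the exterior derivative.\<close>

definition ext_deriv2 ::
  "('m::topological_space, 'e::real_normed_vector) atlas \<Rightarrow>
   ('m \<Rightarrow> 'm tvec \<Rightarrow> 'm tvec \<Rightarrow> real) \<Rightarrow>
   ('m \<Rightarrow> 'm tvec) \<Rightarrow> ('m \<Rightarrow> 'm tvec) \<Rightarrow> ('m \<Rightarrow> 'm tvec) \<Rightarrow> 'm \<Rightarrow> real" where
  "ext_deriv2 \<A> \<omega> X Y Z p =
     X p (\<lambda>q. \<omega> q (Y q) (Z q)) - Y p (\<lambda>q. \<omega> q (X q) (Z q)) + Z p (\<lambda>q. \<omega> q (X q) (Y q))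
     - \<omega> p (vf_bracket \<A> X Y p) (Z p)
     + \<omega> p (vf_bracket \<A> X Z p) (Y p)
     - \<omega> p (vf_bracket \<A> Y Z p) (X p)"

definition symplectic_manifold ::
  "('m::{t2_space, second_countable_topology}, 'e::finite_dim_normed_space) atlas \<Rightarrow>
   ('m \<Rightarrow> 'm tvec \<Rightarrow> 'm tvec \<Rightarrow> real) \<Rightarrow> bool" where
  "symplectic_manifold \<A> \<omega> \<longleftrightarrow>
     smooth_atlas \<A> \<and> two_form \<A> \<omega> \<and>
     (\<forall>U X Y Z. open U \<longrightarrow> smooth_vf \<A> U X \<longrightarrow> smooth_vf \<A> U Y \<longrightarrow> smooth_vf \<A> U Z \<longrightarrow>
        (\<forall>p\<in>U. ext_deriv2 \<A> \<omega> X Y Z p = 0)) \<and>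
     (\<forall>p. \<forall>v\<in>tangent_space \<A> p. (\<forall>w\<in>tangent_space \<A> p. \<omega> p v w = 0) \<longrightarrow> v = tzero)"

definition symplectomorphism ::
  "('m::topological_space, 'e::real_normed_vector) atlas \<Rightarrow>
   ('m \<Rightarrow> 'm tvec \<Rightarrow> 'm tvec \<Rightarrow> real) \<Rightarrow> ('m \<Rightarrow> 'm) \<Rightarrow> bool" where
  "symplectomorphism \<A> \<omega> F \<longleftrightarrow>
     bij F \<and> smooth_map_on \<A> UNIV \<A> F \<and> smooth_map_on \<A> UNIV \<A> (inv_into UNIV F) \<and>
     (\<forall>p. \<forall>v\<in>tangent_space \<A> p. \<forall>w\<in>tangent_space \<A> p.
        \<omega> (F p) (pushforward \<A> F p v) (pushforward \<A> F p w) = \<omega> p v w)"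


section \<open>Lie groups\<close>

definition lie_group ::
  "('g::{t2_space, second_countable_topology}) monoid \<Rightarrow>
   ('g, 'a::finite_dim_normed_space) atlas \<Rightarrow> bool" where
  "lie_group G \<G> \<longleftrightarrow>
     group G \<and> carrier G = UNIV \<and> smooth_atlas \<G> \<and>
     smooth_map_on (prod_atlas \<G> \<G>) UNIV \<G> (\<lambda>(x, y). x \<otimes>\<^bsub>G\<^esub> y) \<and>
     smooth_map_on \<G> UNIV \<G> (\<lambda>x. inv\<^bsub>G\<^esub> x)"

definition compact_lie_group ::
  "('g::{t2_space, second_countable_topology}) monoid \<Rightarrow>
   ('g, 'a::finite_dim_normed_space) atlas \<Rightarrow> bool" where
  "compact_lie_group G \<G> \<longleftrightarrow> lie_group G \<G> \<and> compact (UNIV :: 'g set)"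

definition lie_algebra ::
  "('g::topological_space) monoid \<Rightarrow> ('g, 'a::real_normed_vector) atlas \<Rightarrow> 'g tvec set" where
  "lie_algebra G \<G> = tangent_space \<G> \<one>\<^bsub>G\<^esub>"

definition left_invariant_vf :: "'g monoid \<Rightarrow> 'g tvec \<Rightarrow> 'g \<Rightarrow> 'g tvec" where
  "left_invariant_vf G A = (\<lambda>g f. A (\<lambda>x. f (g \<otimes>\<^bsub>G\<^esub> x)))"

definition lie_bracket ::
  "('g::topological_space) monoid \<Rightarrow> ('g, 'a::real_normed_vector) atlas \<Rightarrow>
   'g tvec \<Rightarrow> 'g tvec \<Rightarrow> 'g tvec" where
  "lie_bracket G \<G> A B =
     vf_bracket \<G> (left_invariant_vf G A) (left_invariant_vf G B) \<one>\<^bsub>G\<^esub>"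

definition one_parameter_subgroup ::
  "('g::topological_space) monoid \<Rightarrow> ('g, 'a::real_normed_vector) atlas \<Rightarrow> (real \<Rightarrow> 'g) \<Rightarrow> bool" where
  "one_parameter_subgroup G \<G> \<gamma> \<longleftrightarrow>
     smooth_map_on std_atlas UNIV \<G> \<gamma> \<and> (\<forall>s t. \<gamma> (s + t) = \<gamma> s \<otimes>\<^bsub>G\<^esub> \<gamma> t)"

definition lie_exp ::
  "('g::topological_space) monoid \<Rightarrow> ('g, 'a::real_normed_vector) atlas \<Rightarrow> 'g tvec \<Rightarrow> 'g" where
  "lie_exp G \<G> A = (THE \<gamma>. one_parameter_subgroup G \<G> \<gamma> \<and> velocity \<G> UNIV \<gamma> 0 = A) 1"

text \<open>Smoothness in the finite-dimensional space \<open>\<gg>\<close>: the evaluations \<open>A \<mapsto> A f\<close> span its dual.\<close>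

definition smooth_lie_algebra_curve ::
  "('g::topological_space) monoid \<Rightarrow> ('g, 'a::real_normed_vector) atlas \<Rightarrow>
   real set \<Rightarrow> (real \<Rightarrow> 'g tvec) \<Rightarrow> bool" where
  "smooth_lie_algebra_curve G \<G> I A \<longleftrightarrow>
     (\<forall>t\<in>I. A t \<in> lie_algebra G \<G>) \<and>
     (\<forall>f. smooth_near \<G> \<one>\<^bsub>G\<^esub> f \<longrightarrow> smooth_on I (\<lambda>t. A t f))"

definition lax_solution ::
  "('g::topological_space) monoid \<Rightarrow> ('g, 'a::real_normed_vector) atlas \<Rightarrow>
   real set \<Rightarrow> (real \<Rightarrow> 'g tvec) \<Rightarrow> (real \<Rightarrow> 'g) \<Rightarrow> bool" where
  "lax_solution G \<G> I A h \<longleftrightarrow>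
     smooth_map_on std_atlas I \<G> h \<and> h 0 = \<one>\<^bsub>G\<^esub> \<and>
     (\<forall>t\<in>I. pushforward \<G> (\<lambda>x. x \<otimes>\<^bsub>G\<^esub> inv\<^bsub>G\<^esub> (h t)) (h t) (velocity \<G> I h t) = A t)"


section \<open>Hamiltonian actions\<close>

definition lie_group_action ::
  "('g::topological_space) monoid \<Rightarrow> ('g, 'a::real_normed_vector) atlas \<Rightarrow>
   ('m::topological_space, 'e::real_normed_vector) atlas \<Rightarrow> ('g \<Rightarrow> 'm \<Rightarrow> 'm) \<Rightarrow> bool" where
  "lie_group_action G \<G> \<A> act \<longleftrightarrow>
     smooth_map_on (prod_atlas \<G> \<A>) UNIV \<A> (\<lambda>(g, q). act g q) \<and>
     (\<forall>q. act \<one>\<^bsub>G\<^esub> q = q) \<and> (\<forall>g h q. act (g \<otimes>\<^bsub>G\<^esub> h) q = act g (act h q))"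

definition generated_vf ::
  "('g::topological_space) monoid \<Rightarrow> ('g, 'a::real_normed_vector) atlas \<Rightarrow>
   ('m::topological_space, 'e::real_normed_vector) atlas \<Rightarrow> ('g \<Rightarrow> 'm \<Rightarrow> 'm) \<Rightarrow>
   'g tvec \<Rightarrow> 'm \<Rightarrow> 'm tvec" where
  "generated_vf G \<G> \<A> act A q = velocity \<A> UNIV (\<lambda>u. act (lie_exp G \<G> (tscale u A)) q) 0"

text \<open>The moment map has values in the dual of the Lie algebra: \<open>\<Phi> q A\<close> is \<open>f\<^sub>A(q) = \<Phi>(q) \<cdot> A\<close>.\<close>

definition moment_map ::
  "('g::topological_space) monoid \<Rightarrow> ('g, 'a::real_normed_vector) atlas \<Rightarrow>
   ('m::topological_space, 'e::real_normed_vector) atlas \<Rightarrow> ('g \<Rightarrow> 'm \<Rightarrow> 'm) \<Rightarrow>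
   ('m \<Rightarrow> 'm tvec \<Rightarrow> 'm tvec \<Rightarrow> real) \<Rightarrow> ('m \<Rightarrow> 'g tvec \<Rightarrow> real) \<Rightarrow> bool" where
  "moment_map G \<G> \<A> act \<omega> \<Phi> \<longleftrightarrow>
     (\<forall>q. \<forall>A\<in>lie_algebra G \<G>. \<forall>B\<in>lie_algebra G \<G>. \<forall>a b.
        \<Phi> q (tadd (tscale a A) (tscale b B)) = a * \<Phi> q A + b * \<Phi> q B) \<and>
     (\<forall>A\<in>lie_algebra G \<G>. smooth_fun_on \<A> UNIV (\<lambda>q. \<Phi> q A)) \<and>
     (\<forall>A\<in>lie_algebra G \<G>. \<forall>Y. smooth_vf \<A> UNIV Y \<longrightarrow>
        (\<forall>q. Y q (\<lambda>p. \<Phi> p A) = \<omega> q (Y q) (generated_vf G \<G> \<A> act A q))) \<and>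
     (\<forall>A\<in>lie_algebra G \<G>. \<forall>B\<in>lie_algebra G \<G>. \<forall>q.
        \<omega> q (generated_vf G \<G> \<A> act B q) (generated_vf G \<G> \<A> act A q)
          = \<Phi> q (lie_bracket G \<G> A B))"


section \<open>Hermitian line bundles with connection\<close>

text \<open>The smooth structure of the bundle is given by local trivialisations: pairs of an open set
  \<open>U\<close> of the base and the fibre coordinate \<open>\<theta>\<close> on the part of the total space over \<open>U\<close>.\<close>

record ('m, 'l) line_bundle =
  lb_proj :: "'l \<Rightarrow> 'm"
  lb_add :: "'l \<Rightarrow> 'l \<Rightarrow> 'l"
  lb_scale :: "complex \<Rightarrow> 'l \<Rightarrow> 'l"
  lb_herm :: "'l \<Rightarrow> 'l \<Rightarrow> complex"
  lb_trivs :: "('m set \<times> ('l \<Rightarrow> complex)) set"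

definition fibre :: "('m, 'l) line_bundle \<Rightarrow> 'm \<Rightarrow> 'l set" where
  "fibre L q = {x. lb_proj L x = q}"

text \<open>The fibre coordinates transport the vector space structure of the complex numbers, so the
  vector space axioms for the fibres need not be listed.\<close>

definition complex_line_bundle ::
  "('m::topological_space, 'e::real_normed_vector) atlas \<Rightarrow> ('m, 'l) line_bundle \<Rightarrow> bool" where
  "complex_line_bundle \<A> L \<longleftrightarrow>
     (\<forall>q. \<exists>(U, \<theta>)\<in>lb_trivs L. q \<in> U) \<and>
     (\<forall>(U, \<theta>)\<in>lb_trivs L. open U \<and> (\<forall>q\<in>U.
        bij_betw \<theta> (fibre L q) UNIV \<and>
        (\<forall>x\<in>fibre L q. \<forall>y\<in>fibre L q.
           lb_add L x y \<in> fibre L q \<and> \<theta> (lb_add L x y) = \<theta> x + \<theta> y) \<and>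
        (\<forall>c. \<forall>x\<in>fibre L q. lb_scale L c x \<in> fibre L q \<and> \<theta> (lb_scale L c x) = c * \<theta> x))) \<and>
     (\<forall>(U, \<theta>)\<in>lb_trivs L. \<forall>(V, \<psi>)\<in>lb_trivs L.
        smooth_fun_on \<A> (U \<inter> V) (\<lambda>q. \<psi> (inv_into (fibre L q) \<theta> 1)))"

definition smooth_section_on ::
  "('m::topological_space, 'e::real_normed_vector) atlas \<Rightarrow> ('m, 'l) line_bundle \<Rightarrow>
   'm set \<Rightarrow> ('m \<Rightarrow> 'l) \<Rightarrow> bool" where
  "smooth_section_on \<A> L U s \<longleftrightarrow>
     (\<forall>q\<in>U. s q \<in> fibre L q) \<and> (\<forall>(V, \<theta>)\<in>lb_trivs L. smooth_fun_on \<A> (U \<inter> V) (\<lambda>q. \<theta> (s q)))"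

definition smooth_sections ::
  "('m::topological_space, 'e::real_normed_vector) atlas \<Rightarrow> ('m, 'l) line_bundle \<Rightarrow> ('m \<Rightarrow> 'l) set" where
  "smooth_sections \<A> L = {s. smooth_section_on \<A> L UNIV s}"

definition section_near ::
  "('m::topological_space, 'e::real_normed_vector) atlas \<Rightarrow> ('m, 'l) line_bundle \<Rightarrow>
   'm \<Rightarrow> ('m \<Rightarrow> 'l) \<Rightarrow> bool" where
  "section_near \<A> L q s \<longleftrightarrow> (\<exists>U. open U \<and> q \<in> U \<and> smooth_section_on \<A> L U s)"

definition hermitian_metric ::
  "('m::topological_space, 'e::real_normed_vector) atlas \<Rightarrow> ('m, 'l) line_bundle \<Rightarrow> bool" where
  "hermitian_metric \<A> L \<longleftrightarrow>
     (\<forall>q. \<forall>x\<in>fibre L q. \<forall>y\<in>fibre L q. \<forall>z\<in>fibre L q. \<forall>c.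
        lb_herm L (lb_add L x y) z = lb_herm L x z + lb_herm L y z \<and>
        lb_herm L (lb_scale L c x) z = c * lb_herm L x z \<and>
        lb_herm L y x = cnj (lb_herm L x y) \<and>
        (x \<noteq> lb_scale L 0 x \<longrightarrow> 0 < Re (lb_herm L x x))) \<and>
     (\<forall>U r s. open U \<longrightarrow> smooth_section_on \<A> L U r \<longrightarrow> smooth_section_on \<A> L U s \<longrightarrow>
        smooth_fun_on \<A> U (\<lambda>q. lb_herm L (r q) (s q)))"

definition tvec_complex :: "'m tvec \<Rightarrow> ('m \<Rightarrow> complex) \<Rightarrow> complex" where
  "tvec_complex v f = Complex (v (\<lambda>p. Re (f p))) (v (\<lambda>p. Im (f p)))"

text \<open>\<open>D q v s\<close> is the covariant derivative at \<open>q\<close>, in the direction of the tangent vector \<open>v\<close>, of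
  a section \<open>s\<close> defined near \<open>q\<close>: the connection is given together with its restrictions to
  open sets. Complex linearity in \<open>s\<close> is the Leibniz rule for constant \<open>f\<close>. No compatibility with
  the Hermitian metric is imposed.\<close>

definition connection ::
  "('m::topological_space, 'e::real_normed_vector) atlas \<Rightarrow> ('m, 'l) line_bundle \<Rightarrow>
   ('m \<Rightarrow> 'm tvec \<Rightarrow> ('m \<Rightarrow> 'l) \<Rightarrow> 'l) \<Rightarrow> bool" where
  "connection \<A> L D \<longleftrightarrow>
     (\<forall>q s. section_near \<A> L q s \<longrightarrow>
       (\<forall>v\<in>tangent_space \<A> q.
          D q v s \<in> fibre L q \<and>
          (\<forall>w\<in>tangent_space \<A> q. \<forall>a b.
             D q (tadd (tscale a v) (tscale b w)) s
               = lb_add L (lb_scale L (of_real a) (D q v s)) (lb_scale L (of_real b) (D q w s))) \<and>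
          (\<forall>r. section_near \<A> L q r \<longrightarrow>
             D q v (\<lambda>p. lb_add L (s p) (r p)) = lb_add L (D q v s) (D q v r)) \<and>
          (\<forall>f. smooth_near \<A> q f \<longrightarrow>
             D q v (\<lambda>p. lb_scale L (f p) (s p))
               = lb_add L (lb_scale L (tvec_complex v f) (s q)) (lb_scale L (f q) (D q v s))) \<and>
          (\<forall>r. section_near \<A> L q r \<longrightarrow> (\<exists>U. open U \<and> q \<in> U \<and> (\<forall>p\<in>U. r p = s p)) \<longrightarrow>
             D q v r = D q v s))) \<and>
     (\<forall>U X s. open U \<longrightarrow> smooth_vf \<A> U X \<longrightarrow> smooth_section_on \<A> L U s \<longrightarrow>
        smooth_section_on \<A> L U (\<lambda>q. D q (X q) s))"

text \<open>The value at \<open>q\<close> of \<open>D\<^sub>X D\<^sub>Y s - D\<^sub>Y D\<^sub>X s - D\<^bsub>[X,Y]\<^esub> s\<close>.\<close>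

definition curvature ::
  "('m::topological_space, 'e::real_normed_vector) atlas \<Rightarrow> ('m, 'l) line_bundle \<Rightarrow>
   ('m \<Rightarrow> 'm tvec \<Rightarrow> ('m \<Rightarrow> 'l) \<Rightarrow> 'l) \<Rightarrow>
   ('m \<Rightarrow> 'm tvec) \<Rightarrow> ('m \<Rightarrow> 'm tvec) \<Rightarrow> ('m \<Rightarrow> 'l) \<Rightarrow> 'm \<Rightarrow> 'l" where
  "curvature \<A> L D X Y s q =
     lb_add L (D q (X q) (\<lambda>p. D p (Y p) s))
       (lb_add L (lb_scale L (-1) (D q (Y q) (\<lambda>p. D p (X p) s)))
                 (lb_scale L (-1) (D q (vf_bracket \<A> X Y q) s)))"

definition prequantum_bundle ::
  "('m::topological_space, 'e::real_normed_vector) atlas \<Rightarrow>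
   ('m \<Rightarrow> 'm tvec \<Rightarrow> 'm tvec \<Rightarrow> real) \<Rightarrow> ('m, 'l) line_bundle \<Rightarrow>
   ('m \<Rightarrow> 'm tvec \<Rightarrow> ('m \<Rightarrow> 'l) \<Rightarrow> 'l) \<Rightarrow> bool" where
  "prequantum_bundle \<A> \<omega> L D \<longleftrightarrow>
     complex_line_bundle \<A> L \<and> hermitian_metric \<A> L \<and> connection \<A> L D \<and>
     (\<forall>U X Y s. open U \<longrightarrow> smooth_vf \<A> U X \<longrightarrow> smooth_vf \<A> U Y \<longrightarrow> smooth_section_on \<A> L U s \<longrightarrow>
        (\<forall>q\<in>U. curvature \<A> L D X Y s q
                 = lb_scale L (- 2 * of_real pi * \<i> * of_real (\<omega> q (X q) (Y q))) (s q)))"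

definition prequantization ::
  "('g::topological_space) monoid \<Rightarrow> ('g, 'a::real_normed_vector) atlas \<Rightarrow>
   ('m::topological_space, 'e::real_normed_vector) atlas \<Rightarrow> ('g \<Rightarrow> 'm \<Rightarrow> 'm) \<Rightarrow>
   ('m \<Rightarrow> 'g tvec \<Rightarrow> real) \<Rightarrow> ('m, 'l) line_bundle \<Rightarrow> ('m \<Rightarrow> 'm tvec \<Rightarrow> ('m \<Rightarrow> 'l) \<Rightarrow> 'l) \<Rightarrow>
   'g tvec \<Rightarrow> ('m \<Rightarrow> 'l) \<Rightarrow> 'm \<Rightarrow> 'l" where
  "prequantization G \<G> \<A> act \<Phi> L D A s q =
     lb_add L (lb_scale L (-1) (D q (generated_vf G \<G> \<A> act A q) s))
              (lb_scale L (- 2 * of_real pi * \<i> * of_real (\<Phi> q A)) (s q))"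


section \<open>Families of sections\<close>

text \<open>A map from a subset \<open>S\<close> of a manifold with atlas \<open>\<N>\<close> to the space of smooth sections is
  smooth (for the Frechet topology of uniform convergence of all derivatives on compact sets) iff it
  is jointly smooth in the parameter and the base point.\<close>

definition smooth_section_family ::
  "('n::topological_space, 'f::real_normed_vector) atlas \<Rightarrow> 'n set \<Rightarrow>
   ('m::topological_space, 'e::real_normed_vector) atlas \<Rightarrow> ('m, 'l) line_bundle \<Rightarrow>
   ('n \<Rightarrow> 'm \<Rightarrow> 'l) \<Rightarrow> bool" where
  "smooth_section_family \<N> S \<A> L \<sigma> \<longleftrightarrow>
     (\<forall>x\<in>S. \<sigma> x \<in> smooth_sections \<A> L) \<and>
     (\<forall>(U, \<theta>)\<in>lb_trivs L. smooth_fun_on (prod_atlas \<N> \<A>) (S \<times> U) (\<lambda>(x, q). \<theta> (\<sigma> x q)))"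

text \<open>The derivative is taken in each fibre; for smooth families it is the derivative in the space of
  smooth sections.\<close>

definition has_section_derivative ::
  "('m, 'l) line_bundle \<Rightarrow> (real \<Rightarrow> 'm \<Rightarrow> 'l) \<Rightarrow> ('m \<Rightarrow> 'l) \<Rightarrow> real filter \<Rightarrow> bool" where
  "has_section_derivative L \<sigma> \<eta> F \<longleftrightarrow>
     (\<forall>q. \<forall>(U, \<theta>)\<in>lb_trivs L. q \<in> U \<longrightarrow> ((\<lambda>t. \<theta> (\<sigma> t q)) has_vector_derivative \<theta> (\<eta> q)) F)"

definition invariant_prequantum_data ::
  "('g::topological_space) monoid \<Rightarrow> ('g, 'a::real_normed_vector) atlas \<Rightarrow>
   ('m::topological_space, 'e::real_normed_vector) atlas \<Rightarrow> ('g \<Rightarrow> 'm \<Rightarrow> 'm) \<Rightarrow>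
   ('m \<Rightarrow> 'g tvec \<Rightarrow> real) \<Rightarrow> ('m, 'l) line_bundle \<Rightarrow> ('m \<Rightarrow> 'm tvec \<Rightarrow> ('m \<Rightarrow> 'l) \<Rightarrow> 'l) \<Rightarrow>
   ('g \<Rightarrow> ('m \<Rightarrow> 'l) \<Rightarrow> 'm \<Rightarrow> 'l) \<Rightarrow> bool" where
  "invariant_prequantum_data G \<G> \<A> act \<Phi> L D \<rho> \<longleftrightarrow>
     (\<forall>g. \<forall>s\<in>smooth_sections \<A> L. \<rho> g s \<in> smooth_sections \<A> L) \<and>
     (\<forall>g. \<forall>r\<in>smooth_sections \<A> L. \<forall>s\<in>smooth_sections \<A> L.
        \<rho> g (\<lambda>q. lb_add L (r q) (s q)) = (\<lambda>q. lb_add L (\<rho> g r q) (\<rho> g s q))) \<and>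
     (\<forall>g c. \<forall>s\<in>smooth_sections \<A> L. \<rho> g (\<lambda>q. lb_scale L c (s q)) = (\<lambda>q. lb_scale L c (\<rho> g s q))) \<and>
     (\<forall>s\<in>smooth_sections \<A> L. \<rho> \<one>\<^bsub>G\<^esub> s = s) \<and>
     (\<forall>g h. \<forall>s\<in>smooth_sections \<A> L. \<rho> (g \<otimes>\<^bsub>G\<^esub> h) s = \<rho> g (\<rho> h s)) \<and>
     (\<forall>s\<in>smooth_sections \<A> L. smooth_section_family \<G> UNIV \<A> L (\<lambda>g. \<rho> g s)) \<and>
     (\<forall>A\<in>lie_algebra G \<G>. \<forall>s\<in>smooth_sections \<A> L.
        has_section_derivative L (\<lambda>u. \<rho> (lie_exp G \<G> (tscale u A)) s)
          (prequantization G \<G> \<A> act \<Phi> L D A s) (at 0))"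

definition prequantum_evolution ::
  "('g::topological_space) monoid \<Rightarrow> ('g, 'a::real_normed_vector) atlas \<Rightarrow>
   ('m::topological_space, 'e::real_normed_vector) atlas \<Rightarrow> ('g \<Rightarrow> 'm \<Rightarrow> 'm) \<Rightarrow>
   ('m \<Rightarrow> 'g tvec \<Rightarrow> real) \<Rightarrow> ('m, 'l) line_bundle \<Rightarrow> ('m \<Rightarrow> 'm tvec \<Rightarrow> ('m \<Rightarrow> 'l) \<Rightarrow> 'l) \<Rightarrow>
   real set \<Rightarrow> (real \<Rightarrow> 'g tvec) \<Rightarrow> ('m \<Rightarrow> 'l) \<Rightarrow> (real \<Rightarrow> 'm \<Rightarrow> 'l) \<Rightarrow> bool" where
  "prequantum_evolution G \<G> \<A> act \<Phi> L D I A \<tau> \<sigma> \<longleftrightarrow>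
     smooth_section_family std_atlas I \<A> L \<sigma> \<and> \<sigma> 0 = \<tau> \<and>
     (\<forall>t\<in>I. has_section_derivative L \<sigma>
        (prequantization G \<G> \<A> act \<Phi> L D (A t) (\<sigma> t)) (at t within I))"

end

theory Submission
  imports Defs
begin

text \<open>Both sides of the evolution equation are transported along the characteristics
  \<open>q\<^sub>t = h\<^sub>t q\<close>, whose velocity is \<open>X\<^bsub>A\<^sub>t\<^esub>\<close> by the Lax equation. In a trivialisation of \<open>L\<close> the operator
  \<open>P\<^sub>A\<close> is \<open>- X\<^sub>A\<close> plus multiplication by a function, so any solution \<open>\<sigma>\<close> satisfies a linear scalar
  equation \<open>z' = k z\<close> along a characteristic, with \<open>k\<close> independent of \<open>\<sigma>\<close> and locally bounded.
  Hence solutions are unique.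
  That \<open>\<rho> h\<^sub>t \<tau>\<close> is a solution follows since \<open>h\<^bsub>t+s\<^esub> h\<^sub>t\<^sup>-\<^sup>1\<close> and \<open>exp (s A\<^sub>t)\<close> have the same velocity at
  \<open>s = 0\<close>. As the exponential is defined by a description operator, this uses existence and
  uniqueness of one-parameter subgroups: a Picard solution in a chart, extended by
  \<open>\<gamma> t = (\<gamma> (t / n))\<^sup>n\<close>.\<close>

section \<open>Finite-dimensional normed spaces\<close>

text \<open>\<open>P_A\<close> differentiates sections, so the evolution equation is a partial
  differential equation and not an ordinary one in a Banach space: Picard iteration gives no
  uniqueness for it. Its first-order part is cancelled by moving with \<open>h t\<close>, and a
  single orbit argument reaches every point because \<open>act (h t)\<close> is invertible. Three
  features shape the details. Tangent vectors are functionals that vanish on functions not smooth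
  near the base point, so identities between them are tested function by function. The interval
  \<open>I\<close> may contain endpoints, possibly 0 itself, so derivatives are taken within
  \<open>I\<close>, and their uniqueness rests on \<open>I\<close> being nondegenerate. The curve
  \<open>A\<close> is known only through its evaluations on functions, so the local bound on the
  coefficient comes from coordinates on the Lie algebra together with linearity in the Lie algebra
  argument. The model spaces carry neither an inner product nor a chosen basis; completeness and
  continuity of coordinates have to be derived from a finite spanning set.\<close>

lemma complete_span_finite:
  fixes S :: "'a::real_normed_vector set"
  assumes "finite S"
  shows "complete (span S)"
  using assms
proof (induction S)
  case empty
  have "f \<longlonglongrightarrow> 0" if "\<forall>n. f n \<in> {0}" for f :: "nat \<Rightarrow> 'a"
    using that by (simp add: tendsto_eventually)
  then show ?case by (auto simp: complete_def)
next
  case (insert b S)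
  show ?case
  proof (cases "b \<in> span S")
    case True
    then show ?thesis using insert by (simp add: span_redundant)
  next
    case False
    have cl: "closed (span S)" by (rule complete_imp_closed[OF insert.IH])
    define d where "d = infdist b (span S)"
    have ne: "span S \<noteq> {}" using span_zero by blast
    have d: "d > 0" unfolding d_def
      using False cl ne by (simp add: infdist_pos_not_in_closed)
    \<comment> \<open>Dividing by \<open>k\<close> gives a vector \<open>b + v/k\<close>, whose
      distance from 0 is at least the distance \<open>d\<close> of \<open>b\<close> from the span.
      So the coefficient of \<open>b\<close> is controlled by the norm, and a Cauchy sequence has
      Cauchy coefficients.\<close>
    have key: "\<bar>k\<bar> * d \<le> norm (v + k *\<^sub>R b)" if "v \<in> span S" for v k
    proof (cases "k = 0")
      case False
      have "(-1/k) *\<^sub>R v \<in> span S" using that by (rule span_scale)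
      then have "d \<le> dist b ((-1/k) *\<^sub>R v)" unfolding d_def by (rule infdist_le)
      also have "\<dots> = norm (b + (1/k) *\<^sub>R v)" by (simp add: dist_norm)
      finally have "\<bar>k\<bar> * d \<le> norm (k *\<^sub>R (b + (1/k) *\<^sub>R v))"
        using False by (simp add: mult_left_mono)
      also have "k *\<^sub>R (b + (1/k) *\<^sub>R v) = v + k *\<^sub>R b" using False by (simp add: algebra_simps)
      finally show ?thesis .
    qed (simp)
    show ?thesis
    proof (rule completeI)
      fix f :: "nat \<Rightarrow> 'a" assume f: "\<forall>n. f n \<in> span (insert b S)" and C: "Cauchy f"
      have "\<forall>n. \<exists>k. f n - k *\<^sub>R b \<in> span S" using f by (simp add: span_insert)
      then obtain k where k: "\<And>n. f n - k n *\<^sub>R b \<in> span S" by metis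
      have kd: "\<bar>k m - k n\<bar> * d \<le> dist (f m) (f n)" for m n
      proof -
        have "(f m - k m *\<^sub>R b) - (f n - k n *\<^sub>R b) \<in> span S" using k span_diff by blast
        from key[OF this, of "k m - k n"] show ?thesis by (simp add: dist_norm algebra_simps)
      qed
      have "Cauchy k"
      proof (rule metric_CauchyI)
        fix e :: real assume "e > 0"
        then have "e * d > 0" using d by simp
        then obtain M where M: "\<And>m n. m \<ge> M \<Longrightarrow> n \<ge> M \<Longrightarrow> dist (f m) (f n) < e * d"
          using metric_CauchyD[OF C] by blast
        have "dist (k m) (k n) < e" if "m \<ge> M" "n \<ge> M" for m n
        proof -
          have "\<bar>k m - k n\<bar> * d < e * d" using kd[of m n] M[OF that] by linarith
          then show ?thesis using d by (simp add: dist_real_def)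
        qed
        then show "\<exists>M. \<forall>m\<ge>M. \<forall>n\<ge>M. dist (k m) (k n) < e" by blast
      qed
      then obtain l where l: "k \<longlonglongrightarrow> l" using Cauchy_convergent convergent_def by blast
      have lb: "(\<lambda>n. k n *\<^sub>R b) \<longlonglongrightarrow> l *\<^sub>R b" by (intro tendsto_intros l)
      have "Cauchy (\<lambda>n. f n - k n *\<^sub>R b)"
      proof (rule CauchyI)
        fix e :: real assume "e > 0"
        then have e: "e / 2 > 0" by simp
        obtain M N where M: "\<And>m n. m \<ge> M \<Longrightarrow> n \<ge> M \<Longrightarrow> norm (f m - f n) < e / 2"
          and N: "\<And>m n. m \<ge> N \<Longrightarrow> n \<ge> N \<Longrightarrow> norm (k m *\<^sub>R b - k n *\<^sub>R b) < e / 2"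
          using CauchyD[OF C e] CauchyD[OF LIMSEQ_imp_Cauchy[OF lb] e] by blast
        have "norm ((f m - k m *\<^sub>R b) - (f n - k n *\<^sub>R b)) < e" if "m \<ge> max M N" "n \<ge> max M N" for m n
        proof -
          have "norm ((f m - f n) - (k m *\<^sub>R b - k n *\<^sub>R b)) < e / 2 + e / 2"
            using norm_triangle_ineq4[of "f m - f n" "k m *\<^sub>R b - k n *\<^sub>R b"] M[of m n] N[of m n] that
            by simp
          then show ?thesis by (simp add: algebra_simps)
        qed
        then show "\<exists>M. \<forall>m\<ge>M. \<forall>n\<ge>M. norm ((f m - k m *\<^sub>R b) - (f n - k n *\<^sub>R b)) < e" by blast
      qed
      then obtain v where v: "v \<in> span S" "(\<lambda>n. f n - k n *\<^sub>R b) \<longlonglongrightarrow> v"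
        using completeE[OF insert.IH, of "\<lambda>n. f n - k n *\<^sub>R b"] k by blast
      from tendsto_add[OF v(2) lb] have "f \<longlonglongrightarrow> v + l *\<^sub>R b" by simp
      moreover have "v + l *\<^sub>R b \<in> span (insert b S)"
        using v(1) unfolding span_insert by (intro CollectI exI[of _ l]) simp
      ultimately show "\<exists>l\<in>span (insert b S). f \<longlonglongrightarrow> l" by blast
    qed
  qed
qed

text \<open>The class provides only a finite spanning set; a basis is extracted from it once and
  fixed by choice.\<close>

definition fd_basis :: "'a::finite_dim_normed_space set" where
  "fd_basis = (SOME B. finite B \<and> independent B \<and> span B = UNIV)"

definition fd_coord :: "'a::finite_dim_normed_space \<Rightarrow> 'a \<Rightarrow> real" where
  "fd_coord b x = representation fd_basis x b"

lemma
  shows finite_fd_basis: "finite (fd_basis :: 'a::finite_dim_normed_space set)"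
    and independent_fd_basis: "independent (fd_basis :: 'a set)"
    and span_fd_basis: "span (fd_basis :: 'a set) = UNIV"
proof -
  obtain B :: "'a set" where B: "finite B" "\<And>x. \<exists>c. x = (\<Sum>b\<in>B. c b *\<^sub>R b)"
    using finite_dim by blast
  have "span B = UNIV"
  proof -
    have "x \<in> span B" for x
    proof -
      obtain c where "x = (\<Sum>b\<in>B. c b *\<^sub>R b)" using B(2) by blast
      then show ?thesis by (simp add: span_sum span_scale span_base)
    qed
    then show ?thesis by blast
  qed
  moreover obtain C where C: "C \<subseteq> B" "independent C" "B \<subseteq> span C"
    using maximal_independent_subset by blast
  ultimately have "span C = UNIV" using span_mono[OF C(3)] unfolding span_span by blast
  then have "finite C \<and> independent C \<and> span C = UNIV"
    using B(1) C finite_subset by blast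
  then have "finite (fd_basis :: 'a set) \<and> independent (fd_basis :: 'a set) \<and> span (fd_basis :: 'a set) = UNIV"
    unfolding fd_basis_def by (rule someI)
  then show "finite (fd_basis :: 'a set)" "independent (fd_basis :: 'a set)" "span (fd_basis :: 'a set) = UNIV"
    by auto
qed

text \<open>Makes Picard iteration, which is carried out in a Banach space, available for charts of
  the Lie group.\<close>

instance finite_dim_normed_space \<subseteq> banach
proof
  fix X :: "nat \<Rightarrow> 'a" assume "Cauchy X"
  moreover have "complete (UNIV :: 'a set)"
    using complete_span_finite[OF finite_fd_basis] by (simp add: span_fd_basis)
  ultimately show "convergent X" unfolding complete_def convergent_def by blast
qed

lemma fd_expand: "(\<Sum>b\<in>fd_basis. fd_coord b x *\<^sub>R b) = x"
  unfolding fd_coord_def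
  by (rule sum_representation_eq) (auto simp: independent_fd_basis span_fd_basis finite_fd_basis)

lemma scaleR_cancel_quotient: 
  fixes b :: "'a::real_vector"
  assumes "k \<noteq> 0" "x = k *\<^sub>R b + v"
  shows "k *\<^sub>R (b + (1/k) *\<^sub>R v) = x"
  unfolding scaleR_add_right scaleR_scaleR using assms by simp

text \<open>Same distance estimate as for completeness: a basis vector lies at positive distance
  from the closed span of the others. For \<open>b\<close> outside \<open>fd_basis\<close>,
  \<open>representation\<close> returns 0, so no membership premise is needed.\<close>

lemma bounded_linear_fd_coord:
  fixes b :: "'a::finite_dim_normed_space"
  shows "bounded_linear (fd_coord b)"
proof (cases "b \<in> fd_basis")
  case True
  let ?S = "span (fd_basis - {b})"
  have "b \<notin> ?S" using True independent_fd_basis by (auto simp: dependent_def)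
  moreover have "closed ?S" by (intro complete_imp_closed complete_span_finite) (simp add: finite_fd_basis)
  ultimately have d: "infdist b ?S > 0"
    using infdist_pos_not_in_closed span_zero by blast
  have le: "\<bar>fd_coord b x\<bar> * infdist b ?S \<le> norm x" for x
  proof (cases "fd_coord b x = 0")
    case False
    let ?k = "fd_coord b x"
    define v where "v = (\<Sum>c\<in>fd_basis - {b}. fd_coord c x *\<^sub>R c)"
    have x: "x = ?k *\<^sub>R b + v"
      using fd_expand[of x] sum.remove[OF finite_fd_basis True, of "\<lambda>b. fd_coord b x *\<^sub>R b"]
      by (simp add: v_def)
    have "v \<in> ?S" unfolding v_def by (intro span_sum span_scale span_base)
    then have "infdist b ?S \<le> dist b ((-1/?k) *\<^sub>R v)" by (intro infdist_le span_scale)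
    also have "\<dots> = norm (b + (1/?k) *\<^sub>R v)" by (simp add: dist_norm)
    finally have "\<bar>?k\<bar> * infdist b ?S \<le> norm (?k *\<^sub>R (b + (1/?k) *\<^sub>R v))"
      by (simp add: mult_left_mono)
    also have "?k *\<^sub>R (b + (1/?k) *\<^sub>R v) = x"
      using False x by (metis scaleR_cancel_quotient)
    finally show ?thesis .
  qed simp
  show ?thesis
  proof (rule bounded_linear_intro[where K = "1 / infdist b ?S"])
    show "norm (fd_coord b x) \<le> norm x * (1 / infdist b ?S)" for x
      using le[of x] d by (simp add: field_simps)
  qed (simp_all add: fd_coord_def representation_add representation_scale independent_fd_basis span_fd_basis)
next
  case False
  then have "fd_coord b = (\<lambda>x. 0)"
    unfolding fd_coord_def using representation_ne_zero by blast
  then show ?thesis by simp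
qed

text \<open>Charts of \<open>G \<times> M\<close> and of parameter times base point take values in
  products, and composition of smooth maps requires the intermediate model space to be in this
  class.\<close>

instance prod :: (finite_dim_normed_space, finite_dim_normed_space) finite_dim_normed_space
proof
  let ?B = "(\<lambda>b. (b, 0)) ` (fd_basis :: 'a set) \<union> (\<lambda>b. (0, b)) ` (fd_basis :: 'b set)"
  have fin: "finite ?B" by (simp add: finite_fd_basis)
  have sp: "span ?B = UNIV"
  proof -
    have "(x, y) \<in> span ?B" for x :: 'a and y :: 'b
    proof -
      have "(x, 0) = (\<Sum>b\<in>fd_basis. fd_coord b x *\<^sub>R (b, 0::'b))"
        by (simp add: prod_eq_iff fst_sum snd_sum fd_expand)
      also have "\<dots> \<in> span ?B" by (intro span_sum span_scale span_base) auto
      finally have 1: "(x, 0) \<in> span ?B" .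
      have "(0, y) = (\<Sum>b\<in>fd_basis. fd_coord b y *\<^sub>R (0::'a, b))"
        by (simp add: prod_eq_iff fst_sum snd_sum fd_expand)
      also have "\<dots> \<in> span ?B" by (intro span_sum span_scale span_base) auto
      finally have 2: "(0, y) \<in> span ?B" .
      have "(x, y) = (x, 0) + (0, y)" by simp
      then show ?thesis using span_add[OF 1 2] by metis
    qed
    then have "z \<in> span ?B" for z by (cases z) blast
    then show ?thesis by blast
  qed
  have "\<exists>c. x = (\<Sum>b\<in>?B. c b *\<^sub>R b)" for x
  proof -
    have "x \<in> range (\<lambda>c. \<Sum>b\<in>?B. c b *\<^sub>R b)"
      using sp unfolding span_finite[OF fin] by blast
    then show ?thesis by blast
  qed
  then show "\<exists>B. finite B \<and> (\<forall>x::'a \<times> 'b. \<exists>c. x = (\<Sum>b\<in>B. c b *\<^sub>R b))"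
    using fin by blast
qed

section \<open>Smooth maps between normed spaces\<close>

lemma Ck_on_cong:
  assumes "open S" "\<And>x. x \<in> S \<Longrightarrow> f x = g x"
  shows "Ck_on k S f \<longleftrightarrow> Ck_on k S g"
proof (cases k)
  case 0
  then show ?thesis using assms by (simp cong: continuous_on_cong)
next
  case (Suc n)
  have "(f has_derivative d) (at x) \<longleftrightarrow> (g has_derivative d) (at x)" if "x \<in> S" for x d
    using has_derivative_transform_within_open[of f d x UNIV S g]
      has_derivative_transform_within_open[of g d x UNIV S f] assms that by auto
  then show ?thesis using Suc by simp
qed

lemma Ck_on_SucE:
  assumes "Ck_on (Suc k) S f"
  obtains f' where "\<And>x. x \<in> S \<Longrightarrow> (f has_derivative f' x) (at x)" "\<And>v. Ck_on k S (\<lambda>x. f' x v)"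
proof -
  obtain f' where "(\<forall>x\<in>S. (f has_derivative f' x) (at x)) \<and> (\<forall>v. Ck_on k S (\<lambda>x. f' x v))"
    using assms unfolding Ck_on.simps by (rule exE)
  then show ?thesis by (intro that[of f']) simp_all
qed

lemma smooth_onE:
  assumes "smooth_on S f" "x \<in> S"
  obtains T g where "open T" "x \<in> T" "\<And>k. Ck_on k T g" "\<And>y. y \<in> S \<Longrightarrow> y \<in> T \<Longrightarrow> g y = f y"
proof -
  obtain T g where "open T \<and> x \<in> T \<and> (\<forall>k. Ck_on k T g) \<and> (\<forall>y\<in>S \<inter> T. g y = f y)"
    using bspec[OF assms(1)[unfolded smooth_on_def] assms(2)] by (elim exE)
  then show ?thesis by (intro that[of T g]) simp_all
qed

lemma smooth_onI:
  assumes "\<And>x. x \<in> S \<Longrightarrow> \<exists>T g. open T \<and> x \<in> T \<and> (\<forall>k. Ck_on k T g) \<and> (\<forall>y\<in>S \<inter> T. g y = f y)"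
  shows "smooth_on S f"
  using assms unfolding smooth_on_def by (rule ballI)

lemma Ck_on_subset: "Ck_on k S f \<Longrightarrow> T \<subseteq> S \<Longrightarrow> Ck_on k T f"
proof (induction k arbitrary: f)
  case 0
  then show ?case by (auto intro: continuous_on_subset)
next
  case (Suc k)
  then show ?case by simp blast
qed

lemma Ck_on_SucD: "Ck_on (Suc k) S f \<Longrightarrow> Ck_on k S f"
proof (induction k arbitrary: f)
  case 0
  then show ?case by (auto intro!: continuous_at_imp_continuous_on dest: has_derivative_continuous)
next
  case (Suc k)
  then obtain f' where f': "\<forall>x\<in>S. (f has_derivative f' x) (at x)" "\<forall>v. Ck_on (Suc k) S (\<lambda>x. f' x v)"
    by (simp only: Ck_on.simps(2)[of "Suc k"]) blast
  then have "\<forall>v. Ck_on k S (\<lambda>x. f' x v)" using Suc.IH by blast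
  then show ?case using f'(1) by auto
qed

text \<open>The derivative in \<open>Ck_on\<close> is existentially quantified; uniqueness of
  derivatives transfers its regularity to any derivative at hand.\<close>

lemma Ck_on_has_derivative:
  assumes "Ck_on (Suc k) S f" "\<And>x. x \<in> S \<Longrightarrow> (f has_derivative f' x) (at x)" "open S"
  shows "Ck_on k S (\<lambda>x. f' x v)"
proof -
  obtain f'' where f'': "\<And>x. x \<in> S \<Longrightarrow> (f has_derivative f'' x) (at x)" "\<And>v. Ck_on k S (\<lambda>x. f'' x v)"
    using assms(1) by auto
  have "f'' x = f' x" if "x \<in> S" for x
    using f''(1)[OF that] assms(2)[OF that] by (rule has_derivative_unique)
  then show ?thesis using f''(2)[of v] Ck_on_cong[OF assms(3), of "\<lambda>x. f'' x v" "\<lambda>x. f' x v"] by simp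
qed

lemma Ck_on_local:
  assumes "open S" "\<And>x. x \<in> S \<Longrightarrow> \<exists>T. open T \<and> x \<in> T \<and> Ck_on k (S \<inter> T) f"
  shows "Ck_on k S f"
  using assms(2)
proof (induction k arbitrary: f)
  case 0
  show ?case unfolding Ck_on.simps(1)
  proof (rule continuous_at_imp_continuous_on, rule ballI)
    fix x assume "x \<in> S"
    then obtain T where "open T" "x \<in> T" "continuous_on (S \<inter> T) f" using 0 by auto
    then show "isCont f x" using \<open>x \<in> S\<close> assms(1)
      by (metis IntI continuous_on_eq_continuous_at open_Int)
  qed
next
  case (Suc k)
  \<comment> \<open>Each neighbourhood supplies its own derivative;
    \<open>frechet_derivative\<close> is a choice independent of the neighbourhood, so that the
    induction hypothesis can glue.\<close>
  define f' where "f' x = frechet_derivative f (at x)" for x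
  have f': "(f has_derivative f' x) (at x)" if x: "x \<in> S" for x
  proof -
    obtain T where T: "x \<in> T" "Ck_on (Suc k) (S \<inter> T) f" using Suc.prems[OF x] by blast
    obtain d where "\<And>x. x \<in> S \<inter> T \<Longrightarrow> (f has_derivative d x) (at x)"
      by (rule Ck_on_SucE[OF T(2)]) (rule that)
    then have "f differentiable at x" using x T(1) unfolding differentiable_def by blast
    then show ?thesis unfolding f'_def by (simp add: frechet_derivative_works)
  qed
  have "Ck_on k S (\<lambda>x. f' x v)" for v
  proof (rule Suc.IH)
    fix x assume "x \<in> S"
    then obtain T where T: "open T" "x \<in> T" "Ck_on (Suc k) (S \<inter> T) f" using Suc.prems by blast
    have "Ck_on k (S \<inter> T) (\<lambda>x. f' x v)"
      by (rule Ck_on_has_derivative[OF T(3)]) (use f' assms(1) T(1) in auto)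
    then show "\<exists>T. open T \<and> x \<in> T \<and> Ck_on k (S \<inter> T) (\<lambda>x. f' x v)" using T by blast
  qed
  then show ?case using f' by auto
qed

lemma Ck_on_const: "Ck_on k S (\<lambda>x. c)"
proof (induction k arbitrary: c)
  case (Suc k)
  show ?case unfolding Ck_on.simps
    by (rule exI[of _ "\<lambda>x v. 0"]) (use Suc in simp)
qed simp

lemma Ck_on_bounded_linear:
  assumes "bounded_linear f"
  shows "Ck_on k S f"
proof (cases k)
  case 0
  then show ?thesis using assms by (simp add: linear_continuous_on)
next
  case (Suc n)
  show ?thesis unfolding Suc Ck_on.simps
    by (rule exI[of _ "\<lambda>x. f"]) (use assms in \<open>simp add: bounded_linear_imp_has_derivative Ck_on_const\<close>)
qed

lemma Ck_on_linear_compose: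
  assumes "bounded_linear L"
  shows "Ck_on k S f \<Longrightarrow> Ck_on k S (\<lambda>x. L (f x))"
proof (induction k arbitrary: f)
  case 0
  then show ?case using assms by (simp add: bounded_linear.continuous_on)
next
  case (Suc k)
  then obtain f' where "\<forall>x\<in>S. (f has_derivative f' x) (at x)" "\<forall>v. Ck_on k S (\<lambda>x. f' x v)" by auto
  then show ?case unfolding Ck_on.simps
    by (intro exI[of _ "\<lambda>x v. L (f' x v)"]) (auto intro: bounded_linear.has_derivative[OF assms] Suc.IH)
qed

lemma Ck_on_add: "Ck_on k S f \<Longrightarrow> Ck_on k S g \<Longrightarrow> Ck_on k S (\<lambda>x. f x + g x)"
proof (induction k arbitrary: f g)
  case 0
  then show ?case by (simp add: continuous_on_add)
next
  case (Suc k)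
  then obtain f' g' where "\<forall>x\<in>S. (f has_derivative f' x) (at x)" "\<forall>v. Ck_on k S (\<lambda>x. f' x v)"
    "\<forall>x\<in>S. (g has_derivative g' x) (at x)" "\<forall>v. Ck_on k S (\<lambda>x. g' x v)" by auto
  then show ?case unfolding Ck_on.simps
    by (intro exI[of _ "\<lambda>x v. f' x v + g' x v"]) (auto intro!: has_derivative_add Suc.IH)
qed

lemma Ck_on_sum:
  "(\<And>i. i \<in> I \<Longrightarrow> Ck_on k S (f i)) \<Longrightarrow> Ck_on k S (\<lambda>x. \<Sum>i\<in>I. f i x)"
  by (induction I rule: infinite_finite_induct) (auto simp: Ck_on_const intro!: Ck_on_add)

lemma Ck_on_scaleR:
  fixes f :: "_ \<Rightarrow> real"
  shows "Ck_on k S f \<Longrightarrow> Ck_on k S g \<Longrightarrow> Ck_on k S (\<lambda>x. f x *\<^sub>R g x)"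
proof (induction k arbitrary: f g)
  case 0
  then show ?case by (simp add: continuous_on_scaleR)
next
  case (Suc k)
  then obtain f' g' where *: "\<forall>x\<in>S. (f has_derivative f' x) (at x)" "\<forall>v. Ck_on k S (\<lambda>x. f' x v)"
    "\<forall>x\<in>S. (g has_derivative g' x) (at x)" "\<forall>v. Ck_on k S (\<lambda>x. g' x v)" by auto
  have "Ck_on k S f" "Ck_on k S g" using Suc.prems Ck_on_SucD by blast+
  then show ?case unfolding Ck_on.simps using *
    by (intro exI[of _ "\<lambda>x v. f x *\<^sub>R g' x v + f' x v *\<^sub>R g x"])
      (auto intro!: has_derivative_scaleR Ck_on_add Suc.IH)
qed

text \<open>\<open>Ck_on\<close> controls derivatives only in fixed directions, whereas the chain
  rule yields \<open>g' (f x) (f' x v)\<close>, whose direction moves with \<open>x\<close>.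
  Expanding that direction in the basis turns it into a finite sum of scalar functions times
  derivatives of \<open>g\<close> in fixed directions, to which the induction hypothesis
  applies.\<close>

lemma Ck_on_compose:
  fixes f :: "_ \<Rightarrow> 'b::finite_dim_normed_space"
  shows "Ck_on k S f \<Longrightarrow> Ck_on k T g \<Longrightarrow> f ` S \<subseteq> T \<Longrightarrow> Ck_on k S (\<lambda>x. g (f x))"
proof (induction k arbitrary: g)
  case 0
  then show ?case by (auto intro: continuous_on_compose2)
next
  case (Suc k)
  obtain f' where f': "\<And>x. x \<in> S \<Longrightarrow> (f has_derivative f' x) (at x)" "\<And>v. Ck_on k S (\<lambda>x. f' x v)"
    using Ck_on_SucE[OF Suc.prems(1)] by blast
  obtain g' where g': "\<And>x. x \<in> T \<Longrightarrow> (g has_derivative g' x) (at x)" "\<And>v. Ck_on k T (\<lambda>x. g' x v)"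
    using Ck_on_SucE[OF Suc.prems(2)] by blast
  note * = f' g'
  define d where "d x v = (\<Sum>b\<in>fd_basis. fd_coord b (f' x v) *\<^sub>R g' (f x) b)" for x v
  have "((\<lambda>x. g (f x)) has_derivative d x) (at x)" if "x \<in> S" for x
  proof -
    have fx: "f x \<in> T" using that Suc.prems by auto
    have "linear (g' (f x))" using *(3)[OF fx] by (rule has_derivative_linear)
    then have "d x = (\<lambda>v. g' (f x) (\<Sum>b\<in>fd_basis. fd_coord b (f' x v) *\<^sub>R b))"
      unfolding d_def by (simp add: linear_sum linear_cmul fun_eq_iff)
    then have "d x = (\<lambda>v. g' (f x) (f' x v))" by (simp add: fd_expand)
    then show ?thesis using has_derivative_compose[OF *(1)[OF that] *(3)[OF fx]] by simp
  qed
  moreover have "Ck_on k S (\<lambda>x. d x v)" for v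
    unfolding d_def using Suc.prems(3)
    by (intro Ck_on_sum Ck_on_scaleR Ck_on_linear_compose[OF bounded_linear_fd_coord] * Suc.IH
        Ck_on_SucD[OF Suc.prems(1)])
  ultimately show ?case by auto
qed

lemma Ck_on_Pair:
  assumes "Ck_on k S f" "Ck_on k S g"
  shows "Ck_on k S (\<lambda>x. (f x, g x))"
proof -
  have "Ck_on k S (\<lambda>x. (f x, 0) + (0, g x))"
    using assms by (intro Ck_on_add Ck_on_linear_compose[where L = "\<lambda>x. (x, 0)"]
        Ck_on_linear_compose[where L = "\<lambda>x. (0, x)"] bounded_linear_Pair bounded_linear_ident bounded_linear_zero)
  then show ?thesis by simp
qed

section \<open>Smoothness on arbitrary sets, by local extension\<close>

lemma smooth_on_local:
  assumes "\<And>x. x \<in> S \<Longrightarrow> \<exists>T. open T \<and> x \<in> T \<and> smooth_on (S \<inter> T) f"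
  shows "smooth_on S f"
proof (rule smooth_onI)
  fix x assume x: "x \<in> S"
  then obtain T where T: "open T" "x \<in> T" "smooth_on (S \<inter> T) f" using assms by blast
  obtain T' g where T': "open T'" "x \<in> T'" "\<And>k. Ck_on k T' g"
    "\<And>y. y \<in> S \<inter> T \<Longrightarrow> y \<in> T' \<Longrightarrow> g y = f y"
    using T(3) IntI[OF x T(2)] by (rule smooth_onE) blast
  then show "\<exists>T g. open T \<and> x \<in> T \<and> (\<forall>k. Ck_on k T g) \<and> (\<forall>y\<in>S \<inter> T. g y = f y)"
    using T by (intro exI[of _ "T \<inter> T'"] exI[of _ g]) (auto intro: Ck_on_subset)
qed

lemma smooth_on_subset: 
  assumes "smooth_on S f" "T \<subseteq> S"
  shows "smooth_on T f"
proof (rule smooth_onI)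
  fix x assume "x \<in> T"
  then have "x \<in> S" using assms by blast
  from assms(1) this show "\<exists>U g. open U \<and> x \<in> U \<and> (\<forall>k. Ck_on k U g) \<and> (\<forall>y\<in>T \<inter> U. g y = f y)"
    by (rule smooth_onE) (use assms(2) in blast)
qed

lemma smooth_on_cong: "smooth_on S f \<Longrightarrow> (\<And>x. x \<in> S \<Longrightarrow> f x = g x) \<Longrightarrow> smooth_on S g"
  unfolding smooth_on_def by simp

lemma smooth_on_Ck: "(\<And>k. Ck_on k UNIV f) \<Longrightarrow> smooth_on S f"
  by (rule smooth_onI, rule exI[of _ UNIV], rule exI[of _ f]) simp

lemma smooth_on_const: "smooth_on S (\<lambda>x. c)"
  by (rule smooth_on_Ck) (rule Ck_on_const)

lemma smooth_on_bounded_linear: "bounded_linear f \<Longrightarrow> smooth_on S f"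
  by (rule smooth_on_Ck) (rule Ck_on_bounded_linear)

lemma smooth_on_compose:
  fixes f :: "_ \<Rightarrow> 'b::finite_dim_normed_space"
  assumes f: "smooth_on S f" and g: "smooth_on T g" and "f ` S \<subseteq> T"
  shows "smooth_on S (\<lambda>x. g (f x))"
proof (rule smooth_onI)
  fix x assume x: "x \<in> S"
  then obtain U f1 where U: "open U" "x \<in> U" "\<And>k. Ck_on k U f1" "\<And>y. y \<in> S \<Longrightarrow> y \<in> U \<Longrightarrow> f1 y = f y"
    using smooth_onE[OF f] by blast
  have "f x \<in> T" using x assms(3) by auto
  then obtain V g1 where V: "open V" "f x \<in> V" "\<And>k. Ck_on k V g1" "\<And>y. y \<in> T \<Longrightarrow> y \<in> V \<Longrightarrow> g1 y = g y"
    using smooth_onE[OF g] by blast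
  \<comment> \<open>The extension \<open>f1\<close> need not map into the domain of
    \<open>g1\<close> away from \<open>S\<close>, so its domain is cut down to where it
    does.\<close>
  define W where "W = U \<inter> f1 -` V"
  have "continuous_on U f1" using U(3)[of 0] by simp
  then have W: "open W" unfolding W_def by (metis Int_commute U(1) V(1) continuous_on_open_vimage)
  have "Ck_on k W (\<lambda>x. g1 (f1 x))" for k
    by (rule Ck_on_compose[of _ _ _ V]) (auto simp: W_def intro: V Ck_on_subset[OF U(3)])
  moreover have "x \<in> W" using x U V by (auto simp: W_def)
  moreover have "g1 (f1 y) = g (f y)" if "y \<in> S \<inter> W" for y
    using that U(4)[of y] V(4)[of "f y"] assms(3) by (auto simp: W_def)
  ultimately show "\<exists>T h. open T \<and> x \<in> T \<and> (\<forall>k. Ck_on k T h) \<and> (\<forall>y\<in>S \<inter> T. h y = g (f y))"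
    using W by blast
qed

lemma smooth_on_Pair:
  assumes f: "smooth_on S f" and g: "smooth_on S g"
  shows "smooth_on S (\<lambda>x. (f x, g x))"
proof (rule smooth_onI)
  fix x assume x: "x \<in> S"
  then obtain U f1 where U: "open U" "x \<in> U" "\<And>k. Ck_on k U f1" "\<And>y. y \<in> S \<Longrightarrow> y \<in> U \<Longrightarrow> f1 y = f y"
    using smooth_onE[OF f] by blast
  obtain V g1 where V: "open V" "x \<in> V" "\<And>k. Ck_on k V g1" "\<And>y. y \<in> S \<Longrightarrow> y \<in> V \<Longrightarrow> g1 y = g y"
    using smooth_onE[OF g x] by blast
  have "Ck_on k (U \<inter> V) (\<lambda>x. (f1 x, g1 x))" for k
    by (intro Ck_on_Pair Ck_on_subset[OF U(3)] Ck_on_subset[OF V(3)]) auto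
  then show "\<exists>T h. open T \<and> x \<in> T \<and> (\<forall>k. Ck_on k T h) \<and> (\<forall>y\<in>S \<inter> T. h y = (f y, g y))"
    using U V by (intro exI[of _ "U \<inter> V"] exI[of _ "\<lambda>x. (f1 x, g1 x)"]) auto
qed

text \<open>On an open set the local extensions agree with \<open>f\<close> near each point, and
  \<open>Ck_on\<close> is a local property.\<close>

lemma smooth_on_open:
  assumes "open S"
  shows "smooth_on S f \<longleftrightarrow> (\<forall>k. Ck_on k S f)"
proof
  assume f: "smooth_on S f"
  show "\<forall>k. Ck_on k S f"
  proof (intro allI Ck_on_local assms)
    fix k x assume "x \<in> S"
    then obtain U g where U: "open U" "x \<in> U" "\<And>k. Ck_on k U g" "\<And>y. y \<in> S \<Longrightarrow> y \<in> U \<Longrightarrow> g y = f y"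
      using smooth_onE[OF f] by blast
    have "Ck_on k (S \<inter> U) g" by (rule Ck_on_subset[OF U(3)]) simp
    moreover have "Ck_on k (S \<inter> U) g \<longleftrightarrow> Ck_on k (S \<inter> U) f"
      by (rule Ck_on_cong) (use assms U in auto)
    ultimately have "Ck_on k (S \<inter> U) f" by simp
    then show "\<exists>T. open T \<and> x \<in> T \<and> Ck_on k (S \<inter> T) f" using U(1,2) by (intro exI[of _ U]) simp
  qed
next
  assume f: "\<forall>k. Ck_on k S f"
  show "smooth_on S f"
  proof (rule smooth_onI)
    fix x assume "x \<in> S"
    then have "open S \<and> x \<in> S \<and> (\<forall>k. Ck_on k S f) \<and> (\<forall>y\<in>S \<inter> S. f y = f y)"
      using assms f by (intro conjI ballI) simp_all
    then show "\<exists>T g. open T \<and> x \<in> T \<and> (\<forall>k. Ck_on k T g) \<and> (\<forall>y\<in>S \<inter> T. g y = f y)"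
      by (intro exI)
  qed
qed

lemma smooth_on_has_derivative_within:
  assumes "smooth_on S f" "x \<in> S"
  shows "\<exists>f'. (f has_derivative f') (at x within S)"
proof -
  obtain U g where U: "open U" "x \<in> U" "\<And>k. Ck_on k U g" "\<And>y. y \<in> S \<Longrightarrow> y \<in> U \<Longrightarrow> g y = f y"
    using smooth_onE[OF assms] by blast
  obtain g' where "\<And>x. x \<in> U \<Longrightarrow> (g has_derivative g' x) (at x)"
    using Ck_on_SucE[OF U(3)[of "Suc 0"]] by blast
  from this[OF U(2)] have "(g has_derivative g' x) (at x)" .
  then have g': "(g has_derivative g' x) (at x within S)" by (rule has_derivative_at_withinI)
  obtain d where d: "d > 0" "ball x d \<subseteq> U" using openE[OF U(1,2)] .
  have "(f has_derivative g' x) (at x within S)"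
    using g' d(1) assms(2)
  proof (rule has_derivative_transform_within)
    fix y assume "y \<in> S" "dist y x < d"
    then show "g y = f y" using d(2) U(4)[of y] by (auto simp: dist_commute subset_iff)
  qed
  then show ?thesis by (intro exI)
qed

lemma smooth_on_imp_continuous_on:
  assumes "smooth_on S f"
  shows "continuous_on S f"
  unfolding continuous_on_eq_continuous_within
proof
  fix x assume "x \<in> S"
  from smooth_on_has_derivative_within[OF assms this] show "continuous (at x within S) f"
    by (elim exE) (rule has_derivative_continuous)
qed

lemma smooth_on_has_derivative:
  assumes "smooth_on S f" "open S" "\<And>x. x \<in> S \<Longrightarrow> (f has_derivative f' x) (at x)"
  shows "smooth_on S (\<lambda>x. f' x v)"
  unfolding smooth_on_open[OF assms(2)]
proof
  show "Ck_on k S (\<lambda>x. f' x v)" for k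
    by (rule Ck_on_has_derivative[OF _ assms(3,2)])
      (use assms(1) in \<open>simp_all only: smooth_on_open[OF assms(2)]\<close>)
qed

section \<open>Smooth maps between manifolds\<close>

text \<open>Charts without any compatibility condition: enough for composing smooth maps.\<close>

definition chart_atlas :: "('m::topological_space, 'e::real_normed_vector) atlas \<Rightarrow> bool" where
  "chart_atlas \<A> \<longleftrightarrow> (\<forall>p. \<exists>(U, \<phi>)\<in>\<A>. p \<in> U) \<and>
     (\<forall>(U, \<phi>)\<in>\<A>. open U \<and> open (\<phi> ` U) \<and> inj_on \<phi> U \<and> continuous_on U \<phi> \<and>
        continuous_on (\<phi> ` U) (inv_into U \<phi>))"

lemma chart_atlas_cover:
  assumes "chart_atlas \<A>"
  obtains U \<phi> where "(U, \<phi>) \<in> \<A>" "p \<in> U"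
  using assms unfolding chart_atlas_def by blast

lemma chart_atlasD:
  assumes "chart_atlas \<A>" "(U, \<phi>) \<in> \<A>"
  shows "open U" "open (\<phi> ` U)" "inj_on \<phi> U" "continuous_on U \<phi>" "continuous_on (\<phi> ` U) (inv_into U \<phi>)"
  using assms unfolding chart_atlas_def by blast+

lemma chart_inv:
  assumes "chart_atlas \<A>" "(U, \<phi>) \<in> \<A>" "p \<in> U"
  shows "inv_into U \<phi> (\<phi> p) = p"
  using chart_atlasD(3)[OF assms(1,2)] assms(3) by simp

lemma chart_open_image:
  assumes "chart_atlas \<A>" "(U, \<phi>) \<in> \<A>" "open W"
  shows "open (\<phi> ` (U \<inter> W))"
proof -
  note c = chart_atlasD[OF assms(1,2)]
  have "open (\<phi> ` U \<inter> inv_into U \<phi> -` W)"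
    by (rule continuous_open_preimage) (use c assms(3) in auto)
  moreover have "\<phi> ` U \<inter> inv_into U \<phi> -` W = \<phi> ` (U \<inter> W)"
    using c(3) by auto
  ultimately show ?thesis by simp
qed

lemma smooth_atlas_chart_atlas:
  assumes "smooth_atlas \<A>"
  shows "chart_atlas \<A>"
proof -
  have "open U \<and> open (\<phi> ` U) \<and> inj_on \<phi> U \<and> continuous_on U \<phi> \<and> continuous_on (\<phi> ` U) (inv_into U \<phi>)"
    if "(U, \<phi>) \<in> \<A>" for U \<phi>
  proof -
    have *: "open U" "open (\<phi> ` U)" "homeomorphism U (\<phi> ` U) \<phi> (inv_into U \<phi>)"
      using bspec[OF assms[unfolded smooth_atlas_def, THEN conjunct2, THEN conjunct1] that] by simp_all
    then have "inj_on \<phi> U" by (metis homeomorphism_apply1 inj_on_inverseI)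
    then show ?thesis using * by (simp add: homeomorphism_def)
  qed
  moreover have "\<forall>p. \<exists>(U, \<phi>)\<in>\<A>. p \<in> U"
    using assms unfolding smooth_atlas_def by (rule conjunct1)
  ultimately show ?thesis unfolding chart_atlas_def by blast
qed

lemma chart_atlas_std: "chart_atlas (std_atlas :: ('e::real_normed_vector, 'e) atlas)"
  by (simp add: chart_atlas_def std_atlas_def inv_id[unfolded id_def] id_def)

lemma inv_into_map_prod:
  assumes "inj_on \<phi> U" "inj_on \<psi> V" "a \<in> U" "b \<in> V"
  shows "inv_into (U \<times> V) (map_prod \<phi> \<psi>) (\<phi> a, \<psi> b) = (a, b)"
proof -
  have "inj_on (map_prod \<phi> \<psi>) (U \<times> V)"
    using assms(1,2) by (rule map_prod_inj_on)
  from inv_into_f_f[OF this, of "(a, b)"] show ?thesis using assms(3,4) by simp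
qed

lemma chart_atlas_prod:
  assumes "chart_atlas \<A>" "chart_atlas \<B>"
  shows "chart_atlas (prod_atlas \<A> \<B>)"
  unfolding chart_atlas_def
proof (intro conjI allI ballI)
  fix p :: "'a \<times> 'c"
  obtain U \<phi> where "(U, \<phi>) \<in> \<A>" "fst p \<in> U" using chart_atlas_cover[OF assms(1)] by blast
  moreover obtain V \<psi> where "(V, \<psi>) \<in> \<B>" "snd p \<in> V" using chart_atlas_cover[OF assms(2)] by blast
  ultimately have "(U \<times> V, map_prod \<phi> \<psi>) \<in> prod_atlas \<A> \<B>" "p \<in> U \<times> V"
    unfolding prod_atlas_def by (blast, simp add: mem_Times_iff)
  then show "\<exists>(W, \<kappa>)\<in>prod_atlas \<A> \<B>. p \<in> W"
    by (intro bexI[of _ "(U \<times> V, map_prod \<phi> \<psi>)"]) simp_all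
next
  fix W\<kappa> assume "W\<kappa> \<in> prod_atlas \<A> \<B>"
  then obtain U \<phi> V \<psi> where W: "W\<kappa> = (U \<times> V, map_prod \<phi> \<psi>)" and U: "(U, \<phi>) \<in> \<A>" and V: "(V, \<psi>) \<in> \<B>"
    unfolding prod_atlas_def by blast
  note u = chart_atlasD[OF assms(1) U] and v = chart_atlasD[OF assms(2) V]
  have im: "map_prod \<phi> \<psi> ` (U \<times> V) = \<phi> ` U \<times> \<psi> ` V" by (rule map_prod_image)
  have 1: "open (U \<times> V)" "open (map_prod \<phi> \<psi> ` (U \<times> V))" unfolding im
    using u v by (auto intro: open_Times)
  have 2: "inj_on (map_prod \<phi> \<psi>) (U \<times> V)" using u(3) v(3) by (rule map_prod_inj_on)
  have 3: "continuous_on (U \<times> V) (map_prod \<phi> \<psi>)"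
    unfolding map_prod_def case_prod_beta
    by (intro continuous_on_Pair continuous_on_compose2[OF u(4)] continuous_on_compose2[OF v(4)]
        continuous_on_fst continuous_on_snd continuous_on_id) auto
  have "continuous_on (\<phi> ` U \<times> \<psi> ` V) (\<lambda>z. (inv_into U \<phi> (fst z), inv_into V \<psi> (snd z)))"
    by (intro continuous_on_Pair continuous_on_compose2[OF u(5)] continuous_on_compose2[OF v(5)]
        continuous_on_fst continuous_on_snd continuous_on_id) auto
  then have 4: "continuous_on (\<phi> ` U \<times> \<psi> ` V) (inv_into (U \<times> V) (map_prod \<phi> \<psi>))"
    by (rule continuous_on_eq) (use u(3) v(3) in \<open>auto simp: inv_into_map_prod\<close>)
  show "case W\<kappa> of (W, \<kappa>) \<Rightarrow> open W \<and> open (\<kappa> ` W) \<and> inj_on \<kappa> W \<and> continuous_on W \<kappa> \<and>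
        continuous_on (\<kappa> ` W) (inv_into W \<kappa>)"
    unfolding W prod.case using 1 2 3 4 unfolding im by blast
qed

text \<open>Lets a map of two vector parameters be built with the product lemmas and then be read as
  a map on one normed space.\<close>

lemma prod_atlas_std: "prod_atlas std_atlas std_atlas = std_atlas"
  by (auto simp: prod_atlas_def std_atlas_def map_prod.id)

section \<open>Smooth maps between manifolds: locality, composition, products\<close>

lemma smooth_map_onI:
  assumes "continuous_on S F"
    and "\<And>U \<phi> V \<psi>. (U, \<phi>) \<in> \<A> \<Longrightarrow> (V, \<psi>) \<in> \<B> \<Longrightarrow>
      smooth_on (\<phi> ` {p \<in> S \<inter> U. F p \<in> V}) (\<lambda>x. \<psi> (F (inv_into U \<phi> x)))"
  shows "smooth_map_on \<A> S \<B> F"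
  using assms unfolding smooth_map_on_def comp_def by blast

lemma smooth_map_onD:
  assumes "smooth_map_on \<A> S \<B> F"
  shows "continuous_on S F"
    and "(U, \<phi>) \<in> \<A> \<Longrightarrow> (V, \<psi>) \<in> \<B> \<Longrightarrow>
      smooth_on (\<phi> ` {p \<in> S \<inter> U. F p \<in> V}) (\<lambda>x. \<psi> (F (inv_into U \<phi> x)))"
  using assms unfolding smooth_map_on_def comp_def by blast+

lemma smooth_map_on_std:
  fixes f :: "'a::real_normed_vector \<Rightarrow> 'b::real_normed_vector"
  shows "smooth_map_on std_atlas S std_atlas f \<longleftrightarrow> smooth_on S f"
proof -
  have "inv_into UNIV id = (id :: 'a \<Rightarrow> 'a)" by (rule inv_id)
  then show ?thesis
    by (auto simp: smooth_map_on_def std_atlas_def comp_def intro: smooth_on_imp_continuous_on)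
qed

lemma smooth_map_on_cong:
  assumes "chart_atlas \<A>" "smooth_map_on \<A> S \<B> F" "\<And>p. p \<in> S \<Longrightarrow> F p = F' p"
  shows "smooth_map_on \<A> S \<B> F'"
proof (rule smooth_map_onI)
  show "continuous_on S F'"
    using smooth_map_onD(1)[OF assms(2)] assms(3) by (rule continuous_on_eq)
  fix U \<phi> V \<psi> assume c: "(U, \<phi>) \<in> \<A>" "(V, \<psi>) \<in> \<B>"
  have "{p \<in> S \<inter> U. F' p \<in> V} = {p \<in> S \<inter> U. F p \<in> V}" using assms(3) by auto
  moreover have "smooth_on (\<phi> ` {p \<in> S \<inter> U. F p \<in> V}) (\<lambda>x. \<psi> (F' (inv_into U \<phi> x)))"
    by (rule smooth_on_cong[OF smooth_map_onD(2)[OF assms(2) c]])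
      (use chart_inv[OF assms(1) c(1)] assms(3) in auto)
  ultimately show "smooth_on (\<phi> ` {p \<in> S \<inter> U. F' p \<in> V}) (\<lambda>x. \<psi> (F' (inv_into U \<phi> x)))"
    by simp
qed

lemma smooth_map_on_subset:
  assumes "smooth_map_on \<A> S \<B> F" "T \<subseteq> S"
  shows "smooth_map_on \<A> T \<B> F"
proof (rule smooth_map_onI)
  show "continuous_on T F" using smooth_map_onD(1)[OF assms(1)] assms(2) by (rule continuous_on_subset)
  fix U \<phi> V \<psi> assume c: "(U, \<phi>) \<in> \<A>" "(V, \<psi>) \<in> \<B>"
  show "smooth_on (\<phi> ` {p \<in> T \<inter> U. F p \<in> V}) (\<lambda>x. \<psi> (F (inv_into U \<phi> x)))"
    by (rule smooth_on_subset[OF smooth_map_onD(2)[OF assms(1) c]]) (use assms(2) in auto)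
qed

lemma smooth_map_on_local:
  fixes \<A> :: "('m::t2_space, 'e::real_normed_vector) atlas"
  assumes "chart_atlas \<A>"
    and loc: "\<And>p. p \<in> S \<Longrightarrow> \<exists>W. open W \<and> p \<in> W \<and> smooth_map_on \<A> (S \<inter> W) \<B> F"
  shows "smooth_map_on \<A> S \<B> F"
proof (rule smooth_map_onI)
  show "continuous_on S F"
    unfolding continuous_on_eq_continuous_within
  proof
    fix p assume p: "p \<in> S"
    then obtain W where W: "open W" "p \<in> W" "smooth_map_on \<A> (S \<inter> W) \<B> F" using loc by blast
    from smooth_map_onD(1)[OF W(3)] have "continuous (at p within (S \<inter> W)) F"
      using p W(2) by (simp add: continuous_on_eq_continuous_within)
    then show "continuous (at p within S) F"
      using at_within_nhd[OF W(2,1), of S "S \<inter> W"] by auto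
  qed
  fix U \<phi> V \<psi> assume c: "(U, \<phi>) \<in> \<A>" "(V, \<psi>) \<in> \<B>"
  show "smooth_on (\<phi> ` {p \<in> S \<inter> U. F p \<in> V}) (\<lambda>x. \<psi> (F (inv_into U \<phi> x)))"
  proof (rule smooth_on_local)
    fix x assume "x \<in> \<phi> ` {p \<in> S \<inter> U. F p \<in> V}"
    then obtain p where p: "p \<in> S" "p \<in> U" "F p \<in> V" "x = \<phi> p" by blast
    then obtain W where W: "open W" "p \<in> W" "smooth_map_on \<A> (S \<inter> W) \<B> F" using loc by blast
    have "smooth_on (\<phi> ` {p \<in> S \<inter> U. F p \<in> V} \<inter> \<phi> ` (U \<inter> W)) (\<lambda>x. \<psi> (F (inv_into U \<phi> x)))"
      by (rule smooth_on_subset[OF smooth_map_onD(2)[OF W(3) c]])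
        (use chart_atlasD(3)[OF assms(1) c(1)] in \<open>auto simp: inj_on_def\<close>)
    then show "\<exists>T. open T \<and> x \<in> T \<and>
        smooth_on (\<phi> ` {p \<in> S \<inter> U. F p \<in> V} \<inter> T) (\<lambda>x. \<psi> (F (inv_into U \<phi> x)))"
      using chart_open_image[OF assms(1) c(1) W(1)] p W(2) by blast
  qed
qed

text \<open>No single chart of the middle manifold need contain the image of a chart domain. Near
  each point a chart around \<open>F p\<close> is inserted, and the domain is shrunk to a set
  \<open>T'\<close> on which \<open>F\<close> stays in that chart.\<close>

lemma smooth_map_on_compose:
  fixes \<B> :: "('n::topological_space, 'f::finite_dim_normed_space) atlas"
  assumes \<A>: "chart_atlas \<A>" and \<B>: "chart_atlas \<B>"
    and F: "smooth_map_on \<A> S \<B> F" and H: "smooth_map_on \<B> T \<C> H" and sub: "F ` S \<subseteq> T"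
  shows "smooth_map_on \<A> S \<C> (\<lambda>p. H (F p))"
proof (rule smooth_map_onI)
  show "continuous_on S (\<lambda>p. H (F p))"
    using smooth_map_onD(1)[OF H] smooth_map_onD(1)[OF F] sub by (rule continuous_on_compose2)
  fix U \<phi> W \<kappa> assume U: "(U, \<phi>) \<in> \<A>" and W: "(W, \<kappa>) \<in> \<C>"
  let ?Q = "\<phi> ` {p \<in> S \<inter> U. H (F p) \<in> W}"
  show "smooth_on ?Q (\<lambda>x. \<kappa> (H (F (inv_into U \<phi> x))))"
  proof (rule smooth_on_local)
    fix x assume "x \<in> ?Q"
    then obtain p where p: "p \<in> S" "p \<in> U" "H (F p) \<in> W" "x = \<phi> p" by blast
    obtain V \<psi> where V: "(V, \<psi>) \<in> \<B>" "F p \<in> V" using chart_atlas_cover[OF \<B>] by blast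
    obtain N where N: "open N" "N \<inter> S = F -` V \<inter> S"
      using continuous_on_open_invariant[THEN iffD1, OF smooth_map_onD(1)[OF F], rule_format,
          OF chart_atlasD(1)[OF \<B> V(1)]] by blast
    define T' where "T' = \<phi> ` (U \<inter> N)"
    have QT: "?Q \<inter> T' \<subseteq> \<phi> ` {p \<in> S \<inter> U. F p \<in> V \<and> H (F p) \<in> W}"
    proof
      fix z assume "z \<in> ?Q \<inter> T'"
      then obtain p q where pq: "p \<in> S" "p \<in> U" "H (F p) \<in> W" "z = \<phi> p" "q \<in> U" "q \<in> N" "z = \<phi> q"
        unfolding T'_def by blast
      then have "p = q" using chart_atlasD(3)[OF \<A> U] by (metis inj_onD)
      then have "F p \<in> V" using pq N(2) by blast
      then show "z \<in> \<phi> ` {p \<in> S \<inter> U. F p \<in> V \<and> H (F p) \<in> W}" using pq by blast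
    qed
    have el: "inv_into U \<phi> z \<in> S \<and> F (inv_into U \<phi> z) \<in> V \<and> H (F (inv_into U \<phi> z)) \<in> W"
      if z: "z \<in> ?Q \<inter> T'" for z
    proof -
      obtain p where "p \<in> S" "p \<in> U" "F p \<in> V" "H (F p) \<in> W" "z = \<phi> p"
        using subsetD[OF QT z] by blast
      then show ?thesis using chart_inv[OF \<A> U] by simp
    qed
    have "smooth_on (?Q \<inter> T') (\<lambda>x. \<psi> (F (inv_into U \<phi> x)))"
      by (rule smooth_on_subset[OF smooth_map_onD(2)[OF F U V(1)]]) (use QT in blast)
    moreover have "smooth_on (\<psi> ` {q \<in> T \<inter> V. H q \<in> W}) (\<lambda>y. \<kappa> (H (inv_into V \<psi> y)))"
      by (rule smooth_map_onD(2)[OF H V(1) W])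
    moreover have "(\<lambda>x. \<psi> (F (inv_into U \<phi> x))) ` (?Q \<inter> T') \<subseteq> \<psi> ` {q \<in> T \<inter> V. H q \<in> W}"
    proof
      fix y assume "y \<in> (\<lambda>x. \<psi> (F (inv_into U \<phi> x))) ` (?Q \<inter> T')"
      then obtain z where "z \<in> ?Q \<inter> T'" "y = \<psi> (F (inv_into U \<phi> z))" by (rule imageE)
      then show "y \<in> \<psi> ` {q \<in> T \<inter> V. H q \<in> W}" using el sub by blast
    qed
    ultimately have "smooth_on (?Q \<inter> T') (\<lambda>x. \<kappa> (H (inv_into V \<psi> (\<psi> (F (inv_into U \<phi> x))))))"
      by (rule smooth_on_compose)
    then have "smooth_on (?Q \<inter> T') (\<lambda>x. \<kappa> (H (F (inv_into U \<phi> x))))"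
      by (rule smooth_on_cong) (use el chart_inv[OF \<B> V(1)] in simp)
    moreover have "open T'" unfolding T'_def by (rule chart_open_image[OF \<A> U N(1)])
    moreover have "x \<in> T'" using p N(2) V(2) unfolding T'_def by auto
    ultimately show "\<exists>T. open T \<and> x \<in> T \<and> smooth_on (?Q \<inter> T) (\<lambda>x. \<kappa> (H (F (inv_into U \<phi> x))))"
      by blast
  qed
qed

lemma smooth_map_on_Pair:
  assumes "smooth_map_on \<A> S \<B> F" "smooth_map_on \<A> S \<C> H"
  shows "smooth_map_on \<A> S (prod_atlas \<B> \<C>) (\<lambda>p. (F p, H p))"
proof (rule smooth_map_onI)
  show "continuous_on S (\<lambda>p. (F p, H p))"
    by (intro continuous_on_Pair smooth_map_onD(1)[OF assms(1)] smooth_map_onD(1)[OF assms(2)])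
  fix U \<phi> W \<kappa> assume U: "(U, \<phi>) \<in> \<A>" and "(W, \<kappa>) \<in> prod_atlas \<B> \<C>"
  then obtain V1 \<psi>1 V2 \<psi>2 where W: "W = V1 \<times> V2" "\<kappa> = map_prod \<psi>1 \<psi>2" and V: "(V1, \<psi>1) \<in> \<B>" "(V2, \<psi>2) \<in> \<C>"
    unfolding prod_atlas_def by blast
  have "smooth_on (\<phi> ` {p \<in> S \<inter> U. (F p, H p) \<in> V1 \<times> V2})
      (\<lambda>x. (\<psi>1 (F (inv_into U \<phi> x)), \<psi>2 (H (inv_into U \<phi> x))))"
    by (intro smooth_on_Pair smooth_on_subset[OF smooth_map_onD(2)[OF assms(1) U V(1)]]
        smooth_on_subset[OF smooth_map_onD(2)[OF assms(2) U V(2)]]) auto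
  then show "smooth_on (\<phi> ` {p \<in> S \<inter> U. (F p, H p) \<in> W}) (\<lambda>x. \<kappa> (F (inv_into U \<phi> x), H (inv_into U \<phi> x)))"
    unfolding W by simp
qed

lemma smooth_map_on_fst:
  fixes \<A> :: "('m::topological_space, 'e::finite_dim_normed_space) atlas"
  assumes "chart_atlas \<A>" "chart_atlas \<B>" "smooth_map_on \<A> S \<C> F"
  shows "smooth_map_on (prod_atlas \<A> \<B>) (S \<times> T) \<C> (\<lambda>p. F (fst p))"
proof (rule smooth_map_onI)
  show "continuous_on (S \<times> T) (\<lambda>p. F (fst p))"
    by (rule continuous_on_compose2[OF smooth_map_onD(1)[OF assms(3)] continuous_on_fst[OF continuous_on_id]]) auto
  fix W \<kappa> V \<psi> assume V: "(V, \<psi>) \<in> \<C>" and "(W, \<kappa>) \<in> prod_atlas \<A> \<B>"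
  then obtain U \<phi> U' \<phi>' where W: "W = U \<times> U'" "\<kappa> = map_prod \<phi> \<phi>'" and U: "(U, \<phi>) \<in> \<A>" "(U', \<phi>') \<in> \<B>"
    unfolding prod_atlas_def by blast
  let ?Q = "map_prod \<phi> \<phi>' ` {p \<in> (S \<times> T) \<inter> (U \<times> U'). F (fst p) \<in> V}"
  have "smooth_on ?Q (\<lambda>x. \<psi> (F (inv_into U \<phi> (fst x))))"
    by (rule smooth_on_compose[OF smooth_on_bounded_linear[OF bounded_linear_fst] smooth_map_onD(2)[OF assms(3) U(1) V]])
      auto
  then have "smooth_on ?Q (\<lambda>x. \<psi> (F (fst (inv_into (U \<times> U') (map_prod \<phi> \<phi>') x))))"
    by (rule smooth_on_cong)
      (use chart_atlasD(3)[OF assms(1) U(1)] chart_atlasD(3)[OF assms(2) U(2)] in \<open>auto simp: inv_into_map_prod\<close>)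
  then show "smooth_on (\<kappa> ` {p \<in> (S \<times> T) \<inter> W. F (fst p) \<in> V}) (\<lambda>x. \<psi> (F (fst (inv_into W \<kappa> x))))"
    unfolding W .
qed

lemma smooth_map_on_snd:
  fixes \<B> :: "('m::topological_space, 'e::finite_dim_normed_space) atlas"
  assumes "chart_atlas \<A>" "chart_atlas \<B>" "smooth_map_on \<B> T \<C> F"
  shows "smooth_map_on (prod_atlas \<A> \<B>) (S \<times> T) \<C> (\<lambda>p. F (snd p))"
proof (rule smooth_map_onI)
  show "continuous_on (S \<times> T) (\<lambda>p. F (snd p))"
    by (rule continuous_on_compose2[OF smooth_map_onD(1)[OF assms(3)] continuous_on_snd[OF continuous_on_id]]) auto
  fix W \<kappa> V \<psi> assume V: "(V, \<psi>) \<in> \<C>" and "(W, \<kappa>) \<in> prod_atlas \<A> \<B>"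
  then obtain U \<phi> U' \<phi>' where W: "W = U \<times> U'" "\<kappa> = map_prod \<phi> \<phi>'" and U: "(U, \<phi>) \<in> \<A>" "(U', \<phi>') \<in> \<B>"
    unfolding prod_atlas_def by blast
  let ?Q = "map_prod \<phi> \<phi>' ` {p \<in> (S \<times> T) \<inter> (U \<times> U'). F (snd p) \<in> V}"
  have "smooth_on ?Q (\<lambda>x. \<psi> (F (inv_into U' \<phi>' (snd x))))"
    by (rule smooth_on_compose[OF smooth_on_bounded_linear[OF bounded_linear_snd] smooth_map_onD(2)[OF assms(3) U(2) V]])
      auto
  then have "smooth_on ?Q (\<lambda>x. \<psi> (F (snd (inv_into (U \<times> U') (map_prod \<phi> \<phi>') x))))"
    by (rule smooth_on_cong)
      (use chart_atlasD(3)[OF assms(1) U(1)] chart_atlasD(3)[OF assms(2) U(2)] in \<open>auto simp: inv_into_map_prod\<close>)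
  then show "smooth_on (\<kappa> ` {p \<in> (S \<times> T) \<inter> W. F (snd p) \<in> V}) (\<lambda>x. \<psi> (F (snd (inv_into W \<kappa> x))))"
    unfolding W .
qed

lemma smooth_map_on_const: "smooth_map_on \<A> S \<B> (\<lambda>p. c)"
  by (rule smooth_map_onI) (auto intro: smooth_on_const)

text \<open>Read in charts, the identity is a transition map; here the compatibility of the charts
  enters.\<close>

lemma smooth_map_on_id:
  assumes "smooth_atlas \<A>"
  shows "smooth_map_on \<A> S \<A> (\<lambda>p. p)"
proof (rule smooth_map_onI)
  fix U \<phi> V \<psi> assume c: "(U, \<phi>) \<in> \<A>" "(V, \<psi>) \<in> \<A>"
  then have "smooth_on (\<phi> ` (U \<inter> V)) (\<lambda>x. \<psi> (inv_into U \<phi> x))"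
    using assms unfolding smooth_atlas_def comp_def by blast
  then show "smooth_on (\<phi> ` {p \<in> S \<inter> U. p \<in> V}) (\<lambda>x. \<psi> (inv_into U \<phi> x))"
    by (rule smooth_on_subset) auto
qed (rule continuous_on_id)

lemma smooth_map_on_chart:
  assumes "smooth_atlas \<A>" "(U, \<phi>) \<in> \<A>"
  shows "smooth_fun_on \<A> U \<phi>"
proof (rule smooth_map_onI)
  show "continuous_on U \<phi>" using chart_atlasD(4)[OF smooth_atlas_chart_atlas] assms by blast
  fix V \<psi> W \<kappa> assume c: "(V, \<psi>) \<in> \<A>" "(W, \<kappa>) \<in> (std_atlas :: ('b, 'b) atlas)"
  then have "smooth_on (\<psi> ` (V \<inter> U)) (\<lambda>x. \<phi> (inv_into V \<psi> x))"
    using assms unfolding smooth_atlas_def comp_def by blast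
  moreover have W: "W = UNIV" "\<kappa> = id" using c by (auto simp: std_atlas_def)
  moreover have "{p \<in> U \<inter> V. \<phi> p \<in> W} = V \<inter> U" unfolding W by blast
  ultimately show "smooth_on (\<psi> ` {p \<in> U \<inter> V. \<phi> p \<in> W}) (\<lambda>x. \<kappa> (\<phi> (inv_into V \<psi> x)))"
    by simp
qed

lemma smooth_map_on_chart_inv:
  assumes "smooth_atlas \<A>" "(U, \<phi>) \<in> \<A>"
  shows "smooth_map_on std_atlas (\<phi> ` U) \<A> (inv_into U \<phi>)"
proof (rule smooth_map_onI)
  show "continuous_on (\<phi> ` U) (inv_into U \<phi>)"
    using chart_atlasD(5)[OF smooth_atlas_chart_atlas] assms by blast
  fix W \<kappa> V \<psi> assume c: "(V, \<psi>) \<in> \<A>" "(W, \<kappa>) \<in> (std_atlas :: ('b, 'b) atlas)"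
  then have W: "W = UNIV" "\<kappa> = id" by (auto simp: std_atlas_def)
  have "smooth_on (\<phi> ` (U \<inter> V)) (\<lambda>x. \<psi> (inv_into U \<phi> x))"
    using c assms unfolding smooth_atlas_def comp_def by blast
  moreover have "{p \<in> \<phi> ` U \<inter> W. inv_into U \<phi> p \<in> V} = \<phi> ` (U \<inter> V)"
    unfolding W using chart_inv[OF smooth_atlas_chart_atlas[OF assms(1)] assms(2)] by auto
  ultimately show "smooth_on (\<kappa> ` {p \<in> \<phi> ` U \<inter> W. inv_into U \<phi> p \<in> V}) (\<lambda>x. \<psi> (inv_into U \<phi> (inv_into W \<kappa> x)))"
    by (simp add: W inv_id)
qed

section \<open>Velocities of curves\<close>

lemma has_derivative_imp_has_vector_derivative:
  assumes "(f has_derivative f') (at t within I)"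
  shows "(f has_vector_derivative f' 1) (at t within I)"
proof -
  have "f' = (\<lambda>x. x *\<^sub>R f' 1)"
  proof
    fix x
    have "f' x = f' (x *\<^sub>R 1)" by simp
    also have "\<dots> = x *\<^sub>R f' 1" by (rule linear_cmul[OF has_derivative_linear[OF assms]])
    finally show "f' x = x *\<^sub>R f' 1" .
  qed
  with assms show ?thesis unfolding has_vector_derivative_def by (rule has_derivative_eq_rhs)
qed

lemma at_within_Int_open:
  assumes "open O'" "t \<in> O'"
  shows "at t within I \<inter> O' = at t within I"
  by (rule at_within_nhd[OF assms(2,1)]) blast

text \<open>A connected set with more than one point has no isolated points. This makes derivatives
  within \<open>I\<close> unique, also at endpoints.\<close>

lemma interval_at_within_nontrivial:
  fixes I :: "real set"
  assumes "is_interval I" "a \<in> I" "I \<noteq> {a}" "t \<in> I"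
  shows "at t within I \<noteq> bot"
proof -
  have "I \<noteq> {t}" using assms(2,3) by blast
  then have "t islimpt I"
    using assms(1,4) by (intro connected_imp_perfect) (auto simp: is_interval_connected)
  then show ?thesis by (simp add: trivial_limit_within)
qed

text \<open>Smoothness provides a total derivative \<open>H'\<close> at \<open>(t, t)\<close>; the
  given partial derivatives must be its values on the coordinate vectors, and along the diagonal the
  direction is \<open>(1, 1)\<close>, their sum. Smoothness is asked only when both times are near
  \<open>t\<close>, since the functions to which this is applied live in a trivialisation or near a
  point.\<close>

lemma diagonal_derivative:
  fixes H :: "real \<times> real \<Rightarrow> 'b::real_normed_vector"
  assumes H: "smooth_on ((J \<inter> N) \<times> (J \<inter> N)) H" and N: "open N" "t \<in> N" and t: "t \<in> J"
    and nt: "at t within J \<noteq> bot"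
    and d1: "((\<lambda>s. H (s, t)) has_vector_derivative d1) (at t within J)"
    and d2: "((\<lambda>s. H (t, s)) has_vector_derivative d2) (at t within J)"
  shows "((\<lambda>s. H (s, s)) has_vector_derivative d1 + d2) (at t within J)"
proof -
  let ?J = "J \<inter> N"
  obtain H' where H': "(H has_derivative H') (at (t, t) within ?J \<times> ?J)"
    using smooth_on_has_derivative_within[OF H, of "(t, t)"] t N by blast
  have lin: "linear H'" using H' by (rule has_derivative_linear)
  have comp: "((\<lambda>s. H (g s)) has_vector_derivative H' v) (at t within J)"
    if g: "(g has_derivative (\<lambda>x. x *\<^sub>R v)) (at t within ?J)" "g ` ?J \<subseteq> ?J \<times> ?J" "g t = (t, t)" for g v
  proof -
    have "(H has_derivative H') (at (g t) within g ` ?J)"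
      using has_derivative_subset[OF H' g(2)] g(3) by simp
    from has_derivative_in_compose[OF g(1) this] have "((\<lambda>s. H (g s)) has_derivative (\<lambda>x. H' (x *\<^sub>R v))) (at t within ?J)" .
    from has_derivative_imp_has_vector_derivative[OF this] show ?thesis
      by (simp add: at_within_Int_open[OF N])
  qed
  have "((\<lambda>s. H (s, t)) has_vector_derivative H' (1, 0)) (at t within J)"
    by (rule comp) (use t N in \<open>auto intro!: derivative_eq_intros\<close>)
  then have 1: "H' (1, 0) = d1" using nt d1 vector_derivative_unique_within by blast
  have "((\<lambda>s. H (t, s)) has_vector_derivative H' (0, 1)) (at t within J)"
    by (rule comp) (use t N in \<open>auto intro!: derivative_eq_intros\<close>)
  then have 2: "H' (0, 1) = d2" using nt d2 vector_derivative_unique_within by blast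
  have "((\<lambda>s. H (s, s)) has_vector_derivative H' (1, 1)) (at t within J)"
    by (rule comp) (use t N in \<open>auto intro!: derivative_eq_intros\<close>)
  moreover have "H' (1, 1) = H' (1, 0) + H' (0, 1)"
    using linear_add[OF lin, of "(1, 0)" "(0, 1)"] by simp
  ultimately show ?thesis using 1 2 by simp
qed

lemma smooth_nearE:
  assumes "smooth_near \<A> p f"
  obtains U where "open U" "p \<in> U" "smooth_fun_on \<A> U f"
  using assms unfolding smooth_near_def by blast

lemma smooth_nearI: "open U \<Longrightarrow> p \<in> U \<Longrightarrow> smooth_fun_on \<A> U f \<Longrightarrow> smooth_near \<A> p f"
  unfolding smooth_near_def by blast

lemma smooth_near_compose:
  fixes \<B> :: "('n::topological_space, 'f::finite_dim_normed_space) atlas"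
  assumes "chart_atlas \<A>" "chart_atlas \<B>" and W: "open W" "p \<in> W"
    and F: "smooth_map_on \<A> W \<B> F" and f: "smooth_near \<B> (F p) f"
  shows "smooth_near \<A> p (\<lambda>x. f (F x))"
  using f
proof (rule smooth_nearE)
  fix N assume N: "open N" "F p \<in> N" "smooth_fun_on \<B> N f"
  have "open (W \<inter> F -` N)"
    by (rule continuous_open_preimage[OF smooth_map_onD(1)[OF F] W(1) N(1)])
  moreover have "smooth_fun_on \<A> (W \<inter> F -` N) (\<lambda>x. f (F x))"
    by (rule smooth_map_on_compose[OF assms(1,2) smooth_map_on_subset[OF F] N(3)]) auto
  ultimately show ?thesis using W(2) N(2) by (intro smooth_nearI) auto
qed

lemma smooth_fun_on_linear:
  fixes f :: "_ \<Rightarrow> 'b::finite_dim_normed_space"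
  assumes "chart_atlas \<A>" "bounded_linear L" "smooth_fun_on \<A> U f"
  shows "smooth_fun_on \<A> U (\<lambda>x. L (f x))"
  by (rule smooth_map_on_compose[OF assms(1) chart_atlas_std assms(3), of UNIV])
    (simp_all add: smooth_map_on_std smooth_on_bounded_linear assms(2))

lemma smooth_near_linear:
  fixes f :: "_ \<Rightarrow> 'b::finite_dim_normed_space"
  assumes "chart_atlas \<A>" "bounded_linear L" "smooth_near \<A> p f"
  shows "smooth_near \<A> p (\<lambda>x. L (f x))"
  using assms(3)
proof (rule smooth_nearE)
  fix U assume U: "open U" "p \<in> U" "smooth_fun_on \<A> U f"
  show ?thesis by (rule smooth_nearI[OF U(1,2) smooth_fun_on_linear[OF assms(1,2) U(3)]])
qed

lemma smooth_near_chart: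
  assumes "smooth_atlas \<A>" "(U, \<phi>) \<in> \<A>" "p \<in> U"
  shows "smooth_near \<A> p \<phi>"
  by (rule smooth_nearI[OF chart_atlasD(1)[OF smooth_atlas_chart_atlas[OF assms(1)] assms(2)] assms(3)
        smooth_map_on_chart[OF assms(1,2)]])

text \<open>The product rule for a manifold-valued map of two times, seen through a test
  function.\<close>

lemma diagonal_derivative_map:
  fixes \<A> :: "('m::topological_space, 'e::finite_dim_normed_space) atlas"
  assumes \<A>: "chart_atlas \<A>" and K: "smooth_map_on std_atlas (J \<times> J) \<A> K"
    and f: "smooth_near \<A> (K (t, t)) f" and t: "t \<in> J" "at t within J \<noteq> bot"
    and d1: "((\<lambda>s. f (K (s, t))) has_vector_derivative d1) (at t within J)"
    and d2: "((\<lambda>s. f (K (t, s))) has_vector_derivative d2) (at t within J)"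
  shows "((\<lambda>s. f (K (s, s))) has_vector_derivative d1 + d2) (at t within J)"
proof -
  obtain N where N: "open N" "K (t, t) \<in> N" "smooth_fun_on \<A> N f" using f by (rule smooth_nearE)
  obtain Q where Q: "open Q" "Q \<inter> (J \<times> J) = K -` N \<inter> (J \<times> J)"
    using continuous_on_open_invariant[THEN iffD1, OF smooth_map_onD(1)[OF K], rule_format, OF N(1)] by blast
  have "(t, t) \<in> Q" using Q(2) N(2) t(1) by blast
  \<comment> \<open>The test function is smooth only near \<open>K (t, t)\<close>. A box inside its
    preimage, cut to the square on \<open>A \<inter> B\<close>, keeps both times in one
    neighbourhood, as \<open>diagonal_derivative\<close> requires.\<close>
  then obtain A B where AB: "open A" "open B" "(t, t) \<in> A \<times> B" "A \<times> B \<subseteq> Q"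
    using open_prod_elim[OF Q(1)] by metis
  have sub: "K ` ((J \<inter> (A \<inter> B)) \<times> (J \<inter> (A \<inter> B))) \<subseteq> N" using AB(4) Q(2) by blast
  have "smooth_fun_on std_atlas ((J \<inter> (A \<inter> B)) \<times> (J \<inter> (A \<inter> B))) (\<lambda>x. f (K x))"
    by (rule smooth_map_on_compose[OF chart_atlas_std \<A> smooth_map_on_subset[OF K] N(3) sub]) auto
  then show ?thesis
    using AB t d1 d2 unfolding smooth_map_on_std
    by (intro diagonal_derivative[where H = "\<lambda>x. f (K x)" and N = "A \<inter> B"]) auto
qed

lemma smooth_curve_has_vector_derivative:
  fixes \<A> :: "('m::topological_space, 'e::finite_dim_normed_space) atlas"
  assumes "chart_atlas \<A>" "smooth_map_on std_atlas I \<A> c" "t \<in> I" "smooth_near \<A> (c t) f"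
  shows "\<exists>d. ((\<lambda>s. f (c s)) has_vector_derivative d) (at t within I)"
proof -
  obtain N where N: "open N" "c t \<in> N" "smooth_fun_on \<A> N f" using assms(4) by (rule smooth_nearE)
  obtain Q where Q: "open Q" "Q \<inter> I = c -` N \<inter> I"
    using continuous_on_open_invariant[THEN iffD1, OF smooth_map_onD(1)[OF assms(2)], rule_format, OF N(1)] by blast
  have tQ: "t \<in> Q" using Q(2) N(2) assms(3) by blast
  have "smooth_fun_on std_atlas (I \<inter> Q) (\<lambda>x. f (c x))"
    by (rule smooth_map_on_compose[OF chart_atlas_std assms(1) smooth_map_on_subset[OF assms(2)] N(3)]) (use Q(2) in auto)
  then have "smooth_on (I \<inter> Q) (\<lambda>x. f (c x))" by (simp only: smooth_map_on_std)
  then obtain d where "((\<lambda>x. f (c x)) has_derivative d) (at t within I \<inter> Q)"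
    using smooth_on_has_derivative_within[of "I \<inter> Q"] assms(3) tQ by blast
  then have "((\<lambda>x. f (c x)) has_vector_derivative d 1) (at t within I \<inter> Q)"
    by (rule has_derivative_imp_has_vector_derivative)
  then show ?thesis unfolding at_within_Int_open[OF Q(1) tQ] by (rule exI)
qed

text \<open>\<open>velocity\<close> is built on the choice operator behind
  \<open>vector_derivative\<close>; it is meaningful here because a derivative exists and is unique
  within \<open>I\<close>.\<close>

lemma velocity_has_vector_derivative:
  fixes \<A> :: "('m::topological_space, 'e::finite_dim_normed_space) atlas"
  assumes "chart_atlas \<A>" "smooth_map_on std_atlas I \<A> c" "t \<in> I" "at t within I \<noteq> bot" "smooth_near \<A> (c t) f"
  shows "((\<lambda>s. f (c s)) has_vector_derivative velocity \<A> I c t f) (at t within I)"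
proof -
  obtain d where "((\<lambda>s. f (c s)) has_vector_derivative d) (at t within I)"
    using smooth_curve_has_vector_derivative[OF assms(1,2,3,5)] by blast
  moreover from this have "velocity \<A> I c t f = d"
    unfolding velocity_def using assms(4,5) by (simp add: vector_derivative_within)
  ultimately show ?thesis by simp
qed

lemma velocity_eqI:
  assumes "smooth_near \<A> (c t) f" "((\<lambda>s. f (c s)) has_vector_derivative d) (at t within I)" "at t within I \<noteq> bot"
  shows "velocity \<A> I c t f = d"
  using assms unfolding velocity_def by (simp add: vector_derivative_within)

text \<open>Tangent vectors act on real functions only, hence the detour through real and imaginary parts.\<close>

lemma complex_curve_derivative:
  fixes \<A> :: "('m::topological_space, 'e::finite_dim_normed_space) atlas" and F :: "'m \<Rightarrow> complex"
  assumes "chart_atlas \<A>" "smooth_map_on std_atlas I \<A> c" "t \<in> I" "smooth_near \<A> (c t) F"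
    and v: "\<And>f. smooth_near \<A> (c t) f \<Longrightarrow> ((\<lambda>s. f (c s)) has_vector_derivative v f) (at t within I)"
    and "at t within I \<noteq> bot"
  shows "((\<lambda>s. F (c s)) has_vector_derivative tvec_complex v F) (at t within I)"
proof -
  obtain d where d: "((\<lambda>s. F (c s)) has_vector_derivative d) (at t within I)"
    using smooth_curve_has_vector_derivative[OF assms(1-4)] by blast
  have "Re d = v (\<lambda>p. Re (F p))"
    by (rule vector_derivative_unique_within[OF assms(6) bounded_linear.has_vector_derivative[OF bounded_linear_Re d]])
      (rule v[OF smooth_near_linear[OF assms(1) bounded_linear_Re assms(4)]])
  moreover have "Im d = v (\<lambda>p. Im (F p))"
    by (rule vector_derivative_unique_within[OF assms(6) bounded_linear.has_vector_derivative[OF bounded_linear_Im d]])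
      (rule v[OF smooth_near_linear[OF assms(1) bounded_linear_Im assms(4)]])
  ultimately have "d = tvec_complex v F" by (simp add: tvec_complex_def complex_eq_iff)
  then show ?thesis using d by simp
qed

text \<open>Applied to the coordinate functions of a chart, the hypothesis makes every coordinate of
  \<open>c\<close> constant on a short convex piece of \<open>J\<close>. So \<open>c\<close> is
  locally constant, and connectedness of \<open>J\<close> finishes.\<close>

lemma curve_constant:
  fixes \<A> :: "('m::{t2_space, second_countable_topology}, 'e::finite_dim_normed_space) atlas"
  assumes \<A>: "smooth_atlas \<A>" and J: "is_interval J" and c: "smooth_map_on std_atlas J \<A> c"
    and zero: "\<And>t (f :: 'm \<Rightarrow> real). t \<in> J \<Longrightarrow> smooth_near \<A> (c t) f \<Longrightarrow> ((\<lambda>s. f (c s)) has_vector_derivative 0) (at t within J)"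
    and "s \<in> J" "t \<in> J"
  shows "c s = c t"
proof (rule connected_equivalence_relation[where R = "\<lambda>x y. c x = c y" and S = J])
  show "connected J" using J by (simp add: is_interval_connected)
  fix a assume a: "a \<in> J"
  note ch = smooth_atlas_chart_atlas[OF \<A>]
  obtain U \<phi> where U: "(U, \<phi>) \<in> \<A>" "c a \<in> U" using chart_atlas_cover[OF ch] by blast
  obtain Q where Q: "open Q" "Q \<inter> J = c -` U \<inter> J"
    using continuous_on_open_invariant[THEN iffD1, OF smooth_map_onD(1)[OF c], rule_format, OF chart_atlasD(1)[OF ch U(1)]]
    by blast
  have "a \<in> Q" using Q(2) U(2) a by blast
  then obtain d where d: "d > 0" "ball a d \<subseteq> Q" using openE[OF Q(1)] by blast
  let ?K = "J \<inter> ball a d"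
  have KU: "c x \<in> U" if "x \<in> ?K" for x using that d(2) Q(2) by blast
  have conv: "convex ?K" using J by (simp add: is_interval_convex_1 convex_Int)
  have "fd_coord b (\<phi> (c x)) = fd_coord b (\<phi> (c a))" if x: "x \<in> ?K" for b x
  proof -
    have "((\<lambda>s. fd_coord b (\<phi> (c s))) has_vector_derivative 0) (at y within ?K)" if y: "y \<in> ?K" for y
    proof -
      have yJ: "y \<in> J" using y by blast
      have "smooth_near \<A> (c y) (\<lambda>p. fd_coord b (\<phi> p))"
        by (rule smooth_near_linear[OF ch bounded_linear_fd_coord smooth_near_chart[OF \<A> U(1) KU[OF y]]])
      from zero[OF yJ this] y show ?thesis using at_within_Int_open[of "ball a d" y J] by simp
    qed
    then obtain k where "\<And>x. x \<in> ?K \<Longrightarrow> fd_coord b (\<phi> (c x)) = k"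
      using has_vector_derivative_zero_constant[OF conv] by blast
    then show ?thesis using x a d(1) by simp
  qed
  then have coords: "(\<Sum>b\<in>fd_basis. fd_coord b (\<phi> (c x)) *\<^sub>R b) = (\<Sum>b\<in>fd_basis. fd_coord b (\<phi> (c a)) *\<^sub>R b)"
    if "x \<in> ?K" for x
    using that by (intro sum.cong) simp_all
  have "c a = c x" if x: "x \<in> ?K" for x
  proof -
    have "\<phi> (c x) = \<phi> (c a)" using coords[OF x] unfolding fd_expand .
    then show ?thesis using inj_onD[OF chart_atlasD(3)[OF ch U(1)] _ KU[OF x] U(2)] by simp
  qed
  then show "\<exists>T. openin (top_of_set J) T \<and> a \<in> T \<and> (\<forall>x\<in>T. c a = c x)"
    using a d(1) by (intro exI[of _ ?K]) (simp add: openin_open_Int)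
qed (use assms in simp_all)

lemma vector_derivative_shift:
  fixes g :: "real \<Rightarrow> 'b::real_normed_vector"
  assumes "(g has_vector_derivative d) (at (a + t))"
  shows "((\<lambda>s. g (a + s)) has_vector_derivative d) (at t)"
proof -
  have "((\<lambda>s. a + s) has_vector_derivative 1) (at t)" by (auto intro!: derivative_eq_intros)
  from vector_diff_chain_at[OF this assms] show ?thesis by (simp add: comp_def)
qed

section \<open>Local solutions of ordinary differential equations\<close>

text \<open>The difference is the oriented integral from 0 to \<open>t\<close>. It is written with
  the base point \<open>-e\<close> because the integral over \<open>{0..t}\<close> would vanish for
  negative \<open>t\<close>.\<close>

lemma antiderivative_bound:
  fixes g :: "real \<Rightarrow> 'a::banach"
  assumes "0 < e" "continuous_on {-e..e} g" "\<And>s. s \<in> {-e..e} \<Longrightarrow> norm (g s) \<le> B" "t \<in> {-e..e}"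
  shows "norm (integral {-e..t} g - integral {-e..0} g) \<le> B * \<bar>t\<bar>"
proof -
  have "norm (integral {-e..t} g - integral {-e..0} g) \<le> B * norm (t - 0)"
  proof (rule differentiable_bound[where S = "{-e..e}" and f' = "\<lambda>s x. x *\<^sub>R g s"])
    show "((\<lambda>u. integral {-e..u} g) has_derivative (\<lambda>x. x *\<^sub>R g s)) (at s within {-e..e})"
      if "s \<in> {-e..e}" for s
      using integral_has_vector_derivative[OF assms(2) that] unfolding has_vector_derivative_def .
    show "onorm (\<lambda>x. x *\<^sub>R g s) \<le> B" if s: "s \<in> {-e..e}" for s
    proof (rule onorm_le)
      fix x :: real
      show "norm (x *\<^sub>R g s) \<le> B * norm x"
        using mult_left_mono[OF assms(3)[OF s], of "\<bar>x\<bar>"] by (simp add: mult.commute)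
    qed
  qed (use assms in auto)
  then show ?thesis by simp
qed

text \<open>Banach's fixed point theorem for the integral equation, on functions with values in
  \<open>cball x0 r\<close>.\<close>

lemma picard_local_solution:
  fixes f :: "'a::banach \<Rightarrow> 'a"
  assumes r: "0 < r" and L: "0 \<le> L"
    and lip: "\<And>x y. x \<in> cball x0 r \<Longrightarrow> y \<in> cball x0 r \<Longrightarrow> norm (f x - f y) \<le> L * norm (x - y)"
  obtains e u where "0 < e" "u 0 = x0" "\<And>t. t \<in> {-e<..<e} \<Longrightarrow> u t \<in> cball x0 r"
    "\<And>t. t \<in> {-e<..<e} \<Longrightarrow> (u has_vector_derivative f (u t)) (at t)"
proof -
  \<comment> \<open>Bounds \<open>f\<close> on the ball by the Lipschitz estimate from the centre;
    the added 1 makes it a legitimate divisor.\<close>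
  define M where "M = norm (f x0) + L * r + 1"
  have M: "0 < M" unfolding M_def using r L by (simp add: add_nonneg_pos)
  have fM: "norm (f x) \<le> M" if x: "x \<in> cball x0 r" for x
  proof -
    have "norm (f x - f x0) \<le> L * norm (x - x0)" using lip[OF x, of x0] r by simp
    also have "\<dots> \<le> L * r" using x L by (intro mult_left_mono) (simp_all add: dist_norm norm_minus_commute)
    finally show ?thesis using norm_triangle_sub[of "f x" "f x0"] by (simp add: M_def)
  qed
  \<comment> \<open>\<open>r / M\<close> keeps the iterates in the ball, and
    \<open>1 / (2 * (L + 1))\<close> makes the contraction constant at most 1/2, also when
    \<open>L\<close> is 0.\<close>
  define e where "e = min (r / M) (1 / (2 * (L + 1)))"
  have e: "0 < e" unfolding e_def using r M L by simp
  have "M * e \<le> M * (r / M)" unfolding e_def using M by (intro mult_left_mono) simp_all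
  then have eM: "M * e \<le> r" using M by simp
  have "L * e \<le> L * (1 / (2 * (L + 1)))" unfolding e_def using L by (intro mult_left_mono) simp_all
  also have "\<dots> \<le> 1 / 2" using L by (simp add: field_simps)
  finally have eL: "L * e \<le> 1 / 2" .
  \<comment> \<open>Time is clamped to \<open>{-e..e}\<close>, so that iterates are bounded
    continuous functions on the whole line and the complete type of such functions can be used.
    Inside the interval the clamp is the identity.\<close>
  define cl where "cl t = max (-e) (min e t)" for t
  have cl: "cl t \<in> {-e..e}" "\<bar>cl t\<bar> \<le> e" for t unfolding cl_def using e by auto
  have contf: "continuous_on (cball x0 r) f"
    by (rule lipschitz_on_continuous_on[of L]) (intro lipschitz_onI, use lip L in \<open>simp_all add: dist_norm\<close>)
  define S where "S = PiC UNIV (\<lambda>_::real. cball x0 r)"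
  have S: "u \<in> S \<longleftrightarrow> (\<forall>t. apply_bcontfun u t \<in> cball x0 r)" for u
    unfolding S_def mem_PiC_iff by (simp add: Pi_iff)
  define g :: "(real \<Rightarrow>\<^sub>C 'a) \<Rightarrow> real \<Rightarrow> 'a" where "g u s = f (apply_bcontfun u s)" for u s
  have contg: "continuous_on T (g u)" if "u \<in> S" for u T
    unfolding g_def using that S
    by (intro continuous_on_compose2[OF contf continuous_on_apply_bcontfun]) auto
  define P where "P u t = x0 + (integral {-e..cl t} (g u) - integral {-e..0} (g u))" for u t
  have P_ball: "P u t \<in> cball x0 r" if u: "u \<in> S" for u t
  proof -
    have "norm (integral {-e..cl t} (g u) - integral {-e..0} (g u)) \<le> M * \<bar>cl t\<bar>"
      by (rule antiderivative_bound[OF e contg[OF u] _ cl(1)]) (use fM u S in \<open>auto simp: g_def\<close>)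
    also have "\<dots> \<le> M * e" using M cl(2) by (intro mult_left_mono) simp_all
    finally show ?thesis using eM by (simp add: P_def dist_norm norm_minus_commute)
  qed
  have contP: "continuous_on UNIV (P u)" if u: "u \<in> S" for u
  proof -
    have "continuous_on {-e..e} (\<lambda>t. integral {-e..t} (g u))"
      by (intro indefinite_integral_continuous_1 integrable_continuous_real contg u)
    moreover have "continuous_on UNIV cl" unfolding cl_def by (intro continuous_intros)
    ultimately have "continuous_on UNIV (\<lambda>t. integral {-e..cl t} (g u))"
      by (rule continuous_on_compose2) (use cl(1) in blast)
    then show ?thesis unfolding P_def by (intro continuous_intros)
  qed
  have Pb: "P u \<in> bcontfun" if u: "u \<in> S" for u
  proof -
    have "bounded (range (P u))"
      by (rule bounded_subset[OF bounded_cball[of x0 r]]) (use P_ball[OF u] in blast)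
    then show ?thesis using contP[OF u] by (simp add: bcontfun_def)
  qed
  define T where "T u = Bcontfun (P u)" for u
  have T: "apply_bcontfun (T u) = P u" if "u \<in> S" for u
    unfolding T_def by (rule Bcontfun_inverse[OF Pb[OF that]])
  have "\<exists>!u\<in>S. T u = u"
  proof (rule Banach_fix[where c = "1/2"])
    show "complete S" unfolding S_def complete_eq_closed by (rule closed_PiC) simp
    have "const_bcontfun x0 \<in> S" using S r by simp
    then show "S \<noteq> {}" by blast
    show "T ` S \<subseteq> S"
    proof
      fix v assume "v \<in> T ` S"
      then obtain u where u: "u \<in> S" "v = T u" by blast
      show "v \<in> S" unfolding S u(2) T[OF u(1)] using P_ball[OF u(1)] by blast
    qed
    show "dist (T u) (T v) \<le> 1/2 * dist u v" if u: "u \<in> S" and v: "v \<in> S" for u v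
    proof (rule dist_bound)
      fix t
      have int: "g w integrable_on {-e..s}" if "w \<in> S" for w s
        by (intro integrable_continuous_real contg that)
      have "dist (T u t) (T v t) = norm (integral {-e..cl t} (\<lambda>s. g u s - g v s) - integral {-e..0} (\<lambda>s. g u s - g v s))"
        unfolding T[OF u] T[OF v] P_def dist_norm
        by (simp add: integral_diff[OF int[OF u] int[OF v]] algebra_simps)
      also have "\<dots> \<le> (L * dist u v) * \<bar>cl t\<bar>"
      proof (rule antiderivative_bound[OF e _ _ cl(1)])
        show "continuous_on {-e..e} (\<lambda>s. g u s - g v s)" by (intro continuous_on_diff contg u v)
        fix s
        have "norm (g u s - g v s) \<le> L * norm (apply_bcontfun u s - apply_bcontfun v s)"
          unfolding g_def by (rule lip) (use u v S in blast)+
        also have "\<dots> \<le> L * dist u v"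
          using dist_bounded[of u s v] L by (intro mult_left_mono) (simp_all add: dist_norm)
        finally show "norm (g u s - g v s) \<le> L * dist u v" .
      qed
      also have "\<dots> \<le> (L * dist u v) * e" using L cl(2) by (intro mult_left_mono) simp_all
      also have "\<dots> = (L * e) * dist u v" by simp
      also have "\<dots> \<le> 1/2 * dist u v" by (rule mult_right_mono[OF eL]) simp
      finally show "dist (T u t) (T v t) \<le> 1/2 * dist u v" .
    qed
  qed simp_all
  then obtain u where u: "u \<in> S" "T u = u" by blast
  have uP: "apply_bcontfun u t = P u t" for t using T[OF u(1)] u(2) by simp
  show ?thesis
  proof (rule that[of e "apply_bcontfun u"])
    show "0 < e" by (rule e)
    show "apply_bcontfun u 0 = x0" unfolding uP P_def cl_def using e by simp
    show "apply_bcontfun u t \<in> cball x0 r" for t using u(1) S by blast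
    fix t assume t: "t \<in> {-e<..<e}"
    have "((\<lambda>u'. integral {-e..u'} (g u)) has_vector_derivative g u t) (at t within {-e..e})"
      by (rule integral_has_vector_derivative[OF contg[OF u(1)]]) (use t in simp)
    moreover have "at t within {-e..e} = at t" using t by (intro at_within_Icc_at) auto
    ultimately have "((\<lambda>u'. integral {-e..u'} (g u)) has_vector_derivative g u t) (at t)" by simp
    then have "((\<lambda>s. x0 + (integral {-e..s} (g u) - integral {-e..0} (g u))) has_vector_derivative g u t) (at t)"
      by (auto intro!: derivative_eq_intros)
    then have "(apply_bcontfun u has_vector_derivative g u t) (at t)"
    proof (rule has_vector_derivative_transform_within_open[where S = "{-e<..<e}"])
      fix s assume "s \<in> {-e<..<e}"
      then have "cl s = s" unfolding cl_def by auto
      then show "x0 + (integral {-e..s} (g u) - integral {-e..0} (g u)) = apply_bcontfun u s"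
        unfolding uP[of s] P_def by simp
    qed (use t in auto)
    then show "(apply_bcontfun u has_vector_derivative f (apply_bcontfun u t)) (at t)" by (simp add: g_def)
  qed
qed

text \<open>\<open>Ck_on\<close> gives continuity of the derivative only in each fixed direction.
  Finitely many basis directions suffice to bound the operator norm near \<open>x0\<close>, and the
  mean value inequality on a ball gives the Lipschitz constant.\<close>

lemma smooth_on_locally_lipschitz:
  fixes f :: "'a::finite_dim_normed_space \<Rightarrow> 'b::real_normed_vector"
  assumes S: "open S" "x0 \<in> S" and f: "smooth_on S f"
  obtains r L where "0 < r" "0 \<le> L" "cball x0 r \<subseteq> S"
    "\<And>x y. x \<in> cball x0 r \<Longrightarrow> y \<in> cball x0 r \<Longrightarrow> norm (f x - f y) \<le> L * norm (x - y)"
proof -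
  have "Ck_on (Suc 0) S f" using f smooth_on_open[OF S(1)] by blast
  then obtain f' where f': "\<And>x. x \<in> S \<Longrightarrow> (f has_derivative f' x) (at x)" "\<And>v. Ck_on 0 S (\<lambda>x. f' x v)"
    by (rule Ck_on_SucE) (rule that)
  define B where "B b = norm (f' x0 b) + 1" for b
  have "\<forall>\<^sub>F x in nhds x0. norm (f' x b) < B b" for b
  proof -
    have "continuous_on S (\<lambda>x. f' x b)" using f'(2)[of b] by simp
    then have "isCont (\<lambda>x. norm (f' x b)) x0"
      using S by (simp add: continuous_on_eq_continuous_at continuous_norm)
    then have "((\<lambda>x. norm (f' x b)) \<longlongrightarrow> norm (f' x0 b)) (nhds x0)"
      by (simp add: isCont_def tendsto_nhds_iff)
    then show ?thesis by (rule order_tendstoD) (simp add: B_def)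
  qed
  then have "\<forall>\<^sub>F x in nhds x0. \<forall>b\<in>fd_basis. norm (f' x b) < B b"
    by (intro eventually_ball_finite finite_fd_basis) blast
  moreover have "\<forall>\<^sub>F x in nhds x0. x \<in> S" using S by (rule eventually_nhds_in_open)
  ultimately have "\<forall>\<^sub>F x in nhds x0. x \<in> S \<and> (\<forall>b\<in>fd_basis. norm (f' x b) < B b)"
    by eventually_elim blast
  then obtain d where d: "d > 0" "\<And>x. dist x x0 < d \<Longrightarrow> x \<in> S \<and> (\<forall>b\<in>fd_basis. norm (f' x b) < B b)"
    unfolding eventually_nhds_metric by blast
  have "\<forall>b. \<exists>K\<ge>0. \<forall>v::'a. \<bar>fd_coord b v\<bar> \<le> norm v * K"
    using bounded_linear.nonneg_bounded[OF bounded_linear_fd_coord] unfolding real_norm_def by blast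
  then obtain K where K: "\<And>b. 0 \<le> K b" "\<And>b v::'a. \<bar>fd_coord b v\<bar> \<le> norm v * K b" by metis
  \<comment> \<open>\<open>K b\<close> bounds the coordinate \<open>fd_coord b\<close> and
    \<open>B b\<close> the derivative in direction \<open>b\<close>; summing over the basis bounds
    the operator norm.\<close>
  define L where "L = (\<Sum>b\<in>(fd_basis::'a set). K b * B b)"
  have B0: "0 \<le> B b" for b by (simp add: B_def)
  have x: "x \<in> S" "\<And>b. b \<in> fd_basis \<Longrightarrow> norm (f' x b) < B b" if "x \<in> cball x0 (d/2)" for x
    using d(2)[of x] that d(1) by (auto simp: dist_commute)
  show ?thesis
  proof (rule that[of "d/2" L])
    show "0 < d/2" using d(1) by simp
    show "0 \<le> L" unfolding L_def by (intro sum_nonneg mult_nonneg_nonneg K B0)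
    show "cball x0 (d/2) \<subseteq> S" using x(1) by blast
    fix y z assume y: "y \<in> cball x0 (d/2)" and z: "z \<in> cball x0 (d/2)"
    show "norm (f y - f z) \<le> L * norm (y - z)"
    proof (rule differentiable_bound[where S = "cball x0 (d/2)" and f' = f'])
      fix w assume w: "w \<in> cball x0 (d/2)"
      show D: "(f has_derivative f' w) (at w within cball x0 (d/2))"
        by (rule has_derivative_at_withinI[OF f'(1)[OF x(1)[OF w]]])
      show "onorm (f' w) \<le> L"
      proof (rule onorm_bound)
        show "0 \<le> L" unfolding L_def by (intro sum_nonneg mult_nonneg_nonneg K B0)
        fix v
        have lin: "linear (f' w)" using D by (rule has_derivative_linear)
        have "f' w v = f' w (\<Sum>b\<in>fd_basis. fd_coord b v *\<^sub>R b)" by (simp only: fd_expand)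
        also have "\<dots> = (\<Sum>b\<in>fd_basis. fd_coord b v *\<^sub>R f' w b)"
          by (simp add: linear_sum[OF lin] linear_cmul[OF lin])
        also have "norm \<dots> \<le> (\<Sum>b\<in>fd_basis. norm v * K b * B b)"
        proof (rule sum_norm_le)
          fix b :: 'a assume b: "b \<in> fd_basis"
          have "norm (fd_coord b v *\<^sub>R f' w b) = \<bar>fd_coord b v\<bar> * norm (f' w b)" by simp
          also have "\<dots> \<le> (norm v * K b) * B b"
            using K(2)[of b v] x(2)[OF w b] K(1)[of b] by (intro mult_mono) simp_all
          finally show "norm (fd_coord b v *\<^sub>R f' w b) \<le> norm v * K b * B b" .
        qed
        also have "\<dots> = L * norm v" unfolding L_def by (simp add: sum_distrib_left sum_distrib_right ac_simps)
        finally show "norm (f' w v) \<le> L * norm v" .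
      qed
    qed (use y z in auto)
  qed
qed

text \<open>Bootstrapping: if \<open>x\<close> is \<open>C\<^sup>k\<close>, then so is its
  derivative \<open>V (x t)\<close>, hence \<open>x\<close> is one order better.\<close>

lemma ode_solution_smooth:
  fixes x :: "real \<Rightarrow> 'a::finite_dim_normed_space"
  assumes J: "open J" and S: "open S" and V: "smooth_on S V" and sub: "x ` J \<subseteq> S"
    and x: "\<And>t. t \<in> J \<Longrightarrow> (x has_vector_derivative V (x t)) (at t)"
  shows "smooth_on J x"
proof -
  have VC: "Ck_on k S V" for k using V smooth_on_open[OF S] by blast
  have "Ck_on k J x" for k
  proof (induction k)
    case 0
    have "continuous_on J x"
      by (intro continuous_at_imp_continuous_on ballI) (rule has_vector_derivative_continuous[OF x])
    then show ?case by simp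
  next
    case (Suc k)
    have "Ck_on k J (\<lambda>t. V (x t))" using Suc VC sub by (rule Ck_on_compose)
    then have "Ck_on k J (\<lambda>t. v *\<^sub>R V (x t))" for v
      by (rule Ck_on_linear_compose[OF bounded_linear_scaleR_right])
    then show ?case unfolding Ck_on.simps
      using x[unfolded has_vector_derivative_def] by (intro exI[of _ "\<lambda>t v. v *\<^sub>R V (x t)"]) simp
  qed
  then show ?thesis using smooth_on_open[OF J] by blast
qed

section \<open>One-parameter subgroups and the exponential map\<close>

locale lie =
  fixes G :: "('g::{t2_space, second_countable_topology}) monoid" (structure)
    and \<G> :: "('g, 'a::finite_dim_normed_space) atlas"
  assumes lie_group: "lie_group G \<G>"
begin

sublocale group G
  using lie_group unfolding lie_group_def by simp

lemma carrier_UNIV [simp]: "carrier G = UNIV"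
  using lie_group unfolding lie_group_def by simp

lemma smooth_atlas: "smooth_atlas \<G>"
  using lie_group unfolding lie_group_def by simp

lemma charts: "chart_atlas \<G>"
  by (rule smooth_atlas_chart_atlas[OF smooth_atlas])

lemma smooth_mult:
  assumes "chart_atlas \<A>" "smooth_map_on \<A> S \<G> F" "smooth_map_on \<A> S \<G> H"
  shows "smooth_map_on \<A> S \<G> (\<lambda>p. F p \<otimes> H p)"
proof -
  have m: "smooth_map_on (prod_atlas \<G> \<G>) UNIV \<G> (\<lambda>(x, y). x \<otimes> y)"
    using lie_group unfolding lie_group_def by simp
  have "smooth_map_on \<A> S \<G> (\<lambda>p. (\<lambda>(x, y). x \<otimes> y) (F p, H p))"
    by (rule smooth_map_on_compose[OF assms(1) chart_atlas_prod[OF charts charts]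
        smooth_map_on_Pair[OF assms(2,3)] m]) simp
  then show ?thesis by simp
qed

lemma smooth_inv:
  assumes "chart_atlas \<A>" "smooth_map_on \<A> S \<G> F"
  shows "smooth_map_on \<A> S \<G> (\<lambda>p. inv (F p))"
proof -
  have m: "smooth_map_on \<G> UNIV \<G> (\<lambda>x. inv x)"
    using lie_group unfolding lie_group_def by simp
  show ?thesis
    by (rule smooth_map_on_compose[OF assms(1) charts assms(2) m]) simp
qed

lemma smooth_id: "smooth_map_on \<G> S \<G> (\<lambda>x. x)"
  by (rule smooth_map_on_id[OF smooth_atlas])

lemma smooth_near_mult_left:
  assumes "smooth_near \<G> (a \<otimes> x) f"
  shows "smooth_near \<G> x (\<lambda>y. f (a \<otimes> y))"
  by (rule smooth_near_compose[OF charts charts open_UNIV UNIV_I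
        smooth_mult[OF charts smooth_map_on_const smooth_id] assms])

lemma smooth_near_mult_right:
  assumes "smooth_near \<G> (x \<otimes> a) f"
  shows "smooth_near \<G> x (\<lambda>y. f (y \<otimes> a))"
  by (rule smooth_near_compose[OF charts charts open_UNIV UNIV_I
        smooth_mult[OF charts smooth_id smooth_map_on_const] assms])

text \<open>Integral curves of the left-invariant vector field of \<open>A\<close>: the right-hand
  side is \<open>left_invariant_vf G A (c t)\<close> applied to \<open>f\<close>.\<close>

definition integral_curve :: "'g tvec \<Rightarrow> real set \<Rightarrow> (real \<Rightarrow> 'g) \<Rightarrow> bool" where
  "integral_curve A J c \<longleftrightarrow> smooth_map_on std_atlas J \<G> c \<and>
     (\<forall>t\<in>J. \<forall>f. smooth_near \<G> (c t) f \<longrightarrow>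
        ((\<lambda>s. f (c s)) has_vector_derivative A (\<lambda>y. f (c t \<otimes> y))) (at t))"

lemma integral_curveD:
  assumes "integral_curve A J c"
  shows "smooth_map_on std_atlas J \<G> c"
    and "t \<in> J \<Longrightarrow> smooth_near \<G> (c t) f \<Longrightarrow>
      ((\<lambda>s. f (c s)) has_vector_derivative A (\<lambda>y. f (c t \<otimes> y))) (at t)"
  using assms unfolding integral_curve_def by blast+

text \<open>The derivative of \<open>c\<^sub>2\<^sup>-\<^sup>1\<close> is found by differentiating \<open>c\<^sub>2 c\<^sub>2\<^sup>-\<^sup>1 = 1\<close>; then \<open>c\<^sub>1 c\<^sub>2\<^sup>-\<^sup>1\<close> has velocity zero.\<close>

lemma integral_curve_unique:
  assumes J: "is_interval J" "open J" and c1: "integral_curve A J c1" and c2: "integral_curve A J c2"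
    and s: "s \<in> J" "c1 s = c2 s" and t: "t \<in> J"
  shows "c1 t = c2 t"
proof -
  note sm1 = integral_curveD(1)[OF c1] and sm2 = integral_curveD(1)[OF c2]
  have fst_sm: "smooth_map_on std_atlas (J \<times> J) \<G> (\<lambda>p. c (fst p))"
    and snd_sm: "smooth_map_on std_atlas (J \<times> J) \<G> (\<lambda>p. c (snd p))"
    if "smooth_map_on std_atlas J \<G> c" for c
    using smooth_map_on_fst[OF chart_atlas_std chart_atlas_std that]
      smooth_map_on_snd[OF chart_atlas_std chart_atlas_std that] unfolding prod_atlas_std .
  have "c1 t \<otimes> inv (c2 t) = c1 s \<otimes> inv (c2 s)"
  proof (rule curve_constant[OF smooth_atlas J(1), where c = "\<lambda>t. c1 t \<otimes> inv (c2 t)"])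
    show "smooth_map_on std_atlas J \<G> (\<lambda>t. c1 t \<otimes> inv (c2 t))"
      by (intro smooth_mult smooth_inv chart_atlas_std sm1 sm2)
    fix t and f :: "'g \<Rightarrow> real"
    assume t: "t \<in> J" and f: "smooth_near \<G> (c1 t \<otimes> inv (c2 t)) f"
    have at: "at t within J = at t" using t J(2) by (rule at_within_open)
    have nt: "at t within J \<noteq> bot" unfolding at by simp
    let ?a = "c1 t" and ?b = "c2 t"
    have "((\<lambda>s. f (c1 s \<otimes> inv ?b)) has_vector_derivative A (\<lambda>y. f ((?a \<otimes> y) \<otimes> inv ?b))) (at t)"
      by (rule integral_curveD(2)[OF c1 t smooth_near_mult_right[OF f]])
    then have d1: "((\<lambda>s. f (c1 s \<otimes> inv ?b)) has_vector_derivative A (\<lambda>y. f (?a \<otimes> y \<otimes> inv ?b))) (at t within J)"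
      unfolding at .
    have sm3: "smooth_map_on std_atlas J \<G> (\<lambda>s. ?a \<otimes> inv (c2 s))"
      by (intro smooth_mult smooth_inv chart_atlas_std smooth_map_on_const sm2)
    obtain d2 where d2: "((\<lambda>s. f (?a \<otimes> inv (c2 s))) has_vector_derivative d2) (at t within J)"
      using smooth_curve_has_vector_derivative[OF charts sm3 t f] by blast
    \<comment> \<open>The factor \<open>?a \<otimes> inv ?b\<close> moves the curve
      \<open>c2\<close> to pass through \<open>?a\<close> at time \<open>t\<close>, where it has the
      same velocity as \<open>c1\<close>. The product with \<open>inv (c2 s)\<close> is constant, so
      the two partial derivatives cancel; they are exactly those of
      \<open>c1 s \<otimes> inv (c2 s)\<close>.\<close>
    have "((\<lambda>s. f (?a \<otimes> inv ?b \<otimes> c2 s \<otimes> inv (c2 s))) has_vector_derivative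
        A (\<lambda>y. f (?a \<otimes> y \<otimes> inv ?b)) + d2) (at t within J)"
    proof (rule diagonal_derivative_map[OF charts _ _ t nt, where K = "\<lambda>p. ?a \<otimes> inv ?b \<otimes> c2 (fst p) \<otimes> inv (c2 (snd p))", unfolded fst_conv snd_conv])
      show "smooth_map_on std_atlas (J \<times> J) \<G> (\<lambda>p. ?a \<otimes> inv ?b \<otimes> c2 (fst p) \<otimes> inv (c2 (snd p)))"
        by (intro smooth_mult smooth_inv chart_atlas_std smooth_map_on_const fst_sm snd_sm sm2)
      have f': "smooth_near \<G> (?a \<otimes> inv ?b \<otimes> ?b \<otimes> inv ?b) f"
        using f by (simp add: m_assoc)
      then show "smooth_near \<G> (?a \<otimes> inv ?b \<otimes> ?b \<otimes> inv ?b) f" .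
      have "((\<lambda>s. f (?a \<otimes> inv ?b \<otimes> c2 s \<otimes> inv ?b)) has_vector_derivative
          A (\<lambda>y. f (?a \<otimes> inv ?b \<otimes> (?b \<otimes> y) \<otimes> inv ?b))) (at t)"
        by (rule integral_curveD(2)[OF c2 t smooth_near_mult_left[OF smooth_near_mult_right[OF f']]])
      moreover have "?a \<otimes> inv ?b \<otimes> (?b \<otimes> y) \<otimes> inv ?b = ?a \<otimes> y \<otimes> inv ?b" for y
      proof -
        have "inv ?b \<otimes> (?b \<otimes> z) = z" for z by (simp add: m_assoc[symmetric])
        then show ?thesis by (simp add: m_assoc)
      qed
      ultimately show "((\<lambda>s. f (?a \<otimes> inv ?b \<otimes> c2 s \<otimes> inv ?b)) has_vector_derivative
          A (\<lambda>y. f (?a \<otimes> y \<otimes> inv ?b))) (at t within J)" unfolding at by simp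
      have "?a \<otimes> inv ?b \<otimes> ?b \<otimes> inv (c2 s) = ?a \<otimes> inv (c2 s)" for s by (simp add: m_assoc)
      then show "((\<lambda>s. f (?a \<otimes> inv ?b \<otimes> ?b \<otimes> inv (c2 s))) has_vector_derivative d2) (at t within J)"
        using d2 by simp
    qed
    moreover have "?a \<otimes> inv ?b \<otimes> c2 s \<otimes> inv (c2 s) = ?a \<otimes> inv ?b" for s by (simp add: m_assoc)
    ultimately have "((\<lambda>s. f (?a \<otimes> inv ?b)) has_vector_derivative
        A (\<lambda>y. f (?a \<otimes> y \<otimes> inv ?b)) + d2) (at t within J)" by simp
    then have zero: "A (\<lambda>y. f (?a \<otimes> y \<otimes> inv ?b)) + d2 = 0"
      using vector_derivative_unique_within[OF nt] has_vector_derivative_const by blast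
    have "((\<lambda>s. f (c1 s \<otimes> inv (c2 s))) has_vector_derivative
        A (\<lambda>y. f (?a \<otimes> y \<otimes> inv ?b)) + d2) (at t within J)"
      by (rule diagonal_derivative_map[OF charts _ _ t nt, where K = "\<lambda>p. c1 (fst p) \<otimes> inv (c2 (snd p))", unfolded fst_conv snd_conv, OF _ f d1 d2])
        (intro smooth_mult smooth_inv chart_atlas_std fst_sm snd_sm sm1 sm2)
    then show "((\<lambda>s. f (c1 s \<otimes> inv (c2 s))) has_vector_derivative 0) (at t within J)"
      unfolding zero .
  qed (use s t in simp_all)
  also have "\<dots> = \<one>" using s(2) by simp
  finally have "c1 t \<otimes> inv (c2 t) \<otimes> c2 t = c2 t" by simp
  then show ?thesis by (simp add: m_assoc)
qed

text \<open>In a chart at the identity the left-invariant field becomes a smooth vector field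
  \<open>V\<close> on an open set, so it is locally Lipschitz and Picard applies. Its definition
  through derivatives of the multiplication map makes it smooth without any separate theory of the
  tangent bundle.\<close>

lemma local_integral_curve:
  assumes "A \<in> lie_algebra G \<G>"
  obtains e \<gamma> where "0 < e" "integral_curve A {-e<..<e} \<gamma>" "\<gamma> 0 = \<one>"
proof -
  obtain c \<epsilon> where c: "A = velocity \<G> UNIV c 0" "c 0 = \<one>" "0 < \<epsilon>" "smooth_map_on std_atlas {-\<epsilon><..<\<epsilon>} \<G> c"
    using assms unfolding lie_algebra_def tangent_space_def by blast
  define I where "I = {-\<epsilon><..<\<epsilon>}"
  have I: "open I" "0 \<in> I" "smooth_map_on std_atlas I \<G> c" unfolding I_def using c(3,4) by auto
  obtain U \<phi> where U: "(U, \<phi>) \<in> \<G>" "\<one> \<in> U" using chart_atlas_cover[OF charts] by blast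
  note ch = chart_atlasD[OF charts U(1)] and ci = chart_inv[OF charts U(1)]
  define S where "S = \<phi> ` U"
  \<comment> \<open>Left translates of a curve \<open>c\<close> representing \<open>A\<close>: for
    fixed \<open>x\<close>, differentiating in the second argument at 0 gives the left-invariant
    field at the point with coordinates \<open>x\<close>.\<close>
  define E where "E p = inv_into U \<phi> (fst p) \<otimes> c (snd p)" for p
  have E: "smooth_map_on std_atlas (S \<times> I) \<G> E"
    unfolding E_def
    by (intro smooth_mult chart_atlas_std smooth_map_on_fst[OF chart_atlas_std chart_atlas_std, unfolded prod_atlas_std]
        smooth_map_on_snd[OF chart_atlas_std chart_atlas_std, unfolded prod_atlas_std] I(3))
      (unfold S_def, rule smooth_map_on_chart_inv[OF smooth_atlas U(1)])
  define W where "W = (S \<times> I) \<inter> E -` U"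
  have W: "open W" unfolding W_def
    by (rule continuous_open_preimage[OF smooth_map_onD(1)[OF E]]) (use ch I S_def in \<open>auto intro: open_Times\<close>)
  define \<Psi> where "\<Psi> p = \<phi> (E p)" for p
  have "smooth_fun_on std_atlas W \<Psi>" unfolding \<Psi>_def
    by (rule smooth_map_on_compose[OF chart_atlas_std charts smooth_map_on_subset[OF E] smooth_map_on_chart[OF smooth_atlas U(1)]])
      (auto simp: W_def)
  then have \<Psi>: "smooth_on W \<Psi>" unfolding smooth_map_on_std .
  have "\<forall>p. \<exists>d. p \<in> W \<longrightarrow> (\<Psi> has_derivative d) (at p)"
    using smooth_on_has_derivative_within[OF \<Psi>] at_within_open[OF _ W] by metis
  then obtain \<Psi>' where \<Psi>': "\<And>p. p \<in> W \<Longrightarrow> (\<Psi> has_derivative \<Psi>' p) (at p)" by metis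
  \<comment> \<open>The partial derivative of the coordinates of \<open>E\<close> in the time
    direction \<open>(0, 1)\<close>, at time 0. The direction is fixed, so smoothness follows from
    that of \<open>\<Psi>\<close>.\<close>
  define V where "V x = \<Psi>' (x, 0) (0, 1)" for x
  have E0: "E (x, 0) = inv_into U \<phi> x" for x unfolding E_def by (simp add: c(2))
  have SW: "(x, 0) \<in> W" if "x \<in> S" for x
    using that I(2) ci unfolding W_def S_def by (auto simp: E0)
  have V: "smooth_on S V" unfolding V_def
    by (rule smooth_on_compose[OF smooth_on_Pair[OF smooth_on_bounded_linear[OF bounded_linear_ident] smooth_on_const]
          smooth_on_has_derivative[OF \<Psi> W \<Psi>']])
      (assumption, rule image_subsetI, rule SW)
  have S: "open S" "\<phi> \<one> \<in> S" using ch U(2) unfolding S_def by auto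
  obtain r L where rL: "0 < r" "0 \<le> L" "cball (\<phi> \<one>) r \<subseteq> S"
    "\<And>x y. x \<in> cball (\<phi> \<one>) r \<Longrightarrow> y \<in> cball (\<phi> \<one>) r \<Longrightarrow> norm (V x - V y) \<le> L * norm (x - y)"
    using smooth_on_locally_lipschitz[OF S V] by blast
  obtain e x where x: "0 < e" "x 0 = \<phi> \<one>" "\<And>t. t \<in> {-e<..<e} \<Longrightarrow> x t \<in> cball (\<phi> \<one>) r"
    "\<And>t. t \<in> {-e<..<e} \<Longrightarrow> (x has_vector_derivative V (x t)) (at t)"
    using picard_local_solution[OF rL(1,2,4)] by blast
  have xS: "x t \<in> S" if "t \<in> {-e<..<e}" for t using x(3)[OF that] rL(3) by blast
  have "smooth_on {-e<..<e} x"
    by (rule ode_solution_smooth[OF _ S(1) V _ x(4)]) (use xS in auto)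
  then have sx: "smooth_map_on std_atlas {-e<..<e} std_atlas x" unfolding smooth_map_on_std .
  define \<gamma> where "\<gamma> t = inv_into U \<phi> (x t)" for t
  have "smooth_map_on std_atlas {-e<..<e} \<G> \<gamma>" unfolding \<gamma>_def
    by (rule smooth_map_on_compose[OF chart_atlas_std chart_atlas_std sx smooth_map_on_chart_inv[OF smooth_atlas U(1)]])
      (use xS in \<open>auto simp: S_def\<close>)
  moreover have "((\<lambda>s. f (\<gamma> s)) has_vector_derivative A (\<lambda>y. f (\<gamma> t \<otimes> y))) (at t)"
    if t: "t \<in> {-e<..<e}" and f: "smooth_near \<G> (\<gamma> t) f" for t f
  proof -
    have \<gamma>U: "\<gamma> t \<in> U" "\<phi> (\<gamma> t) = x t" using xS[OF t] ci unfolding \<gamma>_def S_def by auto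
    have "smooth_near std_atlas (x t) (\<lambda>y. f (inv_into U \<phi> y))"
      by (rule smooth_near_compose[OF chart_atlas_std charts S(1) xS[OF t]])
        (use f smooth_map_on_chart_inv[OF smooth_atlas U(1)] in \<open>simp_all add: S_def \<gamma>_def\<close>)
    then obtain N where N: "open N" "x t \<in> N" "smooth_on N (\<lambda>y. f (inv_into U \<phi> y))"
      by (rule smooth_nearE) (simp add: smooth_map_on_std that)
    obtain F' where F': "((\<lambda>y. f (inv_into U \<phi> y)) has_derivative F') (at (x t))"
      using smooth_on_has_derivative_within[OF N(3,2)] at_within_open[OF N(2,1)] by auto
    have "((\<lambda>s. f (inv_into U \<phi> (x s))) has_derivative (\<lambda>h. F' (h *\<^sub>R V (x t)))) (at t)"
      by (rule has_derivative_compose[OF x(4)[OF t, unfolded has_vector_derivative_def] F'])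
    from has_derivative_imp_has_vector_derivative[OF this]
    have 1: "((\<lambda>s. f (\<gamma> s)) has_vector_derivative F' (V (x t))) (at t)" unfolding \<gamma>_def by simp
    have p: "(x t, 0) \<in> W" by (rule SW[OF xS[OF t]])
    have "((\<lambda>s. (x t, s)) has_derivative (\<lambda>h. (0, h))) (at 0)"
      by (auto intro!: derivative_eq_intros)
    from has_derivative_compose[OF this \<Psi>'[OF p]]
    have D1: "((\<lambda>s. \<Psi> (x t, s)) has_derivative (\<lambda>h. \<Psi>' (x t, 0) (0, h))) (at 0)" .
    have \<Psi>0: "\<Psi> (x t, 0) = x t" unfolding \<Psi>_def E0 using \<gamma>U(2) unfolding \<gamma>_def .
    have "((\<lambda>s. f (inv_into U \<phi> (\<Psi> (x t, s)))) has_derivative (\<lambda>h. F' (\<Psi>' (x t, 0) (0, h)))) (at 0)"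
      by (rule has_derivative_compose[OF D1]) (simp add: \<Psi>0 F')
    from has_derivative_imp_has_vector_derivative[OF this]
    have D2: "((\<lambda>s. f (inv_into U \<phi> (\<Psi> (x t, s)))) has_vector_derivative F' (V (x t))) (at 0)"
      unfolding V_def .
    \<comment> \<open>The translate \<open>\<gamma> t \<otimes> c s\<close> can be read in the chart
      only for small \<open>s\<close>; there its coordinates are \<open>\<Psi> (x t, s)\<close>,
      with velocity \<open>V (x t)\<close>, the same as that of \<open>x\<close> at time
      \<open>t\<close>.\<close>
    have "((\<lambda>s. f (\<gamma> t \<otimes> c s)) has_vector_derivative F' (V (x t))) (at 0)"
    proof (rule has_vector_derivative_transform_within_open[OF D2, where S = "(\<lambda>s. (x t, s)) -` W"])
      show "open ((\<lambda>s. (x t, s)) -` W)"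
        by (rule open_vimage[OF W]) (intro continuous_intros)
      show "0 \<in> (\<lambda>s. (x t, s)) -` W" using p by simp
      fix s assume "s \<in> (\<lambda>s. (x t, s)) -` W"
      then have "E (x t, s) \<in> U" unfolding W_def by simp
      then show "f (inv_into U \<phi> (\<Psi> (x t, s))) = f (\<gamma> t \<otimes> c s)"
        unfolding \<Psi>_def by (simp add: ci) (simp add: E_def \<gamma>_def)
    qed
    moreover have "smooth_near \<G> (c 0) (\<lambda>y. f (\<gamma> t \<otimes> y))"
      by (rule smooth_near_mult_left) (use f c(2) in simp)
    ultimately have "A (\<lambda>y. f (\<gamma> t \<otimes> y)) = F' (V (x t))"
      unfolding c(1) by (intro velocity_eqI) simp_all
    then show ?thesis using 1 by simp
  qed
  ultimately have "integral_curve A {-e<..<e} \<gamma>" unfolding integral_curve_def by blast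
  moreover have "\<gamma> 0 = \<one>" unfolding \<gamma>_def x(2) using ci[OF U(2)] .
  ultimately show ?thesis using x(1) that by blast
qed

section \<open>From local integral curves to one-parameter subgroups\<close>

lemma integral_curve_translate_left:
  assumes "integral_curve A J c"
  shows "integral_curve A J (\<lambda>t. a \<otimes> c t)"
  unfolding integral_curve_def
proof (intro conjI ballI allI impI)
  show "smooth_map_on std_atlas J \<G> (\<lambda>t. a \<otimes> c t)"
    by (rule smooth_mult[OF chart_atlas_std smooth_map_on_const integral_curveD(1)[OF assms]])
  fix t and f :: "'g \<Rightarrow> real" assume "t \<in> J" "smooth_near \<G> (a \<otimes> c t) f"
  from integral_curveD(2)[OF assms this(1) smooth_near_mult_left[OF this(2)]]
  show "((\<lambda>s. f (a \<otimes> c s)) has_vector_derivative A (\<lambda>y. f (a \<otimes> c t \<otimes> y))) (at t)"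
    by (simp add: m_assoc)
qed

lemma integral_curve_shift:
  assumes "integral_curve A J c" "\<And>t. t \<in> K \<Longrightarrow> a + t \<in> J"
  shows "integral_curve A K (\<lambda>t. c (a + t))"
  unfolding integral_curve_def
proof (intro conjI ballI allI impI)
  have "Ck_on k UNIV (\<lambda>t::real. a + t)" for k
    by (intro Ck_on_add Ck_on_const Ck_on_bounded_linear bounded_linear_ident)
  then have "smooth_map_on std_atlas K std_atlas (\<lambda>t::real. a + t)"
    unfolding smooth_map_on_std by (rule smooth_on_Ck)
  then show "smooth_map_on std_atlas K \<G> (\<lambda>t. c (a + t))"
    by (rule smooth_map_on_compose[OF chart_atlas_std chart_atlas_std _ integral_curveD(1)[OF assms(1)]])
      (use assms(2) in blast)
  fix t and f :: "'g \<Rightarrow> real" assume t: "t \<in> K" "smooth_near \<G> (c (a + t)) f"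
  from vector_derivative_shift[OF integral_curveD(2)[OF assms(1) assms(2)[OF t(1)] t(2)]]
  show "((\<lambda>s. f (c (a + s))) has_vector_derivative A (\<lambda>y. f (c (a + t) \<otimes> y))) (at t)" .
qed

lemma integral_curve_subset: "integral_curve A J c \<Longrightarrow> K \<subseteq> J \<Longrightarrow> integral_curve A K c"
  unfolding integral_curve_def using smooth_map_on_subset by blast

text \<open>As functions of \<open>t\<close>, both sides are integral curves of the same
  left-invariant field with the same value at 0.\<close>

lemma integral_curve_add:
  assumes c: "integral_curve A {-e<..<e} \<gamma>" "\<gamma> 0 = \<one>"
    and "s \<in> {-e<..<e}" "t \<in> {-e<..<e}" "s + t \<in> {-e<..<e}"
  shows "\<gamma> (s + t) = \<gamma> s \<otimes> \<gamma> t"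
proof -
  \<comment> \<open>The times \<open>t\<close> at which both \<open>t\<close> and
    \<open>s + t\<close> lie in the domain of \<open>\<gamma>\<close>.\<close>
  let ?J = "{max (-e) (-e-s)<..<min e (e-s)}"
  have J: "is_interval ?J" "open ?J" "0 \<in> ?J" "t \<in> ?J"
    using assms(3-5) by (auto simp: is_interval_oo)
  have 1: "integral_curve A ?J (\<lambda>t. \<gamma> (s + t))"
    by (rule integral_curve_shift[OF c(1)]) auto
  have 2: "integral_curve A ?J (\<lambda>t. \<gamma> s \<otimes> \<gamma> t)"
    by (rule integral_curve_translate_left[OF integral_curve_subset[OF c(1)]]) auto
  show ?thesis
    using integral_curve_unique[OF J(1,2) 1 2 J(3) _ J(4)] c(2) by simp
qed

lemma integral_curve_pow:
  assumes c: "integral_curve A {-e<..<e} \<gamma>" "\<gamma> 0 = \<one>" and e: "0 < e" and "\<bar>real n * s\<bar> < e"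
  shows "\<gamma> (real n * s) = \<gamma> s [^] n"
  using assms(4)
proof (induction n)
  case 0
  then show ?case by (simp add: c(2))
next
  case (Suc n)
  have "\<bar>real n * s\<bar> \<le> \<bar>real (Suc n) * s\<bar>" by (simp add: abs_mult mult_right_mono)
  then have n: "\<bar>real n * s\<bar> < e" using Suc.prems by linarith
  have "\<bar>s\<bar> \<le> \<bar>real (Suc n) * s\<bar>"
    using mult_right_mono[of 1 "real (Suc n)" "\<bar>s\<bar>"] by (simp add: abs_mult)
  then have s: "\<bar>s\<bar> < e" using Suc.prems by linarith
  have eq: "real (Suc n) * s = real n * s + s" by (simp add: algebra_simps)
  have "\<gamma> (real n * s + s) = \<gamma> (real n * s) \<otimes> \<gamma> s"
    by (rule integral_curve_add[OF c]) (use n s Suc.prems[unfolded eq] in \<open>auto simp: abs_less_iff\<close>)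
  then show ?case unfolding eq using Suc.IH[OF n] by simp
qed

lemma ex_one_parameter_subgroup:
  assumes A: "A \<in> lie_algebra G \<G>"
  shows "\<exists>\<gamma>. one_parameter_subgroup G \<G> \<gamma> \<and> velocity \<G> UNIV \<gamma> 0 = A"
proof -
  obtain e \<gamma> where e: "0 < e" and c: "integral_curve A {-e<..<e} \<gamma>" "\<gamma> 0 = \<one>"
    using local_integral_curve[OF A] by blast
  \<comment> \<open>Well-definedness of the extension: two admissible subdivisions into
    \<open>n\<close> and \<open>m\<close> steps are compared through the common one into
    \<open>n * m\<close> steps.\<close>
  have refine: "\<gamma> (t / real n) [^] n = \<gamma> (t / real (n * m)) [^] (n * m)"
    if n: "0 < n" "\<bar>t / real n\<bar> < e" and m: "0 < m" for t and n m :: nat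
  proof -
    have eq: "t / real n = real m * (t / real (n * m))" using n m by (simp add: field_simps)
    have "\<gamma> (t / real n) = \<gamma> (t / real (n * m)) [^] m"
      using integral_curve_pow[OF c e, of m "t / real (n * m)"] n(2) unfolding eq[symmetric] by blast
    then show ?thesis by (simp add: nat_pow_pow mult.commute)
  qed
  \<comment> \<open>\<open>Suc\<close> makes the number of steps positive and strictly greater than
    \<open>\<bar>t\<bar> / e\<close>, also when \<open>t\<close> is 0.\<close>
  define N where "N t = Suc (nat \<lceil>\<bar>t\<bar> / e\<rceil>)" for t
  have N: "0 < N t" "\<bar>t / real (N t)\<bar> < e" for t
  proof -
    show "0 < N t" by (simp add: N_def)
    have "\<bar>t\<bar> / e < real (N t)" unfolding N_def by linarith
    then show "\<bar>t / real (N t)\<bar> < e" using e \<open>0 < N t\<close> by (simp add: field_simps abs_divide)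
  qed
  define \<Gamma> where "\<Gamma> t = \<gamma> (t / real (N t)) [^] N t" for t
  have \<Gamma>: "\<Gamma> t = \<gamma> (t / real n) [^] n" if "0 < n" "\<bar>t / real n\<bar> < e" for t n
    unfolding \<Gamma>_def using refine[OF that N(1)[of t]] refine[OF N(1,2) that(1), of t] by (simp add: mult.commute)
  have \<Gamma>_local: "\<Gamma> t = \<gamma> t" if "\<bar>t\<bar> < e" for t
    using \<Gamma>[of 1 t] that by simp
  have add: "\<Gamma> (s + t) = \<Gamma> s \<otimes> \<Gamma> t" for s t
  proof -
    \<comment> \<open>One subdivision fine enough for \<open>s\<close>, \<open>t\<close> and
      \<open>s + t\<close> simultaneously.\<close>
    define n where "n = N (\<bar>s\<bar> + \<bar>t\<bar>)"
    have n: "0 < n" "(\<bar>s\<bar> + \<bar>t\<bar>) / real n < e" using N[of "\<bar>s\<bar> + \<bar>t\<bar>"] unfolding n_def by auto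
    have s: "\<bar>s / real n\<bar> < e" and t: "\<bar>t / real n\<bar> < e"
      using n by (auto simp: abs_divide add_divide_distrib intro: le_less_trans[rotated])
    have st: "\<bar>s / real n + t / real n\<bar> < e"
      using n(2) abs_triangle_ineq[of "s / real n" "t / real n"] by (simp add: abs_divide add_divide_distrib)
    have mem: "s / real n \<in> {-e<..<e}" "t / real n \<in> {-e<..<e}"
      "s / real n + t / real n \<in> {-e<..<e}" "t / real n + s / real n \<in> {-e<..<e}"
      using s t st unfolding abs_less_iff greaterThanLessThan_iff by linarith+
    have 1: "\<gamma> (s / real n + t / real n) = \<gamma> (s / real n) \<otimes> \<gamma> (t / real n)"
      by (rule integral_curve_add[OF c mem(1,2,3)])
    have 2: "\<gamma> (t / real n + s / real n) = \<gamma> (t / real n) \<otimes> \<gamma> (s / real n)"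
      by (rule integral_curve_add[OF c mem(2,1,4)])
    \<comment> \<open>Both products equal \<open>\<gamma>\<close> at the same sum. Commutation is
      what allows the power of a product to be split.\<close>
    have comm: "\<gamma> (s / real n) \<otimes> \<gamma> (t / real n) = \<gamma> (t / real n) \<otimes> \<gamma> (s / real n)"
      using 1 2 by (simp add: add.commute)
    have "\<Gamma> (s + t) = \<gamma> (s / real n + t / real n) [^] n"
      using \<Gamma>[OF n(1), of "s + t"] st by (simp add: add_divide_distrib)
    also have "\<dots> = \<gamma> (s / real n) [^] n \<otimes> \<gamma> (t / real n) [^] n"
      unfolding 1 by (rule pow_mult_distrib[OF comm]) simp_all
    also have "\<dots> = \<Gamma> s \<otimes> \<Gamma> t" using \<Gamma>[OF n(1) s] \<Gamma>[OF n(1) t] by simp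
    finally show ?thesis .
  qed
  have smooth: "smooth_map_on std_atlas UNIV \<G> \<Gamma>"
  proof (rule smooth_map_on_local[OF chart_atlas_std])
    fix t0 :: real
    let ?K = "{t0 - e<..<t0 + e}"
    \<comment> \<open>Near \<open>t0\<close> the extension is the left translate by
      \<open>\<Gamma> t0\<close> of the local curve shifted to \<open>t0\<close>.\<close>
    have "smooth_map_on std_atlas ?K \<G> (\<lambda>t. \<Gamma> t0 \<otimes> \<gamma> (- t0 + t))"
      by (rule integral_curveD(1)[OF integral_curve_translate_left[OF integral_curve_shift[OF c(1)]]]) auto
    then have "smooth_map_on std_atlas ?K \<G> \<Gamma>"
    proof (rule smooth_map_on_cong[OF chart_atlas_std])
      fix t assume "t \<in> ?K"
      then have "\<bar>- t0 + t\<bar> < e" by auto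
      then show "\<Gamma> t0 \<otimes> \<gamma> (- t0 + t) = \<Gamma> t"
        using add[of t0 "- t0 + t"] \<Gamma>_local by simp
    qed
    then show "\<exists>W. open W \<and> t0 \<in> W \<and> smooth_map_on std_atlas (UNIV \<inter> W) \<G> \<Gamma>"
      using e by (intro exI[of _ ?K]) simp
  qed
  \<comment> \<open>Tangent vectors are compared as functionals on all functions, so the default
    value 0 has to be checked too.\<close>
  have A0: "A f = 0" if "\<not> smooth_near \<G> \<one> f" for f
    using A that unfolding lie_algebra_def tangent_space_def by (auto simp: velocity_def)
  have \<Gamma>0: "\<Gamma> 0 = \<one>" using \<Gamma>_local[of 0] e c(2) by simp
  have "velocity \<G> UNIV \<Gamma> 0 f = A f" for f
  proof (cases "smooth_near \<G> \<one> f")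
    case True
    have "((\<lambda>s. f (\<gamma> s)) has_vector_derivative A (\<lambda>y. f (\<gamma> 0 \<otimes> y))) (at 0)"
      by (rule integral_curveD(2)[OF c(1)]) (use e c(2) True in auto)
    then have "((\<lambda>s. f (\<gamma> s)) has_vector_derivative A f) (at 0)" by (simp add: c(2))
    then have "((\<lambda>s. f (\<Gamma> s)) has_vector_derivative A f) (at 0)"
      by (rule has_vector_derivative_transform_within_open[where S = "{-e<..<e}"]) (use e \<Gamma>_local in auto)
    then show ?thesis by (intro velocity_eqI) (simp_all add: \<Gamma>0 True)
  next
    case False
    then show ?thesis using A0 by (simp add: velocity_def \<Gamma>0)
  qed
  then have "velocity \<G> UNIV \<Gamma> 0 = A" by (rule ext)
  then show ?thesis using smooth add unfolding one_parameter_subgroup_def by blast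
qed

lemma one_parameter_subgroup_zero:
  assumes "one_parameter_subgroup G \<G> \<gamma>"
  shows "\<gamma> 0 = \<one>"
proof -
  have "\<gamma> (0 + 0) = \<gamma> 0 \<otimes> \<gamma> 0" using assms unfolding one_parameter_subgroup_def by blast
  then show ?thesis using l_cancel_one'[of "\<gamma> 0" "\<gamma> 0"] by simp
qed

text \<open>The homomorphism law carries the derivative at 0 to every time, so uniqueness of
  integral curves yields uniqueness of one-parameter subgroups.\<close>

lemma one_parameter_subgroup_integral_curve:
  assumes \<gamma>: "one_parameter_subgroup G \<G> \<gamma>"
  shows "integral_curve (velocity \<G> UNIV \<gamma> 0) UNIV \<gamma>"
  unfolding integral_curve_def
proof (intro conjI ballI allI impI)
  show sm: "smooth_map_on std_atlas UNIV \<G> \<gamma>" using \<gamma> unfolding one_parameter_subgroup_def by simp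
  have add: "\<gamma> (s + t) = \<gamma> s \<otimes> \<gamma> t" for s t using \<gamma> unfolding one_parameter_subgroup_def by simp
  note zero = one_parameter_subgroup_zero[OF \<gamma>]
  fix t and f :: "'g \<Rightarrow> real" assume f: "smooth_near \<G> (\<gamma> t) f"
  have "((\<lambda>s. f (\<gamma> t \<otimes> \<gamma> s)) has_vector_derivative velocity \<G> UNIV \<gamma> 0 (\<lambda>y. f (\<gamma> t \<otimes> y))) (at 0)"
    by (rule velocity_has_vector_derivative[OF charts sm]) (use f in \<open>simp_all add: zero smooth_near_mult_left\<close>)
  then have "((\<lambda>s. f (\<gamma> (t + s))) has_vector_derivative velocity \<G> UNIV \<gamma> 0 (\<lambda>y. f (\<gamma> t \<otimes> y))) (at (- t + t))"
    by (simp add: add)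
  from vector_derivative_shift[OF this]
  show "((\<lambda>s. f (\<gamma> s)) has_vector_derivative velocity \<G> UNIV \<gamma> 0 (\<lambda>y. f (\<gamma> t \<otimes> y))) (at t)"
    by simp
qed

lemma one_parameter_subgroup_unique:
  assumes "one_parameter_subgroup G \<G> \<gamma>" "one_parameter_subgroup G \<G> \<delta>"
    and "velocity \<G> UNIV \<gamma> 0 = velocity \<G> UNIV \<delta> 0"
  shows "\<gamma> = \<delta>"
proof
  fix t
  have "integral_curve (velocity \<G> UNIV \<delta> 0) UNIV \<gamma>"
    using one_parameter_subgroup_integral_curve[OF assms(1)] unfolding assms(3) .
  moreover have "integral_curve (velocity \<G> UNIV \<delta> 0) UNIV \<delta>"
    by (rule one_parameter_subgroup_integral_curve[OF assms(2)])
  moreover have "is_interval (UNIV :: real set)" by (simp add: is_interval_def)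
  moreover have "\<gamma> 0 = \<delta> 0"
    using one_parameter_subgroup_zero[OF assms(1)] one_parameter_subgroup_zero[OF assms(2)] by simp
  ultimately show "\<gamma> t = \<delta> t"
    using integral_curve_unique[OF _ open_UNIV, of _ \<gamma> \<delta> 0 t] by blast
qed

text \<open>Evaluates the definite description in \<open>lie_exp\<close>: the rescaled curve
  \<open>\<gamma> (u * s)\<close> is the unique one-parameter subgroup with velocity
  \<open>tscale u A\<close>, and its value at 1 is \<open>\<gamma> u\<close>.\<close>

lemma lie_exp_one_parameter_subgroup:
  assumes "A \<in> lie_algebra G \<G>"
  obtains \<gamma> where "one_parameter_subgroup G \<G> \<gamma>" "velocity \<G> UNIV \<gamma> 0 = A"
    "\<And>u. lie_exp G \<G> (tscale u A) = \<gamma> u"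
proof -
  obtain \<gamma> where \<gamma>: "one_parameter_subgroup G \<G> \<gamma>" "velocity \<G> UNIV \<gamma> 0 = A"
    using ex_one_parameter_subgroup[OF assms] by blast
  have sm: "smooth_map_on std_atlas UNIV \<G> \<gamma>" and add: "\<And>s t. \<gamma> (s + t) = \<gamma> s \<otimes> \<gamma> t"
    using \<gamma>(1) unfolding one_parameter_subgroup_def by simp_all
  note zero = one_parameter_subgroup_zero[OF \<gamma>(1)]
  have "lie_exp G \<G> (tscale u A) = \<gamma> u" for u
  proof -
    have "smooth_map_on std_atlas UNIV std_atlas (\<lambda>s::real. u * s)"
      unfolding smooth_map_on_std by (intro smooth_on_bounded_linear bounded_linear_mult_right)
    then have "smooth_map_on std_atlas UNIV \<G> (\<lambda>s. \<gamma> (u * s))"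
      by (rule smooth_map_on_compose[OF chart_atlas_std chart_atlas_std _ sm]) simp
    then have ops: "one_parameter_subgroup G \<G> (\<lambda>s. \<gamma> (u * s))"
      unfolding one_parameter_subgroup_def by (simp add: distrib_left add)
    have "velocity \<G> UNIV (\<lambda>s. \<gamma> (u * s)) 0 f = tscale u A f" for f
    proof (cases "smooth_near \<G> \<one> f")
      case True
      have "((\<lambda>s. u * s) has_vector_derivative u) (at 0)" by (auto intro!: derivative_eq_intros)
      moreover have "((\<lambda>s. f (\<gamma> s)) has_vector_derivative A f) (at (u * 0))"
        using velocity_has_vector_derivative[OF charts sm, of 0 f] True by (simp add: \<gamma>(2) zero)
      ultimately have "((\<lambda>s. f (\<gamma> (u * s))) has_vector_derivative u * A f) (at 0)"
        using vector_diff_chain_at[of "\<lambda>s. u * s" u 0 "\<lambda>s. f (\<gamma> s)" "A f"] by (simp add: comp_def)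
      then show ?thesis by (intro velocity_eqI) (simp_all add: tscale_def zero True)
    next
      case False
      then have "A f = 0" unfolding \<gamma>(2)[symmetric] by (simp add: velocity_def zero)
      then show ?thesis using False by (simp add: velocity_def zero tscale_def)
    qed
    then have vel: "velocity \<G> UNIV (\<lambda>s. \<gamma> (u * s)) 0 = tscale u A" by (rule ext)
    have "(THE \<delta>. one_parameter_subgroup G \<G> \<delta> \<and> velocity \<G> UNIV \<delta> 0 = tscale u A) = (\<lambda>s. \<gamma> (u * s))"
    proof (rule the_equality)
      show "one_parameter_subgroup G \<G> (\<lambda>s. \<gamma> (u * s)) \<and> velocity \<G> UNIV (\<lambda>s. \<gamma> (u * s)) 0 = tscale u A"
        using ops vel by simp
      fix \<delta> assume "one_parameter_subgroup G \<G> \<delta> \<and> velocity \<G> UNIV \<delta> 0 = tscale u A"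
      then show "\<delta> = (\<lambda>s. \<gamma> (u * s))" using one_parameter_subgroup_unique[OF _ ops] vel by simp
    qed
    then show ?thesis unfolding lie_exp_def by simp
  qed
  then show ?thesis using \<gamma> that by blast
qed

lemma lie_algebra_not_smooth_near:
  assumes "A \<in> lie_algebra G \<G>" "\<not> smooth_near \<G> \<one> f"
  shows "A f = 0"
  using assms unfolding lie_algebra_def tangent_space_def by (auto simp: velocity_def)

text \<open>A coordinate ray in a chart at the identity represents the tangent vector with the given coordinates.\<close>

lemma lie_algebra_coordinates:
  assumes U: "(U, \<phi>) \<in> \<G>" "\<one> \<in> U"
  obtains E :: "'a \<Rightarrow> 'g tvec"
  where "\<And>w. E w \<in> lie_algebra G \<G>"
    and "\<And>a b v w. E (a *\<^sub>R v + b *\<^sub>R w) = tadd (tscale a (E v)) (tscale b (E w))"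
    and "\<And>A. A \<in> lie_algebra G \<G> \<Longrightarrow> A = E (\<Sum>b\<in>fd_basis. A (\<lambda>g. fd_coord b (\<phi> g)) *\<^sub>R b)"
proof -
  define x0 where "x0 = \<phi> \<one>"
  define ray where "ray w s = inv_into U \<phi> (x0 + s *\<^sub>R w)" for w and s :: real
  define E where "E w = velocity \<G> UNIV (ray w) 0" for w
  note ci = chart_inv[OF charts U(1)] and ch = chart_atlasD[OF charts U(1)]
  have ray0: "ray w 0 = \<one>" for w unfolding ray_def x0_def using ci[OF U(2)] by simp
  have x0: "x0 \<in> \<phi> ` U" unfolding x0_def using U(2) by blast
  have inv0: "inv_into U \<phi> x0 = \<one>" unfolding x0_def by (rule ci[OF U(2)])
  have line: "((\<lambda>s. x0 + s *\<^sub>R w) has_derivative (\<lambda>s. s *\<^sub>R w)) (at 0)" for w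
    by (auto intro!: derivative_eq_intros)
  have diff: "\<exists>F'. ((\<lambda>y. f (inv_into U \<phi> y)) has_derivative F') (at x0)"
    if f: "smooth_near \<G> \<one> f" for f :: "'g \<Rightarrow> real"
  proof -
    have "smooth_near std_atlas x0 (\<lambda>y. f (inv_into U \<phi> y))"
      by (rule smooth_near_compose[OF chart_atlas_std charts ch(2) x0 smooth_map_on_chart_inv[OF smooth_atlas U(1)]])
        (simp add: inv0 f)
    then obtain N where N: "open N" "x0 \<in> N" "smooth_on N (\<lambda>y. f (inv_into U \<phi> y))"
      by (rule smooth_nearE) (simp add: smooth_map_on_std that)
    then show ?thesis
      using smooth_on_has_derivative_within[OF N(3,2)] at_within_open[OF N(2,1)] by auto
  qed
  \<comment> \<open>In coordinates \<open>E w\<close> is the directional derivative along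
    \<open>w\<close>, hence linear in \<open>w\<close>.\<close>
  have E_eq: "E w f = F' w"
    if f: "smooth_near \<G> \<one> f" and F': "((\<lambda>y. f (inv_into U \<phi> y)) has_derivative F') (at x0)" for w f F'
  proof -
    have "((\<lambda>s. f (inv_into U \<phi> (x0 + s *\<^sub>R w))) has_derivative (\<lambda>s. F' (s *\<^sub>R w))) (at 0)"
      by (rule has_derivative_compose[OF line]) (simp add: F')
    from has_derivative_imp_has_vector_derivative[OF this]
    have "((\<lambda>s. f (ray w s)) has_vector_derivative F' w) (at 0)" unfolding ray_def by simp
    then show ?thesis unfolding E_def by (intro velocity_eqI) (simp_all add: ray0 f)
  qed
  have mem: "E w \<in> lie_algebra G \<G>" for w
  proof -
    have "open ((\<lambda>s. x0 + s *\<^sub>R w) -` (\<phi> ` U))"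
      by (rule open_vimage[OF ch(2)]) (intro continuous_intros)
    moreover have "0 \<in> (\<lambda>s. x0 + s *\<^sub>R w) -` (\<phi> ` U)" using x0 by simp
    ultimately obtain e where e: "e > 0" "ball 0 e \<subseteq> (\<lambda>s. x0 + s *\<^sub>R w) -` (\<phi> ` U)"
      using openE by blast
    have "Ck_on k UNIV (\<lambda>s. x0 + s *\<^sub>R w)" for k
      by (intro Ck_on_add Ck_on_const Ck_on_bounded_linear bounded_linear_scaleR_left)
    then have "smooth_map_on std_atlas {-e<..<e} std_atlas (\<lambda>s. x0 + s *\<^sub>R w)"
      unfolding smooth_map_on_std by (rule smooth_on_Ck)
    then have "smooth_map_on std_atlas {-e<..<e} \<G> (ray w)" unfolding ray_def
      by (rule smooth_map_on_compose[OF chart_atlas_std chart_atlas_std _ smooth_map_on_chart_inv[OF smooth_atlas U(1)]])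
        (use e(2) in \<open>auto simp: ball_eq_greaterThanLessThan\<close>)
    then show ?thesis unfolding lie_algebra_def tangent_space_def E_def using e(1) ray0 by blast
  qed
  have lin: "E (a *\<^sub>R v + b *\<^sub>R w) = tadd (tscale a (E v)) (tscale b (E w))" for a b v w
  proof
    fix f
    show "E (a *\<^sub>R v + b *\<^sub>R w) f = tadd (tscale a (E v)) (tscale b (E w)) f"
    proof (cases "smooth_near \<G> \<one> f")
      case True
      then obtain F' where F': "((\<lambda>y. f (inv_into U \<phi> y)) has_derivative F') (at x0)" using diff by blast
      have "linear F'" using F' by (rule has_derivative_linear)
      then show ?thesis
        unfolding tadd_def tscale_def E_eq[OF True F'] by (simp add: linear_add linear_cmul)
    next
      case False
      then show ?thesis
        using lie_algebra_not_smooth_near[OF mem] by (simp add: tadd_def tscale_def)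
    qed
  qed
  have sn: "smooth_near \<G> \<one> (\<lambda>g. fd_coord b (\<phi> g))" for b
    by (rule smooth_near_linear[OF charts bounded_linear_fd_coord smooth_near_chart[OF smooth_atlas U]])
  have repr: "A = E (\<Sum>b\<in>fd_basis. A (\<lambda>g. fd_coord b (\<phi> g)) *\<^sub>R b)" (is "A = E ?w")
    if A: "A \<in> lie_algebra G \<G>" for A
  proof
    fix f
    show "A f = E ?w f"
    proof (cases "smooth_near \<G> \<one> f")
      case True
      then obtain F' where F': "((\<lambda>y. f (inv_into U \<phi> y)) has_derivative F') (at x0)" using diff by blast
      \<comment> \<open>Represents \<open>A\<close> by a curve defined for all times, whose
        coordinate velocity \<open>d\<close> at 0 is then the vector \<open>?w\<close>.\<close>
      obtain \<gamma> where "one_parameter_subgroup G \<G> \<gamma>" and v: "velocity \<G> UNIV \<gamma> 0 = A"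
        using ex_one_parameter_subgroup[OF A] by blast
      then have sm: "smooth_map_on std_atlas UNIV \<G> \<gamma>" and g0: "\<gamma> 0 = \<one>"
        using one_parameter_subgroup_zero unfolding one_parameter_subgroup_def by blast+
      have "smooth_near \<G> (\<gamma> 0) \<phi>" unfolding g0 by (rule smooth_near_chart[OF smooth_atlas U])
      then obtain d where d: "((\<lambda>s. \<phi> (\<gamma> s)) has_vector_derivative d) (at 0)"
        using smooth_curve_has_vector_derivative[OF charts sm UNIV_I] by blast
      have coord: "A (\<lambda>g. fd_coord b (\<phi> g)) = fd_coord b d" for b
        unfolding v[symmetric]
        by (rule velocity_eqI) (use sn bounded_linear.has_vector_derivative[OF bounded_linear_fd_coord d] in \<open>simp_all add: g0\<close>)
      have w: "?w = d" unfolding coord fd_expand ..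
      have "((\<lambda>s. f (inv_into U \<phi> (\<phi> (\<gamma> s)))) has_derivative (\<lambda>s. F' (s *\<^sub>R d))) (at 0)"
        by (rule has_derivative_compose[OF d[unfolded has_vector_derivative_def]]) (use F' in \<open>simp add: g0 x0_def\<close>)
      from has_derivative_imp_has_vector_derivative[OF this]
      have D: "((\<lambda>s. f (inv_into U \<phi> (\<phi> (\<gamma> s)))) has_vector_derivative F' d) (at 0)" by simp
      have "((\<lambda>s. f (\<gamma> s)) has_vector_derivative F' d) (at 0)"
      proof (rule has_vector_derivative_transform_within_open[OF D, where S = "\<gamma> -` U"])
        show "open (\<gamma> -` U)"
          by (rule open_vimage[OF ch(1) smooth_map_onD(1)[OF sm]])
      qed (use g0 U(2) ci in auto)
      then have "A f = F' d" unfolding v[symmetric] by (intro velocity_eqI) (simp_all add: g0 True)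
      then show ?thesis unfolding w E_eq[OF True F'] .
    next
      case False
      then show ?thesis using lie_algebra_not_smooth_near[OF A] lie_algebra_not_smooth_near[OF mem] by simp
    qed
  qed
  show ?thesis using that[of E] mem lin repr by blast
qed

end

section \<open>Vector fields generated by the action\<close>

locale prequantum_action = lie G \<G>
  for G :: "('g::{t2_space, second_countable_topology}) monoid" (structure)
    and \<G> :: "('g, 'a::finite_dim_normed_space) atlas" +
  fixes \<A> :: "('m::{t2_space, second_countable_topology}, 'e::finite_dim_normed_space) atlas"
    and act :: "'g \<Rightarrow> 'm \<Rightarrow> 'm"
    and \<Phi> :: "'m \<Rightarrow> 'g tvec \<Rightarrow> real"
    and L :: "('m, 'l) line_bundle"
    and D :: "'m \<Rightarrow> 'm tvec \<Rightarrow> ('m \<Rightarrow> 'l) \<Rightarrow> 'l"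
  assumes M_smooth_atlas: "smooth_atlas \<A>"
    and action: "lie_group_action G \<G> \<A> act"
    and moment_linear: "\<And>q A B a b. A \<in> lie_algebra G \<G> \<Longrightarrow> B \<in> lie_algebra G \<G> \<Longrightarrow>
      \<Phi> q (tadd (tscale a A) (tscale b B)) = a * \<Phi> q A + b * \<Phi> q B"
    and moment_smooth: "\<And>A. A \<in> lie_algebra G \<G> \<Longrightarrow> smooth_fun_on \<A> UNIV (\<lambda>q. \<Phi> q A)"
    and line_bundle: "complex_line_bundle \<A> L"
    and connection: "connection \<A> L D"
begin

abbreviation X :: "'g tvec \<Rightarrow> 'm \<Rightarrow> 'm tvec" where
  "X \<equiv> generated_vf G \<G> \<A> act"

lemma M_charts: "chart_atlas \<A>"
  by (rule smooth_atlas_chart_atlas[OF M_smooth_atlas])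

lemma smooth_act:
  assumes "chart_atlas \<B>" "smooth_map_on \<B> S \<G> F" "smooth_map_on \<B> S \<A> H"
  shows "smooth_map_on \<B> S \<A> (\<lambda>p. act (F p) (H p))"
proof -
  have m: "smooth_map_on (prod_atlas \<G> \<A>) UNIV \<A> (\<lambda>(g, q). act g q)"
    using action unfolding lie_group_action_def by simp
  have "smooth_map_on \<B> S \<A> (\<lambda>p. (\<lambda>(g, q). act g q) (F p, H p))"
    by (rule smooth_map_on_compose[OF assms(1) chart_atlas_prod[OF charts M_charts]
        smooth_map_on_Pair[OF assms(2,3)] m]) simp
  then show ?thesis by simp
qed

lemma act_one [simp]: "act \<one> q = q" and act_mult: "act (g \<otimes> h) q = act g (act h q)"
  using action unfolding lie_group_action_def by simp_all

lemma smooth_near_act: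
  assumes "smooth_near \<A> (act g q) f"
  shows "smooth_near \<G> g (\<lambda>g. f (act g q))"
  by (rule smooth_near_compose[OF charts M_charts open_UNIV UNIV_I
        smooth_act[OF charts smooth_id smooth_map_on_const] assms])

lemma exp_curve:
  assumes "A \<in> lie_algebra G \<G>"
  obtains \<gamma> where "smooth_map_on std_atlas UNIV \<G> \<gamma>" "\<gamma> 0 = \<one>" "velocity \<G> UNIV \<gamma> 0 = A"
    "\<forall>u. lie_exp G \<G> (tscale u A) = \<gamma> u" "\<forall>q. X A q = velocity \<A> UNIV (\<lambda>u. act (\<gamma> u) q) 0"
proof -
  obtain \<gamma> where \<gamma>: "one_parameter_subgroup G \<G> \<gamma>" "velocity \<G> UNIV \<gamma> 0 = A"
    "\<And>u. lie_exp G \<G> (tscale u A) = \<gamma> u"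
    using lie_exp_one_parameter_subgroup[OF assms] by blast
  show ?thesis
  proof (rule that)
    show "smooth_map_on std_atlas UNIV \<G> \<gamma>" using \<gamma>(1) unfolding one_parameter_subgroup_def by blast
    show "\<gamma> 0 = \<one>" by (rule one_parameter_subgroup_zero[OF \<gamma>(1)])
    show "\<forall>q. X A q = velocity \<A> UNIV (\<lambda>u. act (\<gamma> u) q) 0"
      unfolding generated_vf_def \<gamma>(3) by simp
    show "\<forall>u. lie_exp G \<G> (tscale u A) = \<gamma> u" using \<gamma>(3) by simp
  qed (rule \<gamma>)
qed

lemma generated_vf_curve_derivative:
  assumes A: "A \<in> lie_algebra G \<G>" and \<gamma>: "smooth_map_on std_atlas UNIV \<G> \<gamma>" "\<gamma> 0 = \<one>" "velocity \<G> UNIV \<gamma> 0 = A"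
    and f: "smooth_near \<A> q f"
  shows "((\<lambda>u. f (act (\<gamma> u) q)) has_vector_derivative A (\<lambda>g. f (act g q))) (at 0)"
  unfolding \<gamma>(3)[symmetric]
  by (rule velocity_has_vector_derivative[OF charts \<gamma>(1)]) (use smooth_near_act[of \<one> q f] f \<gamma>(2) in simp_all)

text \<open>By the chain rule along the orbit map the value depends on the exponential curve only
  through its velocity \<open>A\<close>. This removes \<open>lie_exp\<close> and makes linearity in
  \<open>A\<close> immediate.\<close>

lemma generated_vf_apply:
  assumes A: "A \<in> lie_algebra G \<G>"
  shows "X A q f = (if smooth_near \<A> q f then A (\<lambda>g. f (act g q)) else 0)"
proof -
  obtain \<gamma> where \<gamma>: "smooth_map_on std_atlas UNIV \<G> \<gamma>" "\<gamma> 0 = \<one>" "velocity \<G> UNIV \<gamma> 0 = A"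
    "\<forall>u. lie_exp G \<G> (tscale u A) = \<gamma> u" "\<forall>q. X A q = velocity \<A> UNIV (\<lambda>u. act (\<gamma> u) q) 0"
    by (rule exp_curve[OF A])
  show ?thesis
  proof (cases "smooth_near \<A> q f")
    case True
    have "velocity \<A> UNIV (\<lambda>u. act (\<gamma> u) q) 0 f = A (\<lambda>g. f (act g q))"
      by (rule velocity_eqI) (use generated_vf_curve_derivative[OF A \<gamma>(1-3) True] in \<open>simp_all add: \<gamma>(2) True\<close>)
    then show ?thesis using True \<gamma>(5)[rule_format] by simp
  next
    case False
    then show ?thesis unfolding \<gamma>(5)[rule_format] by (simp add: velocity_def \<gamma>(2))
  qed
qed

lemma generated_vf_tangent:
  assumes A: "A \<in> lie_algebra G \<G>"
  shows "X A q \<in> tangent_space \<A> q"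
proof -
  obtain \<gamma> where \<gamma>: "smooth_map_on std_atlas UNIV \<G> \<gamma>" "\<gamma> 0 = \<one>" "velocity \<G> UNIV \<gamma> 0 = A"
    "\<forall>u. lie_exp G \<G> (tscale u A) = \<gamma> u" "\<forall>q. X A q = velocity \<A> UNIV (\<lambda>u. act (\<gamma> u) q) 0"
    by (rule exp_curve[OF A])
  have "smooth_map_on std_atlas {-1<..<1} \<A> (\<lambda>u. act (\<gamma> u) q)"
    by (rule smooth_act[OF chart_atlas_std smooth_map_on_subset[OF \<gamma>(1)] smooth_map_on_const]) simp
  then have "(\<lambda>u. act (\<gamma> u) q) 0 = q \<and> (\<exists>\<epsilon>>0. smooth_map_on std_atlas {-\<epsilon><..<\<epsilon>} \<A> (\<lambda>u. act (\<gamma> u) q))"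
    using \<gamma>(2) by (intro conjI exI[of _ 1]) simp_all
  then show ?thesis unfolding tangent_space_def \<gamma>(5)[rule_format] by blast
qed

lemma generated_vf_linear:
  assumes "A \<in> lie_algebra G \<G>" "B \<in> lie_algebra G \<G>" "tadd (tscale a A) (tscale b B) \<in> lie_algebra G \<G>"
  shows "X (tadd (tscale a A) (tscale b B)) q = tadd (tscale a (X A q)) (tscale b (X B q))"
proof
  fix f
  show "X (tadd (tscale a A) (tscale b B)) q f = tadd (tscale a (X A q)) (tscale b (X B q)) f"
    unfolding generated_vf_apply[OF assms(3)]
    by (simp add: tadd_def tscale_def generated_vf_apply[OF assms(1)] generated_vf_apply[OF assms(2)])
qed

text \<open>In a chart \<open>X A q f\<close> is the time derivative at 0 of the jointly smooth
  function \<open>f (act (\<gamma> u) q)\<close>, a derivative in the fixed direction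
  \<open>(1, 0)\<close>.\<close>

lemma smooth_generated_vf:
  assumes A: "A \<in> lie_algebra G \<G>"
  shows "smooth_vf \<A> U (X A)"
  unfolding smooth_vf_def
proof (intro conjI ballI allI impI generated_vf_tangent[OF A])
  fix V and f :: "'m \<Rightarrow> real" assume V: "open V" and f: "smooth_fun_on \<A> V f"
  obtain \<gamma> where \<gamma>: "smooth_map_on std_atlas UNIV \<G> \<gamma>" "\<gamma> 0 = \<one>" "velocity \<G> UNIV \<gamma> 0 = A"
    "\<forall>u. lie_exp G \<G> (tscale u A) = \<gamma> u" "\<forall>q. X A q = velocity \<A> UNIV (\<lambda>u. act (\<gamma> u) q) 0"
    by (rule exp_curve[OF A])
  show "smooth_fun_on \<A> V (\<lambda>p. X A p f)"
  proof (rule smooth_map_on_local[OF M_charts])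
    fix p
    obtain W \<phi> where W: "(W, \<phi>) \<in> \<A>" "p \<in> W" using chart_atlas_cover[OF M_charts] by blast
    note ch = chart_atlasD[OF M_charts W(1)] and ci = chart_inv[OF M_charts W(1)]
    have sub: "smooth_map_on (prod_atlas std_atlas std_atlas) (UNIV \<times> \<phi> ` W) \<A> (\<lambda>z. act (\<gamma> (fst z)) (inv_into W \<phi> (snd z)))"
      by (intro smooth_act chart_atlas_prod chart_atlas_std
          smooth_map_on_fst[OF chart_atlas_std chart_atlas_std \<gamma>(1)]
          smooth_map_on_snd[OF chart_atlas_std chart_atlas_std smooth_map_on_chart_inv[OF M_smooth_atlas W(1)]])
    define K where "K z = act (\<gamma> (fst z)) (inv_into W \<phi> (snd z))" for z
    have K: "smooth_map_on std_atlas (UNIV \<times> \<phi> ` W) \<A> K"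
      using sub unfolding prod_atlas_std K_def .
    define Q where "Q = (UNIV \<times> \<phi> ` W) \<inter> K -` V"
    have Q: "open Q" unfolding Q_def
      by (rule continuous_open_preimage[OF smooth_map_onD(1)[OF K] _ V]) (use ch(2) in \<open>auto intro: open_Times\<close>)
    have "smooth_fun_on std_atlas Q (\<lambda>z. f (K z))"
      by (rule smooth_map_on_compose[OF chart_atlas_std M_charts smooth_map_on_subset[OF K] f]) (auto simp: Q_def)
    then have \<Psi>: "smooth_on Q (\<lambda>z. f (K z))" unfolding smooth_map_on_std .
    have "\<forall>z. \<exists>d. z \<in> Q \<longrightarrow> ((\<lambda>z. f (K z)) has_derivative d) (at z)"
      using smooth_on_has_derivative_within[OF \<Psi>] at_within_open[OF _ Q] by metis
    then obtain \<Psi>' where \<Psi>': "\<And>z. z \<in> Q \<Longrightarrow> ((\<lambda>z. f (K z)) has_derivative \<Psi>' z) (at z)" by metis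
    define g where "g x = \<Psi>' (0, x) (1, 0)" for x
    have mem: "(0, x) \<in> Q" if "x \<in> \<phi> ` (V \<inter> W)" for x
      using that ci unfolding Q_def K_def by (auto simp: \<gamma>(2))
    have g: "smooth_on (\<phi> ` (V \<inter> W)) g" unfolding g_def
      by (rule smooth_on_compose[OF smooth_on_Pair[OF smooth_on_const smooth_on_bounded_linear[OF bounded_linear_ident]]
            smooth_on_has_derivative[OF \<Psi> Q \<Psi>']]) (assumption, rule image_subsetI, rule mem)
    have "smooth_map_on \<A> (V \<inter> W) std_atlas \<phi>"
      by (rule smooth_map_on_subset[OF smooth_map_on_chart[OF M_smooth_atlas W(1)]]) simp
    then have "smooth_fun_on \<A> (V \<inter> W) (\<lambda>q. g (\<phi> q))"
      by (rule smooth_map_on_compose[OF M_charts chart_atlas_std, where T = "\<phi> ` (V \<inter> W)"])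
        (simp_all add: smooth_map_on_std g)
    then have "smooth_fun_on \<A> (V \<inter> W) (\<lambda>q. X A q f)"
    proof (rule smooth_map_on_cong[OF M_charts])
      fix q assume q: "q \<in> V \<inter> W"
      have "((\<lambda>u. (u, \<phi> q)) has_derivative (\<lambda>u. (u, 0))) (at 0)" by (auto intro!: derivative_eq_intros)
      from has_derivative_compose[OF this \<Psi>'[OF mem[of "\<phi> q"]]] q
      have "((\<lambda>u. f (K (u, \<phi> q))) has_derivative (\<lambda>u. \<Psi>' (0, \<phi> q) (u, 0))) (at 0)" by blast
      from has_derivative_imp_has_vector_derivative[OF this]
      have 1: "((\<lambda>u. f (act (\<gamma> u) q)) has_vector_derivative g (\<phi> q)) (at 0)"
        using q ci unfolding g_def K_def by simp
      have sn: "smooth_near \<A> q f" using q V f by (intro smooth_nearI) auto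
      from vector_derivative_unique_at[OF 1 generated_vf_curve_derivative[OF A \<gamma>(1-3) sn]]
      show "g (\<phi> q) = X A q f" unfolding generated_vf_apply[OF A] using sn by simp
    qed
    then show "\<exists>W. open W \<and> p \<in> W \<and> smooth_fun_on \<A> (V \<inter> W) (\<lambda>p. X A p f)"
      using ch(1) W(2) by blast
  qed
qed

end

section \<open>The prequantization operator in a trivialisation\<close>

text \<open>At a point \<open>m\<close> of the segment where the norm of \<open>z\<close> is
  maximal, the mean value inequality bounds it by \<open>B * \<bar>m - s\<bar>\<close> times itself,
  hence by half of itself. The smallness premise stands in for an exponential Gronwall estimate;
  larger intervals are covered by connectedness.\<close>

lemma linear_ode_zero:
  fixes z :: "real \<Rightarrow> complex"
  assumes J: "is_interval J" and B: "0 \<le> B"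
    and z: "\<And>t. t \<in> J \<Longrightarrow> (z has_vector_derivative k t * z t) (at t within J)"
    and k: "\<And>t. t \<in> J \<Longrightarrow> norm (k t) \<le> B"
    and small: "\<And>s t. s \<in> J \<Longrightarrow> t \<in> J \<Longrightarrow> B * \<bar>s - t\<bar> \<le> 1/2"
    and st: "s \<in> J" "t \<in> J" "z s = 0"
  shows "z t = 0"
proof -
  let ?S = "closed_segment s t"
  have sub: "?S \<subseteq> J"
    by (rule closed_segment_subset) (use st J in \<open>simp_all add: is_interval_convex_1\<close>)
  have dz: "(z has_vector_derivative k u * z u) (at u within ?S)" if "u \<in> ?S" for u
    using has_vector_derivative_within_subset[OF z sub] that sub by blast
  have "continuous_on ?S z"
    unfolding continuous_on_eq_continuous_within
    using has_vector_derivative_continuous[OF dz] by blast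
  then have "continuous_on ?S (\<lambda>u. norm (z u))" by (rule continuous_on_norm)
  then obtain m where m: "m \<in> ?S" "\<And>u. u \<in> ?S \<Longrightarrow> norm (z u) \<le> norm (z m)"
    using continuous_attains_sup[of ?S "\<lambda>u. norm (z u)"] by fastforce
  have "norm (z m - z s) \<le> (B * norm (z m)) * norm (m - s)"
  proof (rule differentiable_bound[where S = ?S and f' = "\<lambda>u x. x *\<^sub>R (k u * z u)"])
    show "(z has_derivative (\<lambda>x. x *\<^sub>R (k u * z u))) (at u within ?S)" if "u \<in> ?S" for u
      using dz[OF that] unfolding has_vector_derivative_def .
    show "onorm (\<lambda>x. x *\<^sub>R (k u * z u)) \<le> B * norm (z m)" if u: "u \<in> ?S" for u
    proof (rule onorm_bound)
      fix x :: real
      have "norm (k u * z u) \<le> B * norm (z m)"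
        unfolding norm_mult using k[of u] m(2)[OF u] u sub B by (intro mult_mono) auto
      then show "norm (x *\<^sub>R (k u * z u)) \<le> B * norm (z m) * norm x"
        using mult_left_mono[of "norm (k u * z u)" "B * norm (z m)" "\<bar>x\<bar>"] by (simp add: mult.commute)
    qed (use B in simp)
  qed (use m(1) in auto)
  also have "\<dots> = (B * \<bar>m - s\<bar>) * norm (z m)" by simp
  also have "\<dots> \<le> 1/2 * norm (z m)"
    by (rule mult_right_mono[OF small]) (use m(1) sub st in auto)
  finally have "norm (z m) \<le> 0" using st(3) by simp
  then show ?thesis using m(2)[of t] by simp
qed

context prequantum_action
begin

section \<open>Local frames and the connection in a trivialisation\<close>

lemma trivialisationD:
  assumes "(U, \<theta>) \<in> lb_trivs L"
  shows "open U"
    and "q \<in> U \<Longrightarrow> bij_betw \<theta> (fibre L q) UNIV"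
    and "q \<in> U \<Longrightarrow> x \<in> fibre L q \<Longrightarrow> y \<in> fibre L q \<Longrightarrow> lb_add L x y \<in> fibre L q \<and> \<theta> (lb_add L x y) = \<theta> x + \<theta> y"
    and "q \<in> U \<Longrightarrow> x \<in> fibre L q \<Longrightarrow> lb_scale L c x \<in> fibre L q \<and> \<theta> (lb_scale L c x) = c * \<theta> x"
proof -
  have *: "open U \<and> (\<forall>q\<in>U.
        bij_betw \<theta> (fibre L q) UNIV \<and>
        (\<forall>x\<in>fibre L q. \<forall>y\<in>fibre L q.
           lb_add L x y \<in> fibre L q \<and> \<theta> (lb_add L x y) = \<theta> x + \<theta> y) \<and>
        (\<forall>c. \<forall>x\<in>fibre L q. lb_scale L c x \<in> fibre L q \<and> \<theta> (lb_scale L c x) = c * \<theta> x))"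
    using bspec[OF conjunct1[OF conjunct2[OF line_bundle[unfolded complex_line_bundle_def]]] assms]
    unfolding prod.case .
  show "open U" using * by (rule conjunct1)
  fix q assume "q \<in> U"
  note ** = bspec[OF conjunct2[OF *] this]
  show "bij_betw \<theta> (fibre L q) UNIV" using ** by (rule conjunct1)
  show "lb_add L x y \<in> fibre L q \<and> \<theta> (lb_add L x y) = \<theta> x + \<theta> y" if "x \<in> fibre L q" "y \<in> fibre L q" for x y
    using bspec[OF bspec[OF conjunct1[OF conjunct2[OF **]] that(1)] that(2)] .
  show "lb_scale L c x \<in> fibre L q \<and> \<theta> (lb_scale L c x) = c * \<theta> x" if "x \<in> fibre L q" for x c
    using bspec[OF spec[OF conjunct2[OF conjunct2[OF **]]] that] .
qed

lemma trivialisation_cover: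
  obtains U \<theta> where "(U, \<theta>) \<in> lb_trivs L" "q \<in> U"
  using spec[OF conjunct1[OF line_bundle[unfolded complex_line_bundle_def]], of q] by blast

lemma trivialisation_eqI:
  assumes "(U, \<theta>) \<in> lb_trivs L" "q \<in> U" "x \<in> fibre L q" "y \<in> fibre L q" "\<theta> x = \<theta> y"
  shows "x = y"
  using bij_betw_imp_inj_on[OF trivialisationD(2)[OF assms(1,2)]] assms(3-5) by (metis inj_onD)

text \<open>The local frame belonging to the trivialisation; it is meaningful only over the domain
  of \<open>\<theta>\<close>.\<close>

definition unit_section :: "('l \<Rightarrow> complex) \<Rightarrow> 'm \<Rightarrow> 'l" where
  "unit_section \<theta> q = inv_into (fibre L q) \<theta> 1"

lemma unit_section:
  assumes "(U, \<theta>) \<in> lb_trivs L" "q \<in> U"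
  shows "unit_section \<theta> q \<in> fibre L q" "\<theta> (unit_section \<theta> q) = 1"
proof -
  have 1: "1 \<in> \<theta> ` fibre L q"
    using bij_betw_imp_surj_on[OF trivialisationD(2)[OF assms]] by simp
  show "unit_section \<theta> q \<in> fibre L q" "\<theta> (unit_section \<theta> q) = 1"
    unfolding unit_section_def using inv_into_into[OF 1] f_inv_into_f[OF 1] by simp_all
qed

lemma smooth_unit_section:
  assumes "(U, \<theta>) \<in> lb_trivs L"
  shows "smooth_section_on \<A> L U (unit_section \<theta>)"
proof -
  have "smooth_fun_on \<A> (U \<inter> V) (\<lambda>q. \<psi> (unit_section \<theta> q))" if "(V, \<psi>) \<in> lb_trivs L" for V \<psi>
    using bspec[OF bspec[OF conjunct2[OF conjunct2[OF line_bundle[unfolded complex_line_bundle_def]]] assms, unfolded prod.case] that]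
    unfolding prod.case unit_section_def .
  then show ?thesis unfolding smooth_section_on_def using unit_section(1)[OF assms] by blast
qed

lemma smooth_sectionsD:
  assumes "s \<in> smooth_sections \<A> L"
  shows "s q \<in> fibre L q"
    and "(U, \<theta>) \<in> lb_trivs L \<Longrightarrow> smooth_fun_on \<A> U (\<lambda>q. \<theta> (s q))"
    and "section_near \<A> L q s"
proof -
  have *: "smooth_section_on \<A> L UNIV s" using assms by (simp add: smooth_sections_def)
  show "s q \<in> fibre L q" using * by (simp add: smooth_section_on_def)
  show "smooth_fun_on \<A> U (\<lambda>q. \<theta> (s q))" if "(U, \<theta>) \<in> lb_trivs L"
    using * that unfolding smooth_section_on_def by fastforce
  show "section_near \<A> L q s" unfolding section_near_def using * by blast
qed

lemma connectionD:
  assumes "section_near \<A> L q s" "v \<in> tangent_space \<A> q"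
  shows "D q v s \<in> fibre L q"
    and "w \<in> tangent_space \<A> q \<Longrightarrow> D q (tadd (tscale a v) (tscale b w)) s
               = lb_add L (lb_scale L (of_real a) (D q v s)) (lb_scale L (of_real b) (D q w s))"
    and "smooth_near \<A> q f \<Longrightarrow> D q v (\<lambda>p. lb_scale L (f p) (s p))
               = lb_add L (lb_scale L (tvec_complex v f) (s q)) (lb_scale L (f q) (D q v s))"
    and "section_near \<A> L q r \<Longrightarrow> open W \<Longrightarrow> q \<in> W \<Longrightarrow> (\<And>p. p \<in> W \<Longrightarrow> r p = s p) \<Longrightarrow> D q v r = D q v s"
proof -
  note * = bspec[OF mp[OF spec[OF spec[OF conjunct1[OF connection[unfolded connection_def]]]] assms(1)] assms(2)]
  show "D q v s \<in> fibre L q" using * by (rule conjunct1)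
  show "D q (tadd (tscale a v) (tscale b w)) s
               = lb_add L (lb_scale L (of_real a) (D q v s)) (lb_scale L (of_real b) (D q w s))"
    if "w \<in> tangent_space \<A> q"
    using bspec[OF conjunct1[OF conjunct2[OF *]] that] by blast
  show "D q v (\<lambda>p. lb_scale L (f p) (s p))
               = lb_add L (lb_scale L (tvec_complex v f) (s q)) (lb_scale L (f q) (D q v s))" if "smooth_near \<A> q f"
    using mp[OF spec[OF conjunct1[OF conjunct2[OF conjunct2[OF conjunct2[OF *]]]]] that] .
  show "D q v r = D q v s" if "section_near \<A> L q r" "open W" "q \<in> W" "\<And>p. p \<in> W \<Longrightarrow> r p = s p"
    using mp[OF spec[OF conjunct2[OF conjunct2[OF conjunct2[OF conjunct2[OF *]]]]] that(1)] that(2-4) by blast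
qed

text \<open>Over \<open>U\<close> the section is its coordinate times the frame, so the Leibniz rule
  applies; the last summand carries the connection form. The two sections agree only on
  \<open>U\<close>, so locality of the connection is used to exchange them.\<close>

lemma connection_trivialised:
  assumes s: "s \<in> smooth_sections \<A> L" and U: "(U, \<theta>) \<in> lb_trivs L" "q \<in> U" and v: "v \<in> tangent_space \<A> q"
  shows "\<theta> (D q v s) = tvec_complex v (\<lambda>p. \<theta> (s p)) + \<theta> (s q) * \<theta> (D q v (unit_section \<theta>))"
proof -
  note oU = trivialisationD(1)[OF U(1)]
  have un: "section_near \<A> L q (unit_section \<theta>)"
    unfolding section_near_def using oU U(2) smooth_unit_section[OF U(1)] by blast
  have f: "smooth_near \<A> q (\<lambda>p. \<theta> (s p))"
    by (rule smooth_nearI[OF oU U(2) smooth_sectionsD(2)[OF s U(1)]])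
  let ?r = "\<lambda>p. lb_scale L (\<theta> (s p)) (unit_section \<theta> p)"
  have eq: "s p = ?r p" if p: "p \<in> U" for p
    using trivialisationD(4)[OF U(1) p unit_section(1)[OF U(1) p]] unit_section(2)[OF U(1) p]
    by (intro trivialisation_eqI[OF U(1) p smooth_sectionsD(1)[OF s]]) simp_all
  have "smooth_section_on \<A> L U ?r"
    unfolding smooth_section_on_def
  proof (intro conjI ballI)
    show "?r p \<in> fibre L p" if "p \<in> U" for p
      using eq[OF that] smooth_sectionsD(1)[OF s, of p] by simp
    show "case V\<psi> of (V, \<psi>) \<Rightarrow> smooth_fun_on \<A> (U \<inter> V) (\<lambda>q. \<psi> (?r q))" if "V\<psi> \<in> lb_trivs L" for V\<psi>
    proof (cases V\<psi>)
      case (Pair V \<psi>)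
      have "smooth_fun_on \<A> (U \<inter> V) (\<lambda>q. \<psi> (s q))"
        by (rule smooth_map_on_subset[OF smooth_sectionsD(2)[OF s]]) (use that Pair in auto)
      then have "smooth_fun_on \<A> (U \<inter> V) (\<lambda>q. \<psi> (?r q))"
        by (rule smooth_map_on_cong[OF M_charts]) (use eq in auto)
      then show ?thesis unfolding Pair prod.case .
    qed
  qed
  then have rn: "section_near \<A> L q ?r" unfolding section_near_def using oU U(2) by blast
  have "D q v s = D q v ?r"
    by (rule connectionD(4)[OF rn v smooth_sectionsD(3)[OF s] oU U(2)]) (rule eq)
  also have "\<dots> = lb_add L (lb_scale L (tvec_complex v (\<lambda>p. \<theta> (s p))) (unit_section \<theta> q))
      (lb_scale L (\<theta> (s q)) (D q v (unit_section \<theta>)))"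
    by (rule connectionD(3)[OF un v f])
  finally have 1: "D q v s = \<dots>" .
  note sc = trivialisationD(4)[OF U]
  note u1 = sc[OF unit_section(1)[OF U], of "tvec_complex v (\<lambda>p. \<theta> (s p))"]
    and u2 = sc[OF connectionD(1)[OF un v], of "\<theta> (s q)"]
  show ?thesis
    unfolding 1 conjunct2[OF trivialisationD(3)[OF U conjunct1[OF u1] conjunct1[OF u2]]]
      conjunct2[OF u1] conjunct2[OF u2] unit_section(2)[OF U] by simp
qed

text \<open>In a trivialisation the prequantization operator is minus the derivative along the generated
  vector field minus multiplication by this function.\<close>

definition symbol :: "('l \<Rightarrow> complex) \<Rightarrow> 'm \<Rightarrow> 'g tvec \<Rightarrow> complex" where
  "symbol \<theta> q A = \<theta> (D q (X A q) (unit_section \<theta>)) + 2 * of_real pi * \<i> * of_real (\<Phi> q A)"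

lemma prequantization_trivialised:
  assumes s: "s \<in> smooth_sections \<A> L" and U: "(U, \<theta>) \<in> lb_trivs L" "q \<in> U" and A: "A \<in> lie_algebra G \<G>"
  shows "\<theta> (prequantization G \<G> \<A> act \<Phi> L D A s q)
    = - tvec_complex (X A q) (\<lambda>p. \<theta> (s p)) - symbol \<theta> q A * \<theta> (s q)"
proof -
  note v = generated_vf_tangent[OF A, of q]
  note sc = trivialisationD(4)[OF U]
  note u1 = sc[OF connectionD(1)[OF smooth_sectionsD(3)[OF s] v], of "-1"]
    and u2 = sc[OF smooth_sectionsD(1)[OF s], of "- 2 * of_real pi * \<i> * of_real (\<Phi> q A)"]
  show ?thesis
    unfolding prequantization_def conjunct2[OF trivialisationD(3)[OF U conjunct1[OF u1] conjunct1[OF u2]]]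
      conjunct2[OF u1] conjunct2[OF u2] connection_trivialised[OF s U v] symbol_def
    by (simp add: algebra_simps)
qed

lemma continuous_symbol:
  assumes U: "(U, \<theta>) \<in> lb_trivs L" and A: "A \<in> lie_algebra G \<G>"
  shows "continuous_on U (\<lambda>q. symbol \<theta> q A)"
proof -
  have "smooth_section_on \<A> L U (\<lambda>q. D q (X A q) (unit_section \<theta>))"
    using conjunct2[OF connection[unfolded connection_def]] trivialisationD(1)[OF U]
      smooth_generated_vf[OF A] smooth_unit_section[OF U] by blast
  then have "smooth_fun_on \<A> (U \<inter> U) (\<lambda>q. \<theta> (D q (X A q) (unit_section \<theta>)))"
    using U unfolding smooth_section_on_def by blast
  then have 1: "continuous_on U (\<lambda>q. \<theta> (D q (X A q) (unit_section \<theta>)))"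
    unfolding Int_absorb by (rule smooth_map_onD(1))
  have 2: "continuous_on U (\<lambda>q. \<Phi> q A)"
    by (rule continuous_on_subset[OF smooth_map_onD(1)[OF moment_smooth[OF A]]]) simp
  show ?thesis unfolding symbol_def by (intro continuous_intros 1 2)
qed

text \<open>Membership of the combination in the Lie algebra is a premise; in
  \<open>continuous_symbol_orbit\<close> it is supplied by the parametrisation \<open>E\<close>, all
  of whose values lie there.\<close>

lemma symbol_linear:
  assumes U: "(U, \<theta>) \<in> lb_trivs L" "q \<in> U"
    and AB: "A \<in> lie_algebra G \<G>" "B \<in> lie_algebra G \<G>" "tadd (tscale a A) (tscale b B) \<in> lie_algebra G \<G>"
  shows "symbol \<theta> q (tadd (tscale a A) (tscale b B)) = of_real a * symbol \<theta> q A + of_real b * symbol \<theta> q B"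
proof -
  have un: "section_near \<A> L q (unit_section \<theta>)"
    unfolding section_near_def using trivialisationD(1)[OF U(1)] U(2) smooth_unit_section[OF U(1)] by blast
  note v = generated_vf_tangent[OF AB(1), of q] and w = generated_vf_tangent[OF AB(2), of q]
  note u1 = trivialisationD(4)[OF U connectionD(1)[OF un v], of "of_real a"]
    and u2 = trivialisationD(4)[OF U connectionD(1)[OF un w], of "of_real b"]
  show ?thesis
    unfolding symbol_def generated_vf_linear[OF AB] connectionD(2)[OF un v w] moment_linear[OF AB(1,2)]
      conjunct2[OF trivialisationD(3)[OF U conjunct1[OF u1] conjunct1[OF u2]]] conjunct2[OF u1] conjunct2[OF u2]
    by (simp add: algebra_simps)
qed

end

section \<open>Evolution along a Lax curve\<close>

locale lax_curve = prequantum_action G \<G> \<A> act \<Phi> L D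
  for G :: "('g::{t2_space, second_countable_topology}) monoid" (structure)
    and \<G> :: "('g, 'a::finite_dim_normed_space) atlas"
    and \<A> :: "('m::{t2_space, second_countable_topology}, 'e::finite_dim_normed_space) atlas"
    and act :: "'g \<Rightarrow> 'm \<Rightarrow> 'm"
    and \<Phi> :: "'m \<Rightarrow> 'g tvec \<Rightarrow> real"
    and L :: "('m, 'l) line_bundle"
    and D :: "'m \<Rightarrow> 'm tvec \<Rightarrow> ('m \<Rightarrow> 'l) \<Rightarrow> 'l" +
  fixes I :: "real set" and A :: "real \<Rightarrow> 'g tvec" and h :: "real \<Rightarrow> 'g"
    and \<rho> :: "'g \<Rightarrow> ('m \<Rightarrow> 'l) \<Rightarrow> 'm \<Rightarrow> 'l"
  assumes I: "is_interval I" "0 \<in> I" "I \<noteq> {0}"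
    and A_curve: "smooth_lie_algebra_curve G \<G> I A"
    and lax: "lax_solution G \<G> I A h"
    and invariant: "invariant_prequantum_data G \<G> \<A> act \<Phi> L D \<rho>"
begin

section \<open>Orbits of the Lax curve\<close>

lemma within_I: "t \<in> I \<Longrightarrow> at t within I \<noteq> bot"
  by (rule interval_at_within_nontrivial[OF I])

lemma A_mem: "t \<in> I \<Longrightarrow> A t \<in> lie_algebra G \<G>"
  using A_curve unfolding smooth_lie_algebra_curve_def by blast

lemma h_smooth: "smooth_map_on std_atlas I \<G> h" and h_zero: "h 0 = \<one>"
  using lax unfolding lax_solution_def by blast+

text \<open>Unfolding the pushforward: right translation by \<open>inv (h t)\<close> is absorbed
  into the test function, which is evaluated at the identity when \<open>u\<close> equals
  \<open>t\<close>.\<close>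

lemma lax_derivative:
  assumes t: "t \<in> I" and f: "smooth_near \<G> \<one> f"
  shows "((\<lambda>u. f (h u \<otimes> inv (h t))) has_vector_derivative A t f) (at t within I)"
proof -
  have f1: "smooth_near \<G> (h t \<otimes> inv (h t)) f" using f by simp
  have "A t f = pushforward \<G> (\<lambda>x. x \<otimes> inv (h t)) (h t) (velocity \<G> I h t) f"
    using lax t unfolding lax_solution_def by simp
  also have "\<dots> = velocity \<G> I h t (\<lambda>x. f (x \<otimes> inv (h t)))"
    unfolding pushforward_def using f1 by (simp add: comp_def)
  finally show ?thesis
    using velocity_has_vector_derivative[OF charts h_smooth t within_I[OF t] smooth_near_mult_right[OF f1]] by simp
qed

lemma orbit_smooth: "smooth_map_on std_atlas I \<A> (\<lambda>u. act (h u) q)"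
  by (rule smooth_act[OF chart_atlas_std h_smooth smooth_map_on_const])

text \<open>Writing \<open>h u\<close> as \<open>(h u \<otimes> inv (h t)) \<otimes> h t\<close>
  reduces the motion of the orbit to a curve through the identity acting on the fixed point
  \<open>act (h t) q\<close>.\<close>

lemma orbit_derivative:
  assumes t: "t \<in> I" and f: "smooth_near \<A> (act (h t) q) f"
  shows "((\<lambda>u. f (act (h u) q)) has_vector_derivative X (A t) (act (h t) q) f) (at t within I)"
proof -
  have "((\<lambda>u. f (act (h u \<otimes> inv (h t)) (act (h t) q))) has_vector_derivative
      A t (\<lambda>g. f (act g (act (h t) q)))) (at t within I)"
    by (rule lax_derivative[OF t smooth_near_act]) (simp add: f)
  moreover have "act (h u \<otimes> inv (h t)) (act (h t) q) = act (h u) q" for u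
    by (simp add: act_mult[symmetric] m_assoc)
  ultimately show ?thesis unfolding generated_vf_apply[OF A_mem[OF t]] using f by simp
qed

text \<open>The time dependence of the section and the motion of the point are separated into two
  times. The evolution equation contributes minus the derivative along \<open>X (A t)\<close> minus
  the \<open>symbol\<close> term, the moving point contributes plus that derivative, and only the
  \<open>symbol\<close> term survives on the diagonal.\<close>

lemma characteristic_equation:
  assumes \<sigma>: "prequantum_evolution G \<G> \<A> act \<Phi> L D I A \<tau> \<sigma>"
    and U: "(U, \<theta>) \<in> lb_trivs L" and t: "t \<in> I" "act (h t) q \<in> U"
  shows "((\<lambda>u. \<theta> (\<sigma> u (act (h u) q))) has_vector_derivative
    - symbol \<theta> (act (h t) q) (A t) * \<theta> (\<sigma> t (act (h t) q))) (at t within I)"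
proof -
  let ?q = "act (h t) q"
  have family: "\<And>t. t \<in> I \<Longrightarrow> \<sigma> t \<in> smooth_sections \<A> L"
      "smooth_fun_on (prod_atlas std_atlas \<A>) (I \<times> U) (\<lambda>(x, q). \<theta> (\<sigma> x q))"
    and deriv: "has_section_derivative L \<sigma> (prequantization G \<G> \<A> act \<Phi> L D (A t) (\<sigma> t)) (at t within I)"
    using \<sigma> U t(1) unfolding prequantum_evolution_def smooth_section_family_def by blast+
  obtain N where N: "open N" "N \<inter> I = (\<lambda>u. act (h u) q) -` U \<inter> I"
    using continuous_on_open_invariant[THEN iffD1, OF smooth_map_onD(1)[OF orbit_smooth], rule_format,
        OF trivialisationD(1)[OF U]] by blast
  have tN: "t \<in> N" using N(2) t by blast
  define H where "H p = \<theta> (\<sigma> (fst p) (act (h (snd p)) q))" for p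
  let ?J = "I \<inter> N"
  have "smooth_map_on std_atlas (?J \<times> ?J) (prod_atlas std_atlas \<A>) (\<lambda>p. (fst p, act (h (snd p)) q))"
  proof (rule smooth_map_on_Pair)
    show "smooth_map_on std_atlas (?J \<times> ?J) std_atlas (fst :: real \<times> real \<Rightarrow> real)"
      unfolding smooth_map_on_std by (rule smooth_on_bounded_linear[OF bounded_linear_fst])
    have "smooth_map_on std_atlas ?J \<A> (\<lambda>u. act (h u) q)"
      by (rule smooth_map_on_subset[OF orbit_smooth]) blast
    from smooth_map_on_snd[OF chart_atlas_std chart_atlas_std this, of ?J]
    show "smooth_map_on std_atlas (?J \<times> ?J) \<A> (\<lambda>p :: real \<times> real. act (h (snd p)) q)"
      unfolding prod_atlas_std .
  qed
  then have "smooth_map_on std_atlas (?J \<times> ?J) std_atlas (\<lambda>p. (\<lambda>(x, q). \<theta> (\<sigma> x q)) (fst p, act (h (snd p)) q))"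
    by (rule smooth_map_on_compose[OF chart_atlas_std chart_atlas_prod[OF chart_atlas_std M_charts] _ family(2)])
      (use N(2) in auto)
  then have H: "smooth_on (?J \<times> ?J) H" unfolding smooth_map_on_std H_def by simp
  have d1: "((\<lambda>s. H (s, t)) has_vector_derivative \<theta> (prequantization G \<G> \<A> act \<Phi> L D (A t) (\<sigma> t) ?q)) (at t within I)"
    using deriv U t(2) unfolding has_section_derivative_def H_def by fastforce
  have sn: "smooth_near \<A> ?q (\<lambda>p. \<theta> (\<sigma> t p))"
    by (rule smooth_nearI[OF trivialisationD(1)[OF U] t(2) smooth_sectionsD(2)[OF family(1)[OF t(1)] U]])
  have "((\<lambda>s. \<theta> (\<sigma> t (act (h s) q))) has_vector_derivative tvec_complex (X (A t) ?q) (\<lambda>p. \<theta> (\<sigma> t p))) (at t within I)"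
    by (rule complex_curve_derivative[OF M_charts orbit_smooth t(1) sn _ within_I[OF t(1)]])
      (rule orbit_derivative[OF t(1)])
  then have d2: "((\<lambda>s. H (t, s)) has_vector_derivative tvec_complex (X (A t) ?q) (\<lambda>p. \<theta> (\<sigma> t p))) (at t within I)"
    unfolding H_def by simp
  from diagonal_derivative[OF H N(1) tN t(1) within_I[OF t(1)] d1 d2]
  show ?thesis
    unfolding prequantization_trivialised[OF family(1)[OF t(1)] U t(2) A_mem[OF t(1)]] H_def by simp
qed

text \<open>Both the point and the Lie algebra element vary, while \<open>continuous_symbol\<close>
  fixes the latter. Expanding \<open>A t\<close> in coordinates leaves fixed elements
  \<open>E b\<close>, with coefficients that are smooth because they are evaluations of
  \<open>A t\<close> on functions smooth near the identity.\<close>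

lemma continuous_symbol_orbit:
  assumes U: "(U, \<theta>) \<in> lb_trivs L"
  shows "continuous_on {t \<in> I. act (h t) q \<in> U} (\<lambda>t. symbol \<theta> (act (h t) q) (A t))"
proof -
  obtain W \<phi> where W: "(W, \<phi>) \<in> \<G>" "\<one> \<in> W" using chart_atlas_cover[OF charts] by blast
  obtain E where E: "\<And>w. E w \<in> lie_algebra G \<G>"
    "\<And>a b v w. E (a *\<^sub>R v + b *\<^sub>R w) = tadd (tscale a (E v)) (tscale b (E w))"
    "\<And>A. A \<in> lie_algebra G \<G> \<Longrightarrow> A = E (\<Sum>b\<in>fd_basis. A (\<lambda>g. fd_coord b (\<phi> g)) *\<^sub>R b)"
    using lie_algebra_coordinates[OF W] by blast
  let ?T = "{t \<in> I. act (h t) q \<in> U}"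
  have lin: "linear (\<lambda>w. symbol \<theta> p (E w))" if p: "p \<in> U" for p
  proof -
    have *: "symbol \<theta> p (E (a *\<^sub>R v + b *\<^sub>R w)) = of_real a * symbol \<theta> p (E v) + of_real b * symbol \<theta> p (E w)" for a b v w
      using symbol_linear[OF U p E(1) E(1), of a v b w] E(1)[of "a *\<^sub>R v + b *\<^sub>R w"] unfolding E(2) by blast
    show ?thesis
    proof (rule linearI)
      show "symbol \<theta> p (E (v + w)) = symbol \<theta> p (E v) + symbol \<theta> p (E w)" for v w
        using *[of 1 v 1 w] by simp
      show "symbol \<theta> p (E (r *\<^sub>R v)) = r *\<^sub>R symbol \<theta> p (E v)" for r v
        using *[of r v 0 v] by (simp add: scaleR_conv_of_real)
    qed
  qed
  have expand: "symbol \<theta> (act (h t) q) (A t)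
      = (\<Sum>b\<in>fd_basis. A t (\<lambda>g. fd_coord b (\<phi> g)) *\<^sub>R symbol \<theta> (act (h t) q) (E b))" if t: "t \<in> ?T" for t
  proof -
    have tI: "t \<in> I" and tU: "act (h t) q \<in> U" using t by blast+
    have "symbol \<theta> (act (h t) q) (A t)
        = symbol \<theta> (act (h t) q) (E (\<Sum>b\<in>fd_basis. A t (\<lambda>g. fd_coord b (\<phi> g)) *\<^sub>R b))"
      using E(3)[OF A_mem[OF tI]] by (rule arg_cong)
    also have "\<dots> = (\<Sum>b\<in>fd_basis. A t (\<lambda>g. fd_coord b (\<phi> g)) *\<^sub>R symbol \<theta> (act (h t) q) (E b))"
      by (simp add: linear_sum[OF lin[OF tU]] linear_cmul[OF lin[OF tU]])
    finally show ?thesis .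
  qed
  have "continuous_on ?T (\<lambda>t. \<Sum>b\<in>fd_basis. A t (\<lambda>g. fd_coord b (\<phi> g)) *\<^sub>R symbol \<theta> (act (h t) q) (E b))"
  proof (intro continuous_on_sum continuous_on_scaleR)
    fix b
    have "smooth_near \<G> \<one> (\<lambda>g. fd_coord b (\<phi> g))"
      by (rule smooth_near_linear[OF charts bounded_linear_fd_coord smooth_near_chart[OF smooth_atlas W]])
    then have "smooth_on I (\<lambda>t. A t (\<lambda>g. fd_coord b (\<phi> g)))"
      using A_curve unfolding smooth_lie_algebra_curve_def by blast
    then show "continuous_on ?T (\<lambda>t. A t (\<lambda>g. fd_coord b (\<phi> g)))"
      by (intro continuous_on_subset[OF smooth_on_imp_continuous_on]) auto
    have "continuous_on ?T (\<lambda>t. act (h t) q)"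
      by (rule continuous_on_subset[OF smooth_map_onD(1)[OF orbit_smooth]]) blast
    then show "continuous_on ?T (\<lambda>t. symbol \<theta> (act (h t) q) (E b))"
      by (rule continuous_on_compose2[OF continuous_symbol[OF U E(1)]]) blast
  qed
  then show ?thesis by (rule continuous_on_eq) (use expand in simp)
qed

text \<open>Along each orbit the difference of two solutions, read in a trivialisation, solves a
  homogeneous linear equation, so agreement spreads over short intervals in both directions and,
  \<open>I\<close> being connected, over all of \<open>I\<close>.\<close>

lemma evolution_unique:
  assumes \<sigma>: "prequantum_evolution G \<G> \<A> act \<Phi> L D I A \<tau> \<sigma>"
    and \<eta>: "prequantum_evolution G \<G> \<A> act \<Phi> L D I A \<tau> \<eta>" and t: "t \<in> I"
  shows "\<sigma> t = \<eta> t"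
proof -
  have sec: "\<sigma> t \<in> smooth_sections \<A> L" "\<eta> t \<in> smooth_sections \<A> L" if "t \<in> I" for t
    using \<sigma> \<eta> that unfolding prequantum_evolution_def smooth_section_family_def by blast+
  have eq: "\<sigma> t (act (h t) q) = \<eta> t (act (h t) q)" for q
  proof -
    \<comment> \<open>Agreement is stated in the fibre because the trivialisation has to change
      along the orbit.\<close>
    define P where "P t \<longleftrightarrow> \<sigma> t (act (h t) q) = \<eta> t (act (h t) q)" for t
    have "P 0 \<longleftrightarrow> P t"
    proof (rule connected_equivalence_relation[where R = "\<lambda>s t. P s \<longleftrightarrow> P t" and S = I])
      show "connected I" using I(1) by (simp add: is_interval_connected)
      fix a assume a: "a \<in> I"
      obtain U \<theta> where U: "(U, \<theta>) \<in> lb_trivs L" "act (h a) q \<in> U" using trivialisation_cover by blast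
      let ?k = "\<lambda>t. - symbol \<theta> (act (h t) q) (A t)"
      let ?T = "{t \<in> I. act (h t) q \<in> U}"
      obtain N where N: "open N" "N \<inter> I = (\<lambda>u. act (h u) q) -` U \<inter> I"
        using continuous_on_open_invariant[THEN iffD1, OF smooth_map_onD(1)[OF orbit_smooth], rule_format,
            OF trivialisationD(1)[OF U(1)]] by blast
      define B where "B = norm (?k a) + 1"
      have "continuous_on ?T ?k" by (intro continuous_on_minus continuous_symbol_orbit U(1))
      moreover have aT: "a \<in> ?T" using a U(2) by blast
      ultimately have "\<exists>d>0. \<forall>t\<in>?T. dist t a < d \<longrightarrow> dist (?k t) (?k a) < 1"
        unfolding continuous_on_iff using zero_less_one by blast
      then obtain d where d: "d > 0" "\<And>t. t \<in> ?T \<Longrightarrow> dist t a < d \<Longrightarrow> dist (?k t) (?k a) < 1" by blast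
      have "a \<in> N" using N(2) aT by blast
      then obtain e where e: "e > 0" "ball a e \<subseteq> N" using openE[OF N(1)] by blast
      have B: "0 < B" unfolding B_def by (simp add: add_nonneg_pos)
      \<comment> \<open>\<open>d\<close> keeps the coefficient bounded by \<open>B\<close>,
        \<open>e\<close> keeps the orbit in \<open>U\<close>, and points of \<open>?J\<close> are
        less than \<open>2 * r\<close> apart, which is at most \<open>1 / (2 * B)\<close>, the
        smallness that \<open>linear_ode_zero\<close> asks for.\<close>
      define r where "r = min (min d e) (1 / (4 * B))"
      have r: "0 < r" "r \<le> d" "r \<le> e" "r \<le> 1 / (4 * B)" unfolding r_def using d(1) e(1) B by auto
      let ?J = "I \<inter> ball a r"
      have JT: "u \<in> ?T" if u: "u \<in> ?J" for u
      proof -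
        have "u \<in> ball a e" using u r(3) by auto
        then have "u \<in> N \<inter> I" using u e(2) by blast
        then show ?thesis unfolding N(2) by blast
      qed
      have J: "is_interval ?J" using I(1) by (simp add: is_interval_convex_1 convex_Int)
      have bound: "norm (?k u) \<le> B" if u: "u \<in> ?J" for u
      proof -
        have "dist (?k u) (?k a) < 1" using d(2)[OF JT[OF u]] u r(2) by (simp add: dist_commute)
        then show ?thesis unfolding B_def dist_norm using norm_triangle_sub[of "?k u" "?k a"] by linarith
      qed
      have small: "B * \<bar>u - v\<bar> \<le> 1/2" if "u \<in> ?J" "v \<in> ?J" for u v
      proof -
        have "\<bar>u - v\<bar> \<le> 2 * (1 / (4 * B))" using that r(4) by (auto simp: dist_real_def)
        from mult_left_mono[OF this, of B] show ?thesis using B by simp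
      qed
      define z where "z u = \<theta> (\<sigma> u (act (h u) q)) - \<theta> (\<eta> u (act (h u) q))" for u
      have dz: "(z has_vector_derivative ?k u * z u) (at u within ?J)" if u: "u \<in> ?J" for u
      proof -
        have uI: "u \<in> I" "act (h u) q \<in> U" using JT[OF u] by auto
        from has_vector_derivative_diff[OF characteristic_equation[OF \<sigma> U(1) uI] characteristic_equation[OF \<eta> U(1) uI]]
        have "(z has_vector_derivative ?k u * z u) (at u within I)"
          unfolding z_def by (simp add: algebra_simps)
        then show ?thesis by (rule has_vector_derivative_within_subset) blast
      qed
      have Pz: "P u \<longleftrightarrow> z u = 0" if u: "u \<in> ?J" for u
      proof -
        have uI: "u \<in> I" "act (h u) q \<in> U" using JT[OF u] by auto
        show ?thesis
          using trivialisation_eqI[OF U(1) uI(2) smooth_sectionsD(1)[OF sec(1)[OF uI(1)]] smooth_sectionsD(1)[OF sec(2)[OF uI(1)]]]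
          unfolding P_def z_def by auto
      qed
      have zero: "z v = 0" if "u \<in> ?J" "v \<in> ?J" "z u = 0" for u v
        by (rule linear_ode_zero[OF J _ dz bound small that]) (use B in simp_all)
      have aJ: "a \<in> ?J" using a r(1) by simp
      have "\<forall>u\<in>?J. P a \<longleftrightarrow> P u" using zero Pz aJ by blast
      then show "\<exists>T. openin (top_of_set I) T \<and> a \<in> T \<and> (\<forall>x\<in>T. P a \<longleftrightarrow> P x)"
        using aJ by (intro exI[of _ ?J]) (simp add: openin_open_Int)
    qed (use I t in simp_all)
    moreover have "P 0" using \<sigma> \<eta> unfolding prequantum_evolution_def P_def by simp
    ultimately show ?thesis unfolding P_def by blast
  qed
  show ?thesis
  proof
    fix p
    \<comment> \<open>The characteristic started at \<open>act (inv (h t)) p\<close> arrives at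
      \<open>p\<close> at time \<open>t\<close>.\<close>
    have "act (h t) (act (inv (h t)) p) = p" by (simp add: act_mult[symmetric])
    then show "\<sigma> t p = \<eta> t p" using eq[of "act (inv (h t)) p"] by simp
  qed
qed

text \<open>With \<open>s\<close> the section at time \<open>t\<close>, the section at time
  \<open>u\<close> is \<open>\<rho> (h u \<otimes> inv (h t)) s\<close>. The value of
  \<open>\<rho> g s\<close> at a fixed point \<open>q\<close> is a smooth function of
  \<open>g\<close>, so its derivative along any curve through the identity with velocity
  \<open>A t\<close> is the same number; invariance identifies this number along the exponential
  curve.\<close>

lemma evolution_exists:
  assumes \<tau>: "\<tau> \<in> smooth_sections \<A> L"
  shows "prequantum_evolution G \<G> \<A> act \<Phi> L D I A \<tau> (\<lambda>t. \<rho> (h t) \<tau>)"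
proof -
  have \<rho>: "\<And>g s. s \<in> smooth_sections \<A> L \<Longrightarrow> \<rho> g s \<in> smooth_sections \<A> L"
    "\<And>s. s \<in> smooth_sections \<A> L \<Longrightarrow> \<rho> \<one> s = s"
    "\<And>g h s. s \<in> smooth_sections \<A> L \<Longrightarrow> \<rho> (g \<otimes> h) s = \<rho> g (\<rho> h s)"
    "\<And>s. s \<in> smooth_sections \<A> L \<Longrightarrow> smooth_section_family \<G> UNIV \<A> L (\<lambda>g. \<rho> g s)"
    "\<And>A s. A \<in> lie_algebra G \<G> \<Longrightarrow> s \<in> smooth_sections \<A> L \<Longrightarrow>
      has_section_derivative L (\<lambda>u. \<rho> (lie_exp G \<G> (tscale u A)) s) (prequantization G \<G> \<A> act \<Phi> L D A s) (at 0)"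
    using invariant unfolding invariant_prequantum_data_def by blast+
  have family: "smooth_fun_on (prod_atlas \<G> \<A>) (UNIV \<times> U) (\<lambda>(g, q). \<theta> (\<rho> g s q))"
    if "(U, \<theta>) \<in> lb_trivs L" "s \<in> smooth_sections \<A> L" for U \<theta> s
    using \<rho>(4)[OF that(2)] that(1) unfolding smooth_section_family_def by blast
  have "smooth_fun_on (prod_atlas std_atlas \<A>) (I \<times> U) (\<lambda>(t, q). \<theta> (\<rho> (h t) \<tau> q))"
    if U: "(U, \<theta>) \<in> lb_trivs L" for U \<theta>
  proof -
    have "smooth_map_on (prod_atlas std_atlas \<A>) (I \<times> U) (prod_atlas \<G> \<A>) (\<lambda>p. (h (fst p), snd p))"
      by (intro smooth_map_on_Pair smooth_map_on_fst[OF chart_atlas_std M_charts h_smooth]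
          smooth_map_on_snd[OF chart_atlas_std M_charts smooth_map_on_id[OF M_smooth_atlas]])
    then have "smooth_fun_on (prod_atlas std_atlas \<A>) (I \<times> U) (\<lambda>p. (\<lambda>(g, q). \<theta> (\<rho> g \<tau> q)) (h (fst p), snd p))"
      by (rule smooth_map_on_compose[OF chart_atlas_prod[OF chart_atlas_std M_charts]
          chart_atlas_prod[OF charts M_charts] _ family[OF U \<tau>]]) auto
    then show ?thesis by (simp add: case_prod_beta')
  qed
  then have "smooth_section_family std_atlas I \<A> L (\<lambda>t. \<rho> (h t) \<tau>)"
    unfolding smooth_section_family_def using \<rho>(1)[OF \<tau>] by blast
  moreover have "has_section_derivative L (\<lambda>t. \<rho> (h t) \<tau>)
      (prequantization G \<G> \<A> act \<Phi> L D (A t) (\<rho> (h t) \<tau>)) (at t within I)" if t: "t \<in> I" for t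
  proof -
    define s where "s = \<rho> (h t) \<tau>"
    have s: "s \<in> smooth_sections \<A> L" unfolding s_def by (rule \<rho>(1)[OF \<tau>])
    have "((\<lambda>u. \<theta> (\<rho> (h u) \<tau> q)) has_vector_derivative
        \<theta> (prequantization G \<G> \<A> act \<Phi> L D (A t) s q)) (at t within I)"
      if U: "(U, \<theta>) \<in> lb_trivs L" "q \<in> U" for q U \<theta>
    proof -
      \<comment> \<open>A complex function on the group; \<open>tvec_complex (A t) F\<close> is its
        derivative at the identity, computed once along \<open>\<gamma>\<close> and once along the
        Lax curve translated to the identity.\<close>
      define F where "F g = \<theta> (\<rho> g s q)" for g
      have "smooth_map_on \<G> UNIV (prod_atlas \<G> \<A>) (\<lambda>g. (g, q))"
        by (intro smooth_map_on_Pair smooth_id smooth_map_on_const)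
      then have "smooth_fun_on \<G> UNIV (\<lambda>g. (\<lambda>(g, q). \<theta> (\<rho> g s q)) (g, q))"
        by (rule smooth_map_on_compose[OF charts chart_atlas_prod[OF charts M_charts] _ family[OF U(1) s]])
          (use U(2) in auto)
      then have "smooth_fun_on \<G> UNIV F" unfolding F_def by simp
      then have F: "smooth_near \<G> g F" for g by (rule smooth_nearI[OF open_UNIV UNIV_I])
      obtain \<gamma> where \<gamma>: "smooth_map_on std_atlas UNIV \<G> \<gamma>" "\<gamma> 0 = \<one>" "velocity \<G> UNIV \<gamma> 0 = A t"
        "\<forall>u. lie_exp G \<G> (tscale u (A t)) = \<gamma> u" "\<forall>q. X (A t) q = velocity \<A> UNIV (\<lambda>u. act (\<gamma> u) q) 0"
        by (rule exp_curve[OF A_mem[OF t]])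
      have 1: "((\<lambda>u. F (\<gamma> u)) has_vector_derivative tvec_complex (A t) F) (at 0)"
        by (rule complex_curve_derivative[OF charts \<gamma>(1) UNIV_I F])
          (use velocity_has_vector_derivative[OF charts \<gamma>(1), of 0] in \<open>simp_all add: \<gamma>(3)\<close>)
      have "((\<lambda>u. F (\<gamma> u)) has_vector_derivative \<theta> (prequantization G \<G> \<A> act \<Phi> L D (A t) s q)) (at 0)"
        using \<rho>(5)[OF A_mem[OF t] s] U unfolding has_section_derivative_def F_def \<gamma>(4)[rule_format] by fastforce
      from vector_derivative_unique_at[OF 1 this]
      have eq: "tvec_complex (A t) F = \<theta> (prequantization G \<G> \<A> act \<Phi> L D (A t) s q)" .
      have sm: "smooth_map_on std_atlas I \<G> (\<lambda>u. h u \<otimes> inv (h t))"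
        by (rule smooth_mult[OF chart_atlas_std h_smooth smooth_map_on_const])
      have "((\<lambda>u. F (h u \<otimes> inv (h t))) has_vector_derivative tvec_complex (A t) F) (at t within I)"
        by (rule complex_curve_derivative[OF charts sm t F _ within_I[OF t]]) (simp add: lax_derivative[OF t])
      moreover have "F (h u \<otimes> inv (h t)) = \<theta> (\<rho> (h u) \<tau> q)" for u
        unfolding F_def s_def \<rho>(3)[OF \<tau>, symmetric] by (simp add: m_assoc)
      ultimately show ?thesis unfolding eq by simp
    qed
    then show ?thesis unfolding has_section_derivative_def s_def[symmetric] by blast
  qed
  moreover have "\<rho> (h 0) \<tau> = \<tau>" unfolding h_zero by (rule \<rho>(2)[OF \<tau>])
  ultimately show ?thesis unfolding prequantum_evolution_def by blast
qed

text \<open>A family is constrained only at times in \<open>I\<close>: smoothness and derivatives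
  are taken over and within \<open>I\<close>, and 0 lies in \<open>I\<close>. This allows arbitrary
  values of \<open>\<sigma>\<close> outside \<open>I\<close> in the final equivalence.\<close>

lemma evolution_cong:
  assumes \<eta>: "prequantum_evolution G \<G> \<A> act \<Phi> L D I A \<tau> \<eta>" and eq: "\<And>t. t \<in> I \<Longrightarrow> \<eta> t = \<sigma> t"
  shows "prequantum_evolution G \<G> \<A> act \<Phi> L D I A \<tau> \<sigma>"
proof -
  note e = \<eta>[unfolded prequantum_evolution_def smooth_section_family_def]
  have "smooth_fun_on (prod_atlas std_atlas \<A>) (I \<times> U) (\<lambda>(x, q). \<theta> (\<sigma> x q))"
    if U: "(U, \<theta>) \<in> lb_trivs L" for U \<theta>
  proof (rule smooth_map_on_cong[OF chart_atlas_prod[OF chart_atlas_std M_charts]])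
    show "smooth_fun_on (prod_atlas std_atlas \<A>) (I \<times> U) (\<lambda>(x, q). \<theta> (\<eta> x q))" using e U by blast
  qed (use eq in auto)
  then have "smooth_section_family std_atlas I \<A> L \<sigma>"
    unfolding smooth_section_family_def using e eq by fastforce
  moreover have "has_section_derivative L \<sigma> (prequantization G \<G> \<A> act \<Phi> L D (A t) (\<sigma> t)) (at t within I)"
    if t: "t \<in> I" for t
  proof -
    have "((\<lambda>t. \<theta> (\<sigma> t q)) has_vector_derivative \<theta> (prequantization G \<G> \<A> act \<Phi> L D (A t) (\<sigma> t) q)) (at t within I)"
      if "(U, \<theta>) \<in> lb_trivs L" "q \<in> U" for q U \<theta>
    proof (rule has_vector_derivative_transform[OF t])
      show "((\<lambda>t. \<theta> (\<eta> t q)) has_vector_derivative \<theta> (prequantization G \<G> \<A> act \<Phi> L D (A t) (\<sigma> t) q)) (at t within I)"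
        using e t that unfolding has_section_derivative_def eq[OF t, symmetric] by fastforce
    qed (simp add: eq)
    then show ?thesis unfolding has_section_derivative_def by blast
  qed
  moreover have "\<sigma> 0 = \<tau>" using e eq[OF I(2)] by simp
  ultimately show ?thesis unfolding prequantum_evolution_def by blast
qed

end

theorem theorem2:
  fixes G :: "('g::{t2_space, second_countable_topology}) monoid"
    and \<G> :: "('g, 'a::finite_dim_normed_space) atlas"
    and \<A> :: "('m::{t2_space, second_countable_topology}, 'e::finite_dim_normed_space) atlas"
    and \<omega> :: "'m \<Rightarrow> 'm tvec \<Rightarrow> 'm tvec \<Rightarrow> real"
    and act :: "'g \<Rightarrow> 'm \<Rightarrow> 'm"
    and \<Phi> :: "'m \<Rightarrow> 'g tvec \<Rightarrow> real"
    and L :: "('m, 'l) line_bundle"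
    and D :: "'m \<Rightarrow> 'm tvec \<Rightarrow> ('m \<Rightarrow> 'l) \<Rightarrow> 'l"
    and \<rho> :: "'g \<Rightarrow> ('m \<Rightarrow> 'l) \<Rightarrow> 'm \<Rightarrow> 'l"
    and I :: "real set"
    and A :: "real \<Rightarrow> 'g tvec"
    and h :: "real \<Rightarrow> 'g"
    and \<tau> :: "'m \<Rightarrow> 'l"
    and \<sigma> :: "real \<Rightarrow> 'm \<Rightarrow> 'l"
  assumes "compact_lie_group G \<G>"
    and "symplectic_manifold \<A> \<omega>"
    and "lie_group_action G \<G> \<A> act"
    and "\<And>g. symplectomorphism \<A> \<omega> (act g)"
    and "moment_map G \<G> \<A> act \<omega> \<Phi>"
    and "prequantum_bundle \<A> \<omega> L D"
    and "invariant_prequantum_data G \<G> \<A> act \<Phi> L D \<rho>"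
    and "is_interval I" and "0 \<in> I" and "I \<noteq> {0}"
    and "smooth_lie_algebra_curve G \<G> I A" and "A 0 = tzero"
    and "\<tau> \<in> smooth_sections \<A> L"
    and "lax_solution G \<G> I A h"
  shows "prequantum_evolution G \<G> \<A> act \<Phi> L D I A \<tau> \<sigma> \<longleftrightarrow> (\<forall>t\<in>I. \<sigma> t = \<rho> (h t) \<tau>)"
proof -
  interpret lax_curve G \<G> \<A> act \<Phi> L D I A h \<rho>
  proof
    show "lie_group G \<G>" using assms(1) unfolding compact_lie_group_def by blast
    show "smooth_atlas \<A>" using assms(2) unfolding symplectic_manifold_def by blast
    show "\<Phi> q (tadd (tscale a A) (tscale b B)) = a * \<Phi> q A + b * \<Phi> q B"
      if "A \<in> lie_algebra G \<G>" "B \<in> lie_algebra G \<G>" for q A B a b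
      using assms(5) that unfolding moment_map_def by blast
    show "smooth_fun_on \<A> UNIV (\<lambda>q. \<Phi> q A)" if "A \<in> lie_algebra G \<G>" for A
      using assms(5) that unfolding moment_map_def by blast
    show "complex_line_bundle \<A> L" "connection \<A> L D"
      using assms(6) unfolding prequantum_bundle_def by blast+
  qed (rule assms)+
  note solution = evolution_exists[OF assms(13)]
  show ?thesis
  proof
    show "\<forall>t\<in>I. \<sigma> t = \<rho> (h t) \<tau>" if "prequantum_evolution G \<G> \<A> act \<Phi> L D I A \<tau> \<sigma>"
      using evolution_unique[OF that solution] by blast
    show "prequantum_evolution G \<G> \<A> act \<Phi> L D I A \<tau> \<sigma>" if "\<forall>t\<in>I. \<sigma> t = \<rho> (h t) \<tau>"
      using evolution_cong[OF solution] that by simp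
  qed
qed

end
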